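(* Let $(R,\mathfrak m)$ be a commutative Noetherian local ring with $\operatorname{depth} R=t$, and let $M,N$ be finitely generated $R$-modules with $M\in \operatorname{Deep}(R)$ and $N\in \Omega\operatorname{Deep}(R)$. Assume that $\operatorname{Hom}_R(M,N)\in \operatorname{DF}(R)$ and $\operatorname{Ext}^i_R(M,N)=0$ for all $1\le i\le t-1$. Then $R$ is a direct summand of $N$.
   Context: All modules are finitely generated. For a Noetherian local ring $R$ with $\operatorname{depth} R=t$: - $\operatorname{Deep}(R)$ is the class of $R$-modules $X$ with $\operatorname{depth} X\ge t$ (the zero module has depth $\infty$). - $\Omega\operatorname{Deep}(R)$ is the class of $R$-modules $M$ for which there is an exact sequence $0\to M\to R^n\to X\to 0$ with $n\in\mathbb N$ and $X\in\operatorname{Deep}(R)$. - $\operatorname{DF}(R)$ is the class of $R$-modules $M$ for which there is an exact sequence $0\to R\to M^n\to X\to 0$ with $n\in\mathbb N$ and $X\in\operatorname{Deep}(R)$. *)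

theory Defs
  imports
    "HOL-Library.Extended_Nat"
    "HOL-Algebra.Ring_Divisibility"
    "HOL-Algebra.Module"
begin

text \<open>
  The fields \<open>mult\<close> and \<open>one\<close> of a module record play no role in module theory; in the
  constructions below they are left unspecified.
\<close>

locale noetherian_local_ring = cring R + noetherian_ring R for R (structure) +
  assumes unique_maximal: "\<exists>!I. maximalideal I R"

definition max_ideal :: "('r, 'x) ring_scheme \<Rightarrow> 'r set" where
  "max_ideal R = (THE I. maximalideal I R)"

definition fg_module :: "('r, 'x) ring_scheme \<Rightarrow> ('r, 'm) module \<Rightarrow> bool" where
  "fg_module R M \<longleftrightarrow> module R M \<and>
     (\<exists>S. finite S \<and> S \<subseteq> carrier M \<and>
        (\<forall>x\<in>carrier M. \<exists>c\<in>S \<rightarrow> carrier R. x = (\<Oplus>\<^bsub>M\<^esub>s\<in>S. c s \<odot>\<^bsub>M\<^esub> s)))"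

definition zero_module :: "('r, 'm) module \<Rightarrow> bool" where
  "zero_module M \<longleftrightarrow> carrier M = {\<zero>\<^bsub>M\<^esub>}"

text \<open>
  Homomorphisms are taken extensional, so that equality of elements of \<open>Hom_module\<close> is equality
  of maps on the carrier.
\<close>

definition mod_hom ::
    "('r, 'x) ring_scheme \<Rightarrow> ('r, 'm) module \<Rightarrow> ('r, 'n) module \<Rightarrow> ('m \<Rightarrow> 'n) set" where
  "mod_hom R M N = {f \<in> carrier M \<rightarrow>\<^sub>E carrier N.
     (\<forall>x\<in>carrier M. \<forall>y\<in>carrier M. f (x \<oplus>\<^bsub>M\<^esub> y) = f x \<oplus>\<^bsub>N\<^esub> f y) \<and>
     (\<forall>a\<in>carrier R. \<forall>x\<in>carrier M. f (a \<odot>\<^bsub>M\<^esub> x) = a \<odot>\<^bsub>N\<^esub> f x)}"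

definition mod_ker :: "('r, 'm) module \<Rightarrow> ('r, 'n) module \<Rightarrow> ('m \<Rightarrow> 'n) \<Rightarrow> 'm set" where
  "mod_ker M N f = {x \<in> carrier M. f x = \<zero>\<^bsub>N\<^esub>}"

definition Hom_module ::
    "('r, 'x) ring_scheme \<Rightarrow> ('r, 'm) module \<Rightarrow> ('r, 'n) module \<Rightarrow> ('r, 'm \<Rightarrow> 'n) module" where
  "Hom_module R M N =
     \<lparr>carrier = mod_hom R M N, mult = undefined, one = undefined,
      zero = (\<lambda>x\<in>carrier M. \<zero>\<^bsub>N\<^esub>),
      add = (\<lambda>f g. \<lambda>x\<in>carrier M. f x \<oplus>\<^bsub>N\<^esub> g x),
      smult = (\<lambda>a f. \<lambda>x\<in>carrier M. a \<odot>\<^bsub>N\<^esub> f x)\<rparr>"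

definition quot_module :: "('r, 'm) module \<Rightarrow> 'm set \<Rightarrow> ('r, 'm set) module" where
  "quot_module M H =
     \<lparr>carrier = a_rcosets\<^bsub>M\<^esub> H, mult = undefined, one = undefined,
      zero = H,
      add = set_add M,
      smult = (\<lambda>a C. \<Union>x\<in>C. H +>\<^bsub>M\<^esub> (a \<odot>\<^bsub>M\<^esub> x))\<rparr>"

definition self_module :: "('r, 'x) ring_scheme \<Rightarrow> ('r, 'r) module" where
  "self_module R =
     \<lparr>carrier = carrier R, mult = mult R, one = one R, zero = zero R, add = add R,
      smult = mult R\<rparr>"

definition power_module :: "('r, 'm) module \<Rightarrow> nat \<Rightarrow> ('r, nat \<Rightarrow> 'm) module" where
  "power_module M n =
     \<lparr>carrier = {..<n} \<rightarrow>\<^sub>E carrier M, mult = undefined, one = undefined,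
      zero = (\<lambda>i\<in>{..<n}. \<zero>\<^bsub>M\<^esub>),
      add = (\<lambda>v w. \<lambda>i\<in>{..<n}. v i \<oplus>\<^bsub>M\<^esub> w i),
      smult = (\<lambda>a v. \<lambda>i\<in>{..<n}. a \<odot>\<^bsub>M\<^esub> v i)\<rparr>"

abbreviation free_module :: "('r, 'x) ring_scheme \<Rightarrow> nat \<Rightarrow> ('r, nat \<Rightarrow> 'r) module" where
  "free_module R n \<equiv> power_module (self_module R) n"

text \<open>Exactness of \<open>0 \<rightarrow> A \<rightarrow> B \<rightarrow> C \<rightarrow> 0\<close>.\<close>

definition short_exact ::
    "('r, 'x) ring_scheme \<Rightarrow> ('r, 'a) module \<Rightarrow> ('a \<Rightarrow> 'b) \<Rightarrow> ('r, 'b) module \<Rightarrow>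
     ('b \<Rightarrow> 'c) \<Rightarrow> ('r, 'c) module \<Rightarrow> bool" where
  "short_exact R A f B g C \<longleftrightarrow>
     f \<in> mod_hom R A B \<and> g \<in> mod_hom R B C \<and>
     inj_on f (carrier A) \<and> f ` carrier A = mod_ker B C g \<and> g ` carrier B = carrier C"

definition mod_iso ::
    "('r, 'x) ring_scheme \<Rightarrow> ('r, 'm) module \<Rightarrow> ('r, 'n) module \<Rightarrow> bool" where
  "mod_iso R M N \<longleftrightarrow> (\<exists>f\<in>mod_hom R M N. bij_betw f (carrier M) (carrier N))"

text \<open>\<open>A\<close> is, up to isomorphism, a direct summand of \<open>N\<close>: \<open>N\<close> is the internal direct sum of
  submodules \<open>P\<close> and \<open>Q\<close> with \<open>P\<close> isomorphic to \<open>A\<close>.\<close>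

definition direct_summand ::
    "('r, 'x) ring_scheme \<Rightarrow> ('r, 'a) module \<Rightarrow> ('r, 'n) module \<Rightarrow> bool" where
  "direct_summand R A N \<longleftrightarrow>
     (\<exists>P Q. submodule P R N \<and> submodule Q R N \<and>
        P <+>\<^bsub>N\<^esub> Q = carrier N \<and> P \<inter> Q = {\<zero>\<^bsub>N\<^esub>} \<and>
        mod_iso R A (N\<lparr>carrier := P\<rparr>))"

text \<open>The submodule \<open>(x\<^sub>1, \<dots>, x\<^sub>k) M\<close>.\<close>

definition seq_submodule :: "('r, 'm) module \<Rightarrow> 'r list \<Rightarrow> 'm set" where
  "seq_submodule M xs =
     {(\<Oplus>\<^bsub>M\<^esub>i\<in>{..<length xs}. (xs ! i) \<odot>\<^bsub>M\<^esub> f i) | f. f \<in> {..<length xs} \<rightarrow> carrier M}"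

definition nonzerodivisor_on :: "('r, 'm) module \<Rightarrow> 'r \<Rightarrow> bool" where
  "nonzerodivisor_on M a \<longleftrightarrow> (\<forall>x\<in>carrier M. a \<odot>\<^bsub>M\<^esub> x = \<zero>\<^bsub>M\<^esub> \<longrightarrow> x = \<zero>\<^bsub>M\<^esub>)"

definition regular_sequence ::
    "('r, 'x) ring_scheme \<Rightarrow> ('r, 'm) module \<Rightarrow> 'r list \<Rightarrow> bool" where
  "regular_sequence R M xs \<longleftrightarrow>
     set xs \<subseteq> carrier R \<and>
     (\<forall>i<length xs. nonzerodivisor_on (quot_module M (seq_submodule M (take i xs))) (xs ! i)) \<and>
     \<not> zero_module (quot_module M (seq_submodule M xs))"

definition depth :: "('r, 'x) ring_scheme \<Rightarrow> ('r, 'm) module \<Rightarrow> enat" where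
  "depth R M =
     (if zero_module M then \<infinity>
      else Sup {enat (length xs) | xs. regular_sequence R M xs \<and> set xs \<subseteq> max_ideal R})"

text \<open>
  A resolution \<open>\<dots> \<rightarrow> R\<^bsup>b 2\<^esup> \<rightarrow> R\<^bsup>b 1\<^esup> \<rightarrow> R\<^bsup>b 0\<^esup> \<rightarrow> M \<rightarrow> 0\<close> by free modules of finite rank, with
  differentials \<open>d i\<close> from \<open>R\<^bsup>b (i + 1)\<^esup>\<close> to \<open>R\<^bsup>b i\<^esup>\<close> and augmentation \<open>e\<close>. Over a
  Noetherian ring every finitely generated module has one.
\<close>

definition free_resolution ::
    "('r, 'x) ring_scheme \<Rightarrow> ('r, 'm) module \<Rightarrow> (nat \<Rightarrow> nat) \<Rightarrow>
     (nat \<Rightarrow> (nat \<Rightarrow> 'r) \<Rightarrow> (nat \<Rightarrow> 'r)) \<Rightarrow> ((nat \<Rightarrow> 'r) \<Rightarrow> 'm) \<Rightarrow> bool" where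
  "free_resolution R M b d e \<longleftrightarrow>
     e \<in> mod_hom R (free_module R (b 0)) M \<and>
     e ` carrier (free_module R (b 0)) = carrier M \<and>
     (\<forall>i. d i \<in> mod_hom R (free_module R (b (Suc i))) (free_module R (b i))) \<and>
     d 0 ` carrier (free_module R (b 1)) = mod_ker (free_module R (b 0)) M e \<and>
     (\<forall>i. d (Suc i) ` carrier (free_module R (b (Suc (Suc i)))) =
          mod_ker (free_module R (b (Suc i))) (free_module R (b i)) (d i))"

text \<open>
  Cohomology in degree \<open>i\<close> of the cochain complex \<open>Hom(R\<^bsup>b 0\<^esup>, N) \<rightarrow> Hom(R\<^bsup>b 1\<^esup>, N) \<rightarrow> \<dots>\<close>, whose
  differentials are precomposition with \<open>d i\<close>.
\<close>

definition Hom_cochains ::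
    "('r, 'x) ring_scheme \<Rightarrow> (nat \<Rightarrow> nat) \<Rightarrow> ('r, 'n) module \<Rightarrow> nat \<Rightarrow>
     ('r, (nat \<Rightarrow> 'r) \<Rightarrow> 'n) module" where
  "Hom_cochains R b N i = Hom_module R (free_module R (b i)) N"

definition Hom_coboundary ::
    "('r, 'x) ring_scheme \<Rightarrow> (nat \<Rightarrow> nat) \<Rightarrow> (nat \<Rightarrow> (nat \<Rightarrow> 'r) \<Rightarrow> (nat \<Rightarrow> 'r)) \<Rightarrow> nat \<Rightarrow>
     ((nat \<Rightarrow> 'r) \<Rightarrow> 'n) \<Rightarrow> ((nat \<Rightarrow> 'r) \<Rightarrow> 'n)" where
  "Hom_coboundary R b d i f = compose (carrier (free_module R (b (Suc i)))) f (d i)"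

definition Hom_cocycles ::
    "('r, 'x) ring_scheme \<Rightarrow> (nat \<Rightarrow> nat) \<Rightarrow> (nat \<Rightarrow> (nat \<Rightarrow> 'r) \<Rightarrow> (nat \<Rightarrow> 'r)) \<Rightarrow>
     ('r, 'n) module \<Rightarrow> nat \<Rightarrow> ((nat \<Rightarrow> 'r) \<Rightarrow> 'n) set" where
  "Hom_cocycles R b d N i =
     mod_ker (Hom_cochains R b N i) (Hom_cochains R b N (Suc i)) (Hom_coboundary R b d i)"

definition Hom_coboundaries ::
    "('r, 'x) ring_scheme \<Rightarrow> (nat \<Rightarrow> nat) \<Rightarrow> (nat \<Rightarrow> (nat \<Rightarrow> 'r) \<Rightarrow> (nat \<Rightarrow> 'r)) \<Rightarrow>
     ('r, 'n) module \<Rightarrow> nat \<Rightarrow> ((nat \<Rightarrow> 'r) \<Rightarrow> 'n) set" where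
  "Hom_coboundaries R b d N i =
     (case i of
        0 \<Rightarrow> {\<zero>\<^bsub>Hom_cochains R b N 0\<^esub>}
      | Suc j \<Rightarrow> Hom_coboundary R b d j ` carrier (Hom_cochains R b N j))"

definition Hom_cohomology ::
    "('r, 'x) ring_scheme \<Rightarrow> (nat \<Rightarrow> nat) \<Rightarrow> (nat \<Rightarrow> (nat \<Rightarrow> 'r) \<Rightarrow> (nat \<Rightarrow> 'r)) \<Rightarrow>
     ('r, 'n) module \<Rightarrow> nat \<Rightarrow> ('r, ((nat \<Rightarrow> 'r) \<Rightarrow> 'n) set) module" where
  "Hom_cohomology R b d N i =
     quot_module ((Hom_cochains R b N i)\<lparr>carrier := Hom_cocycles R b d N i\<rparr>)
       (Hom_coboundaries R b d N i)"

text \<open>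
  \<open>Ext\<close> is computed from a chosen free resolution of finite rank; as usual, another choice gives
  an isomorphic module. It is meant for finitely generated \<open>M\<close> over a Noetherian ring.
\<close>

definition Ext ::
    "('r, 'x) ring_scheme \<Rightarrow> nat \<Rightarrow> ('r, 'm) module \<Rightarrow> ('r, 'n) module \<Rightarrow>
     ('r, ((nat \<Rightarrow> 'r) \<Rightarrow> 'n) set) module" where
  "Ext R i M N =
     (case (SOME (b, d, e). free_resolution R M b d e) of
        (b, d, e) \<Rightarrow> Hom_cohomology R b d N i)"

definition Deep :: "('r, 'x) ring_scheme \<Rightarrow> ('r, 'm) module set" where
  "Deep R = {X. fg_module R X \<and> depth R X \<ge> depth R (self_module R)}"

text \<open>
  In both classes below the module \<open>X\<close> is determined up to isomorphism as a cokernel, and cokernels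
  are realised as modules of cosets; so fixing the element type of \<open>X\<close> to be a type of sets of
  elements of the middle term is no restriction.
\<close>

definition Omega_Deep :: "('r, 'x) ring_scheme \<Rightarrow> ('r, 'm) module set" where
  "Omega_Deep R = {M. fg_module R M \<and>
     (\<exists>n f g. \<exists>X :: ('r, (nat \<Rightarrow> 'r) set) module.
        X \<in> Deep R \<and> short_exact R M f (free_module R n) g X)}"

definition DF :: "('r, 'x) ring_scheme \<Rightarrow> ('r, 'm) module set" where
  "DF R = {M. fg_module R M \<and>
     (\<exists>n f g. \<exists>X :: ('r, (nat \<Rightarrow> 'm) set) module.
        X \<in> Deep R \<and> short_exact R (self_module R) f (power_module M n) g X)}"

end

(* Choose a sequence of length t in the maximal ideal that is regular on R and on the cokernels X of
   N -> R^n and Y of R -> Hom(M,N)^k; maximality of t gives an element s outside the ideal I it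
   generates that is killed by the maximal ideal modulo I.  Reducing 0 -> R -> Hom(M,N)^k -> Y -> 0
   modulo I yields f in Hom(M,N) with s f not in I Hom(M,N).  Vanishing of Ext makes
   Hom(M,N)/I Hom(M,N) embed into Hom(M,N/IN), so s f(m) is not in IN for some m.  Since N/IN embeds
   into (R/I)^n, some coordinate c of f(m) in R^n satisfies that s c is not in I, so c is a unit and
   this coordinate maps N onto R. *)

theory Submission
  imports Defs
begin

subsection \<open>Submodules and homomorphisms\<close>

text \<open>The regular sequences that witness the depths of \<open>R\<close>, \<open>X\<close> and
  \<open>Y\<close> are unrelated to each other, so a common one has to be built element by element.
  Prime avoidance supplies an element regular on all three modules, but it need not begin any of the
  given sequences. The obstacle is therefore to show that depth drops by at most one modulo an
  arbitrary regular element, not just modulo a well-chosen one; \<open>depth_ge_adjoin\<close> does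
  this by an exchange argument on socles. As \<open>X\<close> or \<open>Y\<close> may be zero, with
  infinite depth, only weak regularity is asked of the common sequence. The number t enters twice.
  No regular sequence on \<open>R\<close> has length t + 1, which produces s. And embedding Hom
  modulo I costs one Ext degree for each element of the sequence but one, which is exactly the range
  from 1 to t - 1. Congruences modulo I are phrased as membership in submodules of the original
  modules, so that maps need not be carried to quotients.\<close>

context module
begin

lemma submodule_zero: "submodule K R M \<Longrightarrow> \<zero>\<^bsub>M\<^esub> \<in> K"
  using submoduleE[of K] smult_l_null by (metis all_not_in_conv R.zero_closed subsetD)

text \<open>Congruences modulo \<open>K\<close> are handled in this way: a term known to lie in
  \<open>K\<close> is dropped inside a membership statement.\<close>

lemma submodule_add_cancel:
  assumes K: "submodule K R M" and k: "k \<in> K" and u: "u \<in> carrier M"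
  shows "k \<oplus>\<^bsub>M\<^esub> u \<in> K \<longleftrightarrow> u \<in> K"
proof
  assume h: "k \<oplus>\<^bsub>M\<^esub> u \<in> K"
  have kc: "k \<in> carrier M" using submoduleE(1)[OF K] k by blast
  have "\<ominus>\<^bsub>M\<^esub> k \<oplus>\<^bsub>M\<^esub> (k \<oplus>\<^bsub>M\<^esub> u) \<in> K"
    using submoduleE(3,5)[OF K] k h by blast
  then show "u \<in> K" using kc u by (simp add: M.r_neg1)
next
  assume "u \<in> K" then show "k \<oplus>\<^bsub>M\<^esub> u \<in> K" using submoduleE(5)[OF K] k by blast
qed

lemma submodule_minus:
  "submodule K R M \<Longrightarrow> a \<in> K \<Longrightarrow> b \<in> K \<Longrightarrow> a \<ominus>\<^bsub>M\<^esub> b \<in> K"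
  unfolding M.minus_eq using submoduleE(3,5) by blast

lemma zero_submodule: "submodule {\<zero>\<^bsub>M\<^esub>} R M"
  by (rule submoduleI) auto

lemma minus_add_cancel:
  "a \<in> carrier M \<Longrightarrow> b \<in> carrier M \<Longrightarrow> a \<oplus>\<^bsub>M\<^esub> (b \<ominus>\<^bsub>M\<^esub> a) = b"
  unfolding M.minus_eq by (metis M.add.inv_closed M.add.m_comm M.r_neg1 M.minus_minus M.add.m_lcomm)

lemma smult_minus_distr:
  "a \<in> carrier R \<Longrightarrow> x \<in> carrier M \<Longrightarrow> y \<in> carrier M \<Longrightarrow>
    a \<odot>\<^bsub>M\<^esub> (x \<ominus>\<^bsub>M\<^esub> y) = a \<odot>\<^bsub>M\<^esub> x \<ominus>\<^bsub>M\<^esub> a \<odot>\<^bsub>M\<^esub> y"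
  by (simp add: M.minus_eq smult_r_distr smult_r_minus)

lemma smult_commute:
  "a \<in> carrier R \<Longrightarrow> b \<in> carrier R \<Longrightarrow> x \<in> carrier M \<Longrightarrow>
    a \<odot>\<^bsub>M\<^esub> (b \<odot>\<^bsub>M\<^esub> x) = b \<odot>\<^bsub>M\<^esub> (a \<odot>\<^bsub>M\<^esub> x)"
  by (metis smult_assoc1 R.m_comm)

end

lemma mod_hom_closed: "f \<in> mod_hom R A B \<Longrightarrow> x \<in> carrier A \<Longrightarrow> f x \<in> carrier B"
  unfolding mod_hom_def by (auto dest: PiE_mem)

lemma mod_hom_add:
  "f \<in> mod_hom R A B \<Longrightarrow> x \<in> carrier A \<Longrightarrow> y \<in> carrier A \<Longrightarrow> f (x \<oplus>\<^bsub>A\<^esub> y) = f x \<oplus>\<^bsub>B\<^esub> f y"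
  unfolding mod_hom_def by auto

lemma mod_hom_smult:
  "f \<in> mod_hom R A B \<Longrightarrow> a \<in> carrier R \<Longrightarrow> x \<in> carrier A \<Longrightarrow> f (a \<odot>\<^bsub>A\<^esub> x) = a \<odot>\<^bsub>B\<^esub> f x"
  unfolding mod_hom_def by auto

lemma mod_hom_extensional: "f \<in> mod_hom R A B \<Longrightarrow> f \<in> extensional (carrier A)"
  unfolding mod_hom_def by (auto simp: PiE_def)

lemma mod_homI:
  assumes "f \<in> extensional (carrier A)" "\<And>x. x \<in> carrier A \<Longrightarrow> f x \<in> carrier B"
    "\<And>x y. x \<in> carrier A \<Longrightarrow> y \<in> carrier A \<Longrightarrow> f (x \<oplus>\<^bsub>A\<^esub> y) = f x \<oplus>\<^bsub>B\<^esub> f y"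
    "\<And>a x. a \<in> carrier R \<Longrightarrow> x \<in> carrier A \<Longrightarrow> f (a \<odot>\<^bsub>A\<^esub> x) = a \<odot>\<^bsub>B\<^esub> f x"
  shows "f \<in> mod_hom R A B"
  using assms unfolding mod_hom_def by (auto simp: PiE_def)

lemma mod_hom_eqI:
  assumes "f \<in> mod_hom R A B" "g \<in> mod_hom R A B" "\<And>x. x \<in> carrier A \<Longrightarrow> f x = g x"
  shows "f = g"
  using assms by (intro extensionalityI[of f "carrier A"]) (auto dest: mod_hom_extensional)

lemma mod_hom_zero:
  assumes "module R A" "module R B" "f \<in> mod_hom R A B"
  shows "f \<zero>\<^bsub>A\<^esub> = \<zero>\<^bsub>B\<^esub>"
proof -
  interpret A: module R A by fact
  interpret B: module R B by fact
  have "f (\<zero>\<^bsub>R\<^esub> \<odot>\<^bsub>A\<^esub> \<zero>\<^bsub>A\<^esub>) = \<zero>\<^bsub>R\<^esub> \<odot>\<^bsub>B\<^esub> f \<zero>\<^bsub>A\<^esub>"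
    by (rule mod_hom_smult[OF assms(3)]) auto
  then show ?thesis using mod_hom_closed[OF assms(3), of "\<zero>\<^bsub>A\<^esub>"] by simp
qed

lemma mod_hom_uminus:
  assumes "module R A" "module R B" "f \<in> mod_hom R A B" "x \<in> carrier A"
  shows "f (\<ominus>\<^bsub>A\<^esub> x) = \<ominus>\<^bsub>B\<^esub> f x"
proof -
  interpret A: module R A by fact
  interpret B: module R B by fact
  have "f x \<oplus>\<^bsub>B\<^esub> f (\<ominus>\<^bsub>A\<^esub> x) = \<zero>\<^bsub>B\<^esub>"
    using mod_hom_add[OF assms(3), of x "\<ominus>\<^bsub>A\<^esub> x"] assms(4) mod_hom_zero[OF assms(1-3)] by (simp add: A.M.r_neg)
  then show ?thesis
    using mod_hom_closed[OF assms(3)] assms(4) by (metis B.M.minus_equality A.M.a_inv_closed B.M.a_comm)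
qed

lemma mod_hom_minus:
  assumes "module R A" "module R B" "f \<in> mod_hom R A B" "x \<in> carrier A" "y \<in> carrier A"
  shows "f (x \<ominus>\<^bsub>A\<^esub> y) = f x \<ominus>\<^bsub>B\<^esub> f y"
proof -
  interpret A: module R A by fact
  interpret B: module R B by fact
  show ?thesis unfolding A.M.minus_eq B.M.minus_eq
    using assms mod_hom_add[OF assms(3)] mod_hom_uminus[OF assms(1-3)] by simp
qed

lemma mod_hom_image_submodule:
  assumes "module R A" "module R B" "f \<in> mod_hom R A B" "submodule K R A"
  shows "submodule (f ` K) R B"
proof -
  interpret A: module R A by fact
  interpret B: module R B by fact
  note K = A.submoduleE[OF assms(4)]
  show ?thesis
  proof (rule B.submoduleI)
    show "f ` K \<subseteq> carrier B" using K(1) mod_hom_closed[OF assms(3)] by auto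
    show "\<zero>\<^bsub>B\<^esub> \<in> f ` K"
      using mod_hom_zero[OF assms(1-3)] A.submodule_zero[OF assms(4)] by (metis imageI)
    show "\<ominus>\<^bsub>B\<^esub> a \<in> f ` K" if a: "a \<in> f ` K" for a
    proof -
      obtain u where u: "u \<in> K" "a = f u" using a by blast
      have "\<ominus>\<^bsub>B\<^esub> a = f (\<ominus>\<^bsub>A\<^esub> u)" using u K(1) mod_hom_uminus[OF assms(1-3)] by auto
      then show ?thesis using K(3)[OF u(1)] by blast
    qed
    show "a \<oplus>\<^bsub>B\<^esub> b \<in> f ` K" if ab: "a \<in> f ` K" "b \<in> f ` K" for a b
    proof -
      obtain u v where u: "u \<in> K" "a = f u" and v: "v \<in> K" "b = f v" using ab by blast
      have "a \<oplus>\<^bsub>B\<^esub> b = f (u \<oplus>\<^bsub>A\<^esub> v)" using u v K(1) by (subst mod_hom_add[OF assms(3)]) auto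
      then show ?thesis using K(5)[OF u(1) v(1)] by blast
    qed
    show "r \<odot>\<^bsub>B\<^esub> b \<in> f ` K" if r: "r \<in> carrier R" and b: "b \<in> f ` K" for r b
    proof -
      obtain v where v: "v \<in> K" "b = f v" using b by blast
      have "r \<odot>\<^bsub>B\<^esub> b = f (r \<odot>\<^bsub>A\<^esub> v)" using r v K(1) by (subst mod_hom_smult[OF assms(3)]) auto
      then show ?thesis using K(4)[OF r v(1)] by blast
    qed
  qed
qed

lemma mod_hom_vimage_submodule:
  assumes "module R A" "module R B" "f \<in> mod_hom R A B" "submodule K R B"
  shows "submodule {x \<in> carrier A. f x \<in> K} R A"
proof -
  interpret A: module R A by fact
  interpret B: module R B by fact
  note K = B.submoduleE[OF assms(4)] B.submodule_zero[OF assms(4)]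
  show ?thesis
    using K by (intro A.submoduleI) (auto simp: mod_hom_zero[OF assms(1-3)]
        mod_hom_uminus[OF assms(1-3)] mod_hom_add[OF assms(3)] mod_hom_smult[OF assms(3)])
qed

lemma mod_ker_submodule:
  assumes "module R A" "module R B" "f \<in> mod_hom R A B"
  shows "submodule (mod_ker A B f) R A"
  using mod_hom_vimage_submodule[OF assms module.zero_submodule[OF assms(2)]]
  unfolding mod_ker_def by simp

subsection \<open>The multiples of a submodule by a sequence\<close>

text \<open>For submodules, \<open>K + x A\<close>. The coefficients range over a separate set
  \<open>A\<close>, not always over the whole module, because it matters later where they lie: in
  the image of a map, or among the cocycles of a complex.\<close>

definition adjoin :: "('r, 'm, 'z) module_scheme \<Rightarrow> 'm set \<Rightarrow> 'm set \<Rightarrow> 'r \<Rightarrow> 'm set" where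
  "adjoin M K A x = {u \<oplus>\<^bsub>M\<^esub> x \<odot>\<^bsub>M\<^esub> a | u a. u \<in> K \<and> a \<in> A}"

text \<open>Sequences are listed with the last element first, so that \<open>x # xs\<close> prolongs \<open>xs\<close>.\<close>

fun seq_mult :: "('r, 'm, 'z) module_scheme \<Rightarrow> 'm set \<Rightarrow> 'r list \<Rightarrow> 'm set" where
  "seq_mult M A [] = {\<zero>\<^bsub>M\<^esub>}"
| "seq_mult M A (x # xs) = adjoin M (seq_mult M A xs) A x"

lemma seq_mult_mono: "A \<subseteq> B \<Longrightarrow> seq_mult M A xs \<subseteq> seq_mult M B xs"
  by (induction xs) (auto simp: adjoin_def)

text \<open>Injectivity of multiplication by \<open>a\<close> on \<open>M / K\<close>, stated on
  representatives.\<close>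

definition regular_mod :: "('r, 'm, 'z) module_scheme \<Rightarrow> 'm set \<Rightarrow> 'r \<Rightarrow> bool" where
  "regular_mod M K a \<longleftrightarrow> (\<forall>u\<in>carrier M. a \<odot>\<^bsub>M\<^esub> u \<in> K \<longrightarrow> u \<in> K)"

text \<open>The quotient by the whole sequence is allowed to vanish. This admits the zero module,
  whose depth is infinite, and lets regularity pass to kernels without a nonvanishing
  argument.\<close>

fun weakly_regular :: "('r, 'm, 'z) module_scheme \<Rightarrow> 'r list \<Rightarrow> bool" where
  "weakly_regular M [] \<longleftrightarrow> True"
| "weakly_regular M (x # xs) \<longleftrightarrow>
     weakly_regular M xs \<and> regular_mod M (seq_mult M (carrier M) xs) x"

context module
begin

lemma adjoin_submodule:
  assumes K: "submodule K R M" and A: "submodule A R M" and x: "x \<in> carrier R"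
  shows "submodule (adjoin M K A x) R M"
proof -
  note K' = submoduleE[OF K] submodule_zero[OF K] and A' = submoduleE[OF A] submodule_zero[OF A]
  have Kc: "\<And>u. u \<in> K \<Longrightarrow> u \<in> carrier M" and Ac: "\<And>u. u \<in> A \<Longrightarrow> u \<in> carrier M"
    using K' A' by auto
  show ?thesis
  proof (rule submoduleI)
    show "adjoin M K A x \<subseteq> carrier M" unfolding adjoin_def using Kc Ac x by auto
    show "\<zero>\<^bsub>M\<^esub> \<in> adjoin M K A x" unfolding adjoin_def
      using K'(7) A'(7) x by (force intro!: exI[of _ "\<zero>\<^bsub>M\<^esub>"])
    show "\<ominus>\<^bsub>M\<^esub> w \<in> adjoin M K A x" if w: "w \<in> adjoin M K A x" for w
    proof -
      obtain u a where "w = u \<oplus>\<^bsub>M\<^esub> x \<odot>\<^bsub>M\<^esub> a" "u \<in> K" "a \<in> A"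
        using w unfolding adjoin_def by auto
      then have "\<ominus>\<^bsub>M\<^esub> w = \<ominus>\<^bsub>M\<^esub> u \<oplus>\<^bsub>M\<^esub> x \<odot>\<^bsub>M\<^esub> (\<ominus>\<^bsub>M\<^esub> a)"
        using Kc Ac x by (simp add: smult_r_minus M.minus_add)
      then show ?thesis unfolding adjoin_def using K'(3) A'(3) \<open>u \<in> K\<close> \<open>a \<in> A\<close> by blast
    qed
    show "w \<oplus>\<^bsub>M\<^esub> w' \<in> adjoin M K A x" if w: "w \<in> adjoin M K A x" "w' \<in> adjoin M K A x" for w w'
    proof -
      obtain u a u' a' where "w = u \<oplus>\<^bsub>M\<^esub> x \<odot>\<^bsub>M\<^esub> a" and ua: "u \<in> K" "a \<in> A"
        and "w' = u' \<oplus>\<^bsub>M\<^esub> x \<odot>\<^bsub>M\<^esub> a'" and ua': "u' \<in> K" "a' \<in> A"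
        using w unfolding adjoin_def by auto
      then have "w \<oplus>\<^bsub>M\<^esub> w' = (u \<oplus>\<^bsub>M\<^esub> u') \<oplus>\<^bsub>M\<^esub> x \<odot>\<^bsub>M\<^esub> (a \<oplus>\<^bsub>M\<^esub> a')"
        using Kc Ac x by (simp add: smult_r_distr M.a_ac)
      then show ?thesis unfolding adjoin_def using K'(5) A'(5) ua ua' by blast
    qed
    show "r \<odot>\<^bsub>M\<^esub> w \<in> adjoin M K A x" if r: "r \<in> carrier R" and w: "w \<in> adjoin M K A x" for w r
    proof -
      obtain u a where "w = u \<oplus>\<^bsub>M\<^esub> x \<odot>\<^bsub>M\<^esub> a" "u \<in> K" "a \<in> A"
        using w unfolding adjoin_def by auto
      then have "r \<odot>\<^bsub>M\<^esub> w = r \<odot>\<^bsub>M\<^esub> u \<oplus>\<^bsub>M\<^esub> x \<odot>\<^bsub>M\<^esub> (r \<odot>\<^bsub>M\<^esub> a)"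
        using Kc Ac x r by (simp add: smult_r_distr smult_commute[of r x])
      then show ?thesis unfolding adjoin_def using K'(4) A'(4) \<open>u \<in> K\<close> \<open>a \<in> A\<close> r by blast
    qed
  qed
qed

lemma seq_mult_submodule:
  "submodule A R M \<Longrightarrow> set xs \<subseteq> carrier R \<Longrightarrow> submodule (seq_mult M A xs) R M"
  by (induction xs) (auto simp: zero_submodule adjoin_submodule)

lemma subset_adjoin:
  assumes "submodule K R M" "submodule A R M" "x \<in> carrier R"
  shows "K \<subseteq> adjoin M K A x"
proof
  fix u assume u: "u \<in> K"
  then have "u = u \<oplus>\<^bsub>M\<^esub> x \<odot>\<^bsub>M\<^esub> \<zero>\<^bsub>M\<^esub>" using assms submoduleE(1)[OF assms(1)] by auto
  then show "u \<in> adjoin M K A x" unfolding adjoin_def using u submodule_zero[OF assms(2)] by blast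
qed

lemma smult_in_adjoin:
  assumes "submodule K R M" "submodule A R M" "x \<in> carrier R" "a \<in> A"
  shows "x \<odot>\<^bsub>M\<^esub> a \<in> adjoin M K A x"
proof -
  have "x \<odot>\<^bsub>M\<^esub> a = \<zero>\<^bsub>M\<^esub> \<oplus>\<^bsub>M\<^esub> x \<odot>\<^bsub>M\<^esub> a" using assms submoduleE(1)[OF assms(2)] by auto
  then show ?thesis unfolding adjoin_def using assms(4) submodule_zero[OF assms(1)] by blast
qed

lemma adjoin_minimal:
  assumes "submodule L R M" "K \<subseteq> L" "\<And>a. a \<in> A \<Longrightarrow> x \<odot>\<^bsub>M\<^esub> a \<in> L"
  shows "adjoin M K A x \<subseteq> L"
  using assms submoduleE(5)[OF assms(1)] unfolding adjoin_def by blast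

end

lemma mod_hom_adjoin:
  assumes "f \<in> mod_hom R V W" "K \<subseteq> carrier V" "A \<subseteq> carrier V" "x \<in> carrier R" "module R V"
  shows "f ` adjoin V K A x = adjoin W (f ` K) (f ` A) x"
proof -
  interpret module R V by fact
  have *: "f (u \<oplus>\<^bsub>V\<^esub> x \<odot>\<^bsub>V\<^esub> a) = f u \<oplus>\<^bsub>W\<^esub> x \<odot>\<^bsub>W\<^esub> f a" if "u \<in> K" "a \<in> A" for u a
    using that assms by (subst mod_hom_add[OF assms(1)]) (auto simp: mod_hom_smult[OF assms(1)])
  show ?thesis unfolding adjoin_def
  proof (intro equalityI subsetI)
    fix w assume "w \<in> f ` {u \<oplus>\<^bsub>V\<^esub> x \<odot>\<^bsub>V\<^esub> a |u a. u \<in> K \<and> a \<in> A}"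
    then show "w \<in> {u \<oplus>\<^bsub>W\<^esub> x \<odot>\<^bsub>W\<^esub> a |u a. u \<in> f ` K \<and> a \<in> f ` A}" using * by blast
  next
    fix w assume "w \<in> {u \<oplus>\<^bsub>W\<^esub> x \<odot>\<^bsub>W\<^esub> a |u a. u \<in> f ` K \<and> a \<in> f ` A}"
    then obtain u a where "u \<in> K" "a \<in> A" "w = f u \<oplus>\<^bsub>W\<^esub> x \<odot>\<^bsub>W\<^esub> f a" by blast
    then show "w \<in> f ` {u \<oplus>\<^bsub>V\<^esub> x \<odot>\<^bsub>V\<^esub> a |u a. u \<in> K \<and> a \<in> A}"
      using * by (auto intro!: image_eqI[where x = "u \<oplus>\<^bsub>V\<^esub> x \<odot>\<^bsub>V\<^esub> a"])
  qed
qed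

text \<open>The coefficients end up in the image of \<open>A\<close>. For a surjection this gives
  all multiples in the target; for a differential it says that multiples of coboundaries are
  coboundaries of multiples.\<close>

lemma mod_hom_seq_mult:
  assumes "module R V" "module R W" "f \<in> mod_hom R V W" "submodule A R V" "set xs \<subseteq> carrier R"
  shows "f ` seq_mult V A xs = seq_mult W (f ` A) xs"
  using assms(5)
proof (induction xs)
  case Nil
  then show ?case using mod_hom_zero[OF assms(1-3)] by simp
next
  case (Cons x xs)
  interpret module R V by fact
  show ?case using Cons mod_hom_adjoin[OF assms(3), of "seq_mult V A xs" A x]
    submoduleE(1)[OF seq_mult_submodule[OF assms(4)]] submoduleE(1)[OF assms(4)] assms(1) by simp
qed

lemma weakly_regular_iso:
  assumes V: "module R V" and W: "module R W" and f: "f \<in> mod_hom R V W"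
    and bij: "bij_betw f (carrier V) (carrier W)" and xs: "set xs \<subseteq> carrier R"
    and reg: "weakly_regular W xs"
  shows "weakly_regular V xs"
  using xs reg
proof (induction xs)
  case (Cons x xs)
  interpret module R V by fact
  have im: "f ` seq_mult V (carrier V) xs = seq_mult W (carrier W) xs"
    using mod_hom_seq_mult[OF V W f carrier_is_submodule] Cons.prems bij
    by (simp add: bij_betw_imp_surj_on)
  have sub: "seq_mult V (carrier V) xs \<subseteq> carrier V"
    using submoduleE(1)[OF seq_mult_submodule[OF carrier_is_submodule]] Cons.prems by simp
  have iff: "u \<in> seq_mult V (carrier V) xs \<longleftrightarrow> f u \<in> seq_mult W (carrier W) xs"
    if "u \<in> carrier V" for u
    unfolding im[symmetric] using inj_on_image_mem_iff[OF bij_betw_imp_inj_on[OF bij] that sub] by simp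
  have "regular_mod V (seq_mult V (carrier V) xs) x"
    unfolding regular_mod_def using iff Cons.prems mod_hom_smult[OF f] mod_hom_closed[OF f]
    by (auto simp: regular_mod_def)
  with Cons show ?case by simp
qed simp

subsection \<open>Exact sequences and complexes\<close>

text \<open>With I the ideal of the sequence, this is injectivity of
  \<open>A / I A -> B / I B\<close>, which holds because the first Koszul homology of
  \<open>C\<close> vanishes for a weakly regular sequence. The induction makes this explicit: in
  \<open>f u = b' + x b\<close> the image \<open>g b\<close> is forced into the multiples of the
  shorter sequence, so \<open>b\<close> agrees with such a multiple up to some \<open>f v\<close>,
  and \<open>u - x v\<close> falls under the induction hypothesis.\<close>

lemma exact_seq_mult:
  assumes A: "module R A" and B: "module R B" and C: "module R C"
    and f: "f \<in> mod_hom R A B" and g: "g \<in> mod_hom R B C"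
    and inj: "inj_on f (carrier A)" and ker: "f ` carrier A = mod_ker B C g"
    and surj: "g ` carrier B = carrier C"
    and xs: "set xs \<subseteq> carrier R" and reg: "weakly_regular C xs"
    and u: "u \<in> carrier A" "f u \<in> seq_mult B (carrier B) xs"
  shows "u \<in> seq_mult A (carrier A) xs"
  using xs reg u
proof (induction xs arbitrary: u)
  case Nil
  interpret A: module R A by fact
  show ?case using Nil mod_hom_zero[OF A B f] inj
    by (simp add: inj_on_def)
next
  case (Cons x xs)
  interpret A: module R A by fact
  interpret B: module R B by fact
  interpret C: module R C by fact
  let ?I = "\<lambda>V. seq_mult V (carrier V) xs"
  have x: "x \<in> carrier R" and xs: "set xs \<subseteq> carrier R" using Cons.prems by auto
  have sA: "submodule (?I A) R A" and sB: "submodule (?I B) R B" and sC: "submodule (?I C) R C"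
    using xs A.seq_mult_submodule[OF A.carrier_is_submodule] B.seq_mult_submodule[OF B.carrier_is_submodule]
      C.seq_mult_submodule[OF C.carrier_is_submodule] by auto
  have gI: "g ` ?I B = ?I C"
    using mod_hom_seq_mult[OF B C g B.carrier_is_submodule xs] surj by simp
  obtain b' b where b: "b' \<in> ?I B" "b \<in> carrier B" and fu: "f u = b' \<oplus>\<^bsub>B\<^esub> x \<odot>\<^bsub>B\<^esub> b"
    using Cons.prems(4) unfolding seq_mult.simps adjoin_def by blast
  have b'c: "b' \<in> carrier B" using b(1) B.submoduleE(1)[OF sB] by blast
  have "g (f u) = \<zero>\<^bsub>C\<^esub>" using ker Cons.prems(3) unfolding mod_ker_def by blast
  then have "g b' \<oplus>\<^bsub>C\<^esub> x \<odot>\<^bsub>C\<^esub> g b = \<zero>\<^bsub>C\<^esub>"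
    using fu b b'c x by (simp add: mod_hom_add[OF g] mod_hom_smult[OF g])
  then have "x \<odot>\<^bsub>C\<^esub> g b \<in> ?I C"
    using C.submodule_add_cancel[OF sC, of "g b'" "x \<odot>\<^bsub>C\<^esub> g b"] gI b x C.submodule_zero[OF sC]
      mod_hom_closed[OF g] by auto
  then have "g b \<in> ?I C" using Cons.prems(2) mod_hom_closed[OF g b(2)] by (simp add: regular_mod_def)
  then obtain b'' where b'': "b'' \<in> ?I B" "g b = g b''" using gI by (metis imageE)
  have b''c: "b'' \<in> carrier B" using b'' B.submoduleE(1)[OF sB] by blast
  have "b \<ominus>\<^bsub>B\<^esub> b'' \<in> mod_ker B C g"
    unfolding mod_ker_def using b b''c b''(2) mod_hom_minus[OF B C g b(2) b''c] mod_hom_closed[OF g b''c]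
    by (simp add: C.M.minus_eq C.M.r_neg)
  then obtain v where v: "v \<in> carrier A" "f v = b \<ominus>\<^bsub>B\<^esub> b''" using ker by (metis imageE)
  have beq: "b = b'' \<oplus>\<^bsub>B\<^esub> f v" using v b b''c B.minus_add_cancel by simp
  have fvc: "f v \<in> carrier B" using v b b''c by simp
  have "f u = (b' \<oplus>\<^bsub>B\<^esub> x \<odot>\<^bsub>B\<^esub> b'') \<oplus>\<^bsub>B\<^esub> f (x \<odot>\<^bsub>A\<^esub> v)"
    unfolding fu using b'c b''c fvc x v(1)
    by (subst beq) (simp add: B.smult_r_distr mod_hom_smult[OF f] B.M.a_ac)
  moreover have in1: "b' \<oplus>\<^bsub>B\<^esub> x \<odot>\<^bsub>B\<^esub> b'' \<in> ?I B"
    using B.submoduleE(4,5)[OF sB] b(1) b''(1) x by blast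
  ultimately have "f (u \<ominus>\<^bsub>A\<^esub> x \<odot>\<^bsub>A\<^esub> v) = b' \<oplus>\<^bsub>B\<^esub> x \<odot>\<^bsub>B\<^esub> b''"
    using Cons.prems(3) v(1) x b'c b''c mod_hom_closed[OF f]
    by (simp add: mod_hom_minus[OF A B f] B.M.minus_eq B.M.a_assoc B.M.r_neg)
  then have "u \<ominus>\<^bsub>A\<^esub> x \<odot>\<^bsub>A\<^esub> v \<in> ?I A"
    using in1 Cons.IH[of "u \<ominus>\<^bsub>A\<^esub> x \<odot>\<^bsub>A\<^esub> v"] Cons.prems v(1) by simp
  moreover have "u = (u \<ominus>\<^bsub>A\<^esub> x \<odot>\<^bsub>A\<^esub> v) \<oplus>\<^bsub>A\<^esub> x \<odot>\<^bsub>A\<^esub> v"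
    using Cons.prems v x by (simp add: A.M.minus_eq A.M.a_assoc A.M.l_neg)
  ultimately show ?case using v(1) unfolding seq_mult.simps adjoin_def by blast
qed

text \<open>At each stage \<open>A / I A\<close> embeds into \<open>B / I B\<close> by
  \<open>exact_seq_mult\<close>, and injectivity of multiplication by the next element is inherited
  by submodules.\<close>

lemma exact_weakly_regular:
  assumes A: "module R A" and B: "module R B" and C: "module R C"
    and f: "f \<in> mod_hom R A B" and g: "g \<in> mod_hom R B C"
    and inj: "inj_on f (carrier A)" and ker: "f ` carrier A = mod_ker B C g"
    and surj: "g ` carrier B = carrier C"
    and xs: "set xs \<subseteq> carrier R" and reg: "weakly_regular C xs" "weakly_regular B xs"
  shows "weakly_regular A xs"
  using xs reg
proof (induction xs)
  case (Cons x xs)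
  interpret A: module R A by fact
  interpret B: module R B by fact
  have x: "x \<in> carrier R" and xs: "set xs \<subseteq> carrier R" using Cons.prems by auto
  have "u \<in> seq_mult A (carrier A) xs"
    if u: "u \<in> carrier A" "x \<odot>\<^bsub>A\<^esub> u \<in> seq_mult A (carrier A) xs" for u
  proof -
    have "f ` seq_mult A (carrier A) xs = seq_mult B (f ` carrier A) xs"
      using mod_hom_seq_mult[OF A B f A.carrier_is_submodule xs] .
    moreover have "f ` carrier A \<subseteq> carrier B" using mod_hom_closed[OF f] by blast
    ultimately have "f (x \<odot>\<^bsub>A\<^esub> u) \<in> seq_mult B (carrier B) xs"
      using u seq_mult_mono[of "f ` carrier A" "carrier B" B xs] by blast
    then have "f u \<in> seq_mult B (carrier B) xs"
      using Cons.prems(3) u x mod_hom_smult[OF f] mod_hom_closed[OF f] by (simp add: regular_mod_def)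
    then show ?thesis
      using exact_seq_mult[OF A B C f g inj ker surj xs _ u(1)] Cons.prems(2) by simp
  qed
  then show ?case using Cons by (simp add: regular_mod_def)
qed simp

text \<open>Tracing \<open>z\<close> through the complex uses one more coboundary for every element of \<open>xs\<close>, which is
  why exactness in degrees \<open>1, \<dots>, t - 1\<close> suffices for sequences of length \<open>t\<close>.\<close>

lemma complex_cocycle_seq_mult:
  assumes C: "\<And>i. module R (C i)" and d: "\<And>i. d i \<in> mod_hom R (C i) (C (Suc i))"
    and exact: "\<And>i. Suc i < t \<Longrightarrow> mod_ker (C (Suc i)) (C (Suc (Suc i))) (d (Suc i)) = d i ` carrier (C i)"
    and xs: "set xs \<subseteq> carrier R" and reg: "\<And>i. weakly_regular (C i) xs"
    and len: "i + length xs \<le> t"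
    and z: "z \<in> mod_ker (C i) (C (Suc i)) (d i)" "z \<in> seq_mult (C i) (carrier (C i)) xs"
  shows "z \<in> seq_mult (C i) (mod_ker (C i) (C (Suc i)) (d i)) xs"
  using xs reg len z
proof (induction xs arbitrary: i z)
  case (Cons x xs)
  let ?I = "\<lambda>i. seq_mult (C i) (carrier (C i)) xs"
  let ?Z = "\<lambda>i. mod_ker (C i) (C (Suc i)) (d i)"
  let ?A = "C i" and ?B = "C (Suc i)"
  interpret A: module R ?A by (rule C)
  interpret B: module R ?B by (rule C)
  have x: "x \<in> carrier R" and xs: "set xs \<subseteq> carrier R" using Cons.prems by auto
  have sA: "submodule (?I i) R ?A" and sB: "submodule (?I (Suc i)) R ?B"
    using xs A.seq_mult_submodule[OF A.carrier_is_submodule] B.seq_mult_submodule[OF B.carrier_is_submodule]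
    by auto
  have dI: "d i ` ?I i = seq_mult ?B (d i ` carrier ?A) xs"
    by (rule mod_hom_seq_mult[OF C C d A.carrier_is_submodule xs])
  have "d i ` carrier ?A \<subseteq> carrier ?B" using mod_hom_closed[OF d] by blast
  then have dIsub: "d i ` ?I i \<subseteq> ?I (Suc i)" unfolding dI by (rule seq_mult_mono)
  obtain c' c where c: "c' \<in> ?I i" "c \<in> carrier ?A" and zeq: "z = c' \<oplus>\<^bsub>?A\<^esub> x \<odot>\<^bsub>?A\<^esub> c"
    using Cons.prems(5) unfolding seq_mult.simps adjoin_def by blast
  have c'c: "c' \<in> carrier ?A" using c(1) A.submoduleE(1)[OF sA] by blast
  have zc: "z \<in> carrier ?A" "d i z = \<zero>\<^bsub>?B\<^esub>" using Cons.prems(4) unfolding mod_ker_def by auto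
  then have "d i c' \<oplus>\<^bsub>?B\<^esub> x \<odot>\<^bsub>?B\<^esub> d i c = \<zero>\<^bsub>?B\<^esub>"
    using zeq c c'c x by (simp add: mod_hom_add[OF d] mod_hom_smult[OF d])
  then have "x \<odot>\<^bsub>?B\<^esub> d i c \<in> ?I (Suc i)"
    using B.submodule_add_cancel[OF sB, of "d i c'" "x \<odot>\<^bsub>?B\<^esub> d i c"] dIsub c x B.submodule_zero[OF sB]
      mod_hom_closed[OF d] by auto
  then have dc: "d i c \<in> ?I (Suc i)"
    using Cons.prems(2)[of "Suc i"] mod_hom_closed[OF d c(2)] by (simp add: regular_mod_def)
  \<comment> \<open>For empty \<open>xs\<close> the element \<open>d i c\<close> is already zero and
    no exactness is called upon. For nonempty \<open>xs\<close> the bound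
    \<open>i + length (x # xs) \<le> t\<close> leaves room for \<open>Suc i < t\<close>.\<close>
  have "d i c \<in> d i ` ?I i"
  proof (cases "xs = []")
    case True
    then have "d i c = d i \<zero>\<^bsub>?A\<^esub>" using dc mod_hom_zero[OF C C d] by simp
    then show ?thesis using True by auto
  next
    case False
    then have lt: "Suc i < t" using Cons.prems(3) by (cases xs) auto
    \<comment> \<open>\<open>d i c\<close> is a cocycle one degree up and a multiple of the shorter
      sequence. The induction hypothesis there lets its coefficients be cocycles, hence coboundaries
      by exactness, so \<open>d i c\<close> is the coboundary of a multiple of the shorter
      sequence.\<close>
    have "d i c \<in> ?Z (Suc i)" using exact[OF lt] c(2) by blast
    then have "d i c \<in> seq_mult ?B (?Z (Suc i)) xs"
      using Cons.IH[of "Suc i" "d i c"] Cons.prems xs dc by simp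
    then show ?thesis unfolding dI exact[OF lt] .
  qed
  then obtain c'' where c'': "c'' \<in> ?I i" "d i c = d i c''" by (metis imageE)
  have c''c: "c'' \<in> carrier ?A" using c'' A.submoduleE(1)[OF sA] by blast
  \<comment> \<open>Correcting \<open>c\<close> by \<open>c''\<close>, which has the same
    coboundary, turns the coefficient of \<open>x\<close> into a cocycle; what remains of
    \<open>z\<close> is left to the induction hypothesis in the same degree.\<close>
  define v where "v = c \<ominus>\<^bsub>?A\<^esub> c''"
  have v: "v \<in> ?Z i"
    unfolding mod_ker_def v_def using c c''c c''(2) mod_hom_minus[OF C C d c(2) c''c] mod_hom_closed[OF d c''c]
    by (simp add: B.M.minus_eq B.M.r_neg)
  then have vc: "v \<in> carrier ?A" by (simp add: mod_ker_def)
  have ceq: "c = c'' \<oplus>\<^bsub>?A\<^esub> v" unfolding v_def using c c''c A.minus_add_cancel by simp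
  have "z = (c' \<oplus>\<^bsub>?A\<^esub> x \<odot>\<^bsub>?A\<^esub> c'') \<oplus>\<^bsub>?A\<^esub> x \<odot>\<^bsub>?A\<^esub> v"
    unfolding zeq using c'c c''c vc x by (subst ceq) (simp add: A.smult_r_distr A.M.a_ac)
  then have weq: "z \<ominus>\<^bsub>?A\<^esub> x \<odot>\<^bsub>?A\<^esub> v = c' \<oplus>\<^bsub>?A\<^esub> x \<odot>\<^bsub>?A\<^esub> c''"
    using vc x c'c c''c by (simp add: A.M.minus_eq A.M.a_assoc A.M.r_neg)
  have "z \<ominus>\<^bsub>?A\<^esub> x \<odot>\<^bsub>?A\<^esub> v \<in> ?Z i"
    using A.submodule_minus[OF mod_ker_submodule[OF C C d]] Cons.prems(4) v x
      A.submoduleE(4)[OF mod_ker_submodule[OF C C d]] by blast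
  moreover have "z \<ominus>\<^bsub>?A\<^esub> x \<odot>\<^bsub>?A\<^esub> v \<in> ?I i"
    unfolding weq using A.submoduleE(4,5)[OF sA] c(1) c''(1) x by blast
  ultimately have "z \<ominus>\<^bsub>?A\<^esub> x \<odot>\<^bsub>?A\<^esub> v \<in> seq_mult ?A (?Z i) xs"
    using Cons.IH[of i "z \<ominus>\<^bsub>?A\<^esub> x \<odot>\<^bsub>?A\<^esub> v"] Cons.prems xs by simp
  moreover have "z = (z \<ominus>\<^bsub>?A\<^esub> x \<odot>\<^bsub>?A\<^esub> v) \<oplus>\<^bsub>?A\<^esub> x \<odot>\<^bsub>?A\<^esub> v"
    using zc vc x by (simp add: A.M.minus_eq A.M.a_assoc A.M.l_neg)
  ultimately show ?case using v unfolding seq_mult.simps adjoin_def by blast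
qed simp

subsection \<open>Noetherian modules\<close>

text \<open>As an intersection, it is minimal and monotone by definition, so containments are proved
  by exhibiting a submodule and not by manipulating sums.\<close>

definition submodule_gen :: "('r, 'x) ring_scheme \<Rightarrow> ('r, 'm, 'z) module_scheme \<Rightarrow> 'm set \<Rightarrow> 'm set" where
  "submodule_gen R M S = \<Inter>{K. submodule K R M \<and> S \<subseteq> K}"

definition noetherian_module :: "('r, 'x) ring_scheme \<Rightarrow> ('r, 'm, 'z) module_scheme \<Rightarrow> bool" where
  "noetherian_module R M \<longleftrightarrow> (\<forall>K. submodule K R M \<longrightarrow>
     (\<exists>S. finite S \<and> S \<subseteq> K \<and> K \<subseteq> submodule_gen R M S))"

context module
begin

lemma submodule_gen_submodule:
  assumes "S \<subseteq> carrier M" shows "submodule (submodule_gen R M S) R M"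
proof (rule submoduleI)
  show "submodule_gen R M S \<subseteq> carrier M"
    unfolding submodule_gen_def using carrier_is_submodule assms by blast
qed (auto simp: submodule_gen_def submodule_zero submoduleE)

lemma submodule_gen_subset: "S \<subseteq> submodule_gen R M S"
  unfolding submodule_gen_def by blast

lemma submodule_gen_minimal: "submodule K R M \<Longrightarrow> S \<subseteq> K \<Longrightarrow> submodule_gen R M S \<subseteq> K"
  unfolding submodule_gen_def by blast

lemma submodule_gen_mono: "S \<subseteq> T \<Longrightarrow> submodule_gen R M S \<subseteq> submodule_gen R M T"
  unfolding submodule_gen_def by blast

lemma submodule_finsum:
  assumes "submodule K R M" "finite S" "f \<in> S \<rightarrow> K"
  shows "(\<Oplus>\<^bsub>M\<^esub>s\<in>S. f s) \<in> K"
  using assms(2,3)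
proof (induction S)
  case (insert s S)
  have "f \<in> S \<rightarrow> carrier M" "f s \<in> carrier M" using insert submoduleE(1)[OF assms(1)] by auto
  then show ?case using insert submoduleE(5)[OF assms(1)] by (simp add: M.finsum_insert)
qed (simp add: submodule_zero[OF assms(1)])

text \<open>The annihilator of the class of \<open>u\<close> in \<open>M / K\<close>. It serves
  twice: as an ideal of leading coefficients in the finiteness proof below, and as a candidate for
  an associated prime.\<close>

lemma colon_ideal:
  assumes K: "submodule K R M" and u: "u \<in> carrier M"
  shows "ideal {a \<in> carrier R. a \<odot>\<^bsub>M\<^esub> u \<in> K} R"
proof (rule idealI)
  show "ring R" by (rule R.ring_axioms)
  show "subgroup {a \<in> carrier R. a \<odot>\<^bsub>M\<^esub> u \<in> K} (add_monoid R)"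
    using submoduleE[OF K] submodule_zero[OF K] u
    by (intro R.add.subgroupI) (auto simp: smult_l_distr smult_l_minus simp flip: a_inv_def intro!: exI[of _ "\<zero>"])
  show "x \<otimes> a \<in> {a \<in> carrier R. a \<odot>\<^bsub>M\<^esub> u \<in> K}" "a \<otimes> x \<in> {a \<in> carrier R. a \<odot>\<^bsub>M\<^esub> u \<in> K}"
    if "a \<in> {a \<in> carrier R. a \<odot>\<^bsub>M\<^esub> u \<in> K}" "x \<in> carrier R" for a x
    using that submoduleE(4)[OF K] u by (auto simp: smult_assoc1 R.m_comm[of a x])
qed

lemma colon_submodule:
  assumes K: "submodule K R M" and a: "a \<in> carrier R"
  shows "submodule {u \<in> carrier M. a \<odot>\<^bsub>M\<^esub> u \<in> K} R M"
  using submoduleE[OF K] submodule_zero[OF K] a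
  by (intro submoduleI) (auto simp: smult_r_distr smult_r_minus smult_commute[of a])

lemma cyclic_submodule:
  assumes "u \<in> carrier M" shows "submodule {a \<odot>\<^bsub>M\<^esub> u | a. a \<in> carrier R} R M"
proof (rule submoduleI)
  let ?C = "{a \<odot>\<^bsub>M\<^esub> u | a. a \<in> carrier R}"
  show "?C \<subseteq> carrier M" using assms by auto
  show "\<zero>\<^bsub>M\<^esub> \<in> ?C" using assms by (auto intro!: exI[of _ "\<zero>"])
  show "\<ominus>\<^bsub>M\<^esub> x \<in> ?C" if x: "x \<in> ?C" for x
  proof -
    obtain a where "x = a \<odot>\<^bsub>M\<^esub> u" "a \<in> carrier R" using x by blast
    then show ?thesis using assms by (auto intro!: exI[of _ "\<ominus> a"] simp: smult_l_minus)
  qed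
  show "x \<oplus>\<^bsub>M\<^esub> y \<in> ?C" if xy: "x \<in> ?C" "y \<in> ?C" for x y
  proof -
    obtain a b where "x = a \<odot>\<^bsub>M\<^esub> u" "a \<in> carrier R" "y = b \<odot>\<^bsub>M\<^esub> u" "b \<in> carrier R" using xy by blast
    then show ?thesis using assms by (auto intro!: exI[of _ "a \<oplus> b"] simp: smult_l_distr)
  qed
  show "r \<odot>\<^bsub>M\<^esub> x \<in> ?C" if r: "r \<in> carrier R" and x: "x \<in> ?C" for r x
  proof -
    obtain a where "x = a \<odot>\<^bsub>M\<^esub> u" "a \<in> carrier R" using x by blast
    then show ?thesis using assms r by (auto intro!: exI[of _ "r \<otimes> a"] simp: smult_assoc1)
  qed
qed

text \<open>Induction on the number of generators. The coefficients of the last generator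
  \<open>s\<close> in elements of \<open>L\<close> form an ideal, which is finitely generated;
  elements of \<open>L\<close> realising its generators, together with generators of the part of
  \<open>L\<close> inside the span of \<open>S\<close>, generate \<open>L\<close>.\<close>

lemma submodule_of_fg_is_fg:
  assumes noeth: "noetherian_ring R" and "finite S" "S \<subseteq> carrier M"
    and "submodule L R M" "L \<subseteq> submodule_gen R M S"
  shows "\<exists>T. finite T \<and> T \<subseteq> L \<and> L \<subseteq> submodule_gen R M T"
  using assms(2-)
proof (induction S arbitrary: L)
  case empty
  have "submodule_gen R M {} \<subseteq> {\<zero>\<^bsub>M\<^esub>}" by (rule submodule_gen_minimal[OF zero_submodule]) simp
  then have "L \<subseteq> {\<zero>\<^bsub>M\<^esub>}" using empty by blast
  then have "L \<subseteq> submodule_gen R M {}" using submodule_zero[OF submodule_gen_submodule[of "{}"]] by auto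
  then show ?case by blast
next
  case (insert s S)
  note L = insert.prems(2)
  let ?G = "submodule_gen R M S"
  have s: "s \<in> carrier M" and S: "S \<subseteq> carrier M" using insert.prems by auto
  have G: "submodule ?G R M" by (rule submodule_gen_submodule[OF S])
  have Gc: "?G \<subseteq> carrier M" and Lc: "L \<subseteq> carrier M" using submoduleE(1) G L by blast+
  \<comment> \<open>\<open>adjoin M ?G L \<one>\<close> is just \<open>?G + L\<close>, so
    \<open>I\<close> collects the coefficients with which \<open>s\<close> occurs in elements of
    \<open>L\<close> modulo \<open>?G\<close>.\<close>
  define I where "I = {a \<in> carrier R. a \<odot>\<^bsub>M\<^esub> s \<in> adjoin M ?G L \<one>}"
  have "ideal I R" unfolding I_def by (rule colon_ideal[OF adjoin_submodule[OF G L] s]) simp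
  then obtain A where A: "A \<subseteq> carrier R" "finite A" "I = Idl A"
    using noetherian_ring.finetely_gen[OF noeth] by blast
  have AI: "A \<subseteq> I" unfolding A(3) by (rule R.genideal_self[OF A(1)])
  have "\<forall>a\<in>A. \<exists>l\<in>L. \<exists>v\<in>?G. a \<odot>\<^bsub>M\<^esub> s = v \<oplus>\<^bsub>M\<^esub> l"
  proof
    fix a assume "a \<in> A"
    then obtain v l where "v \<in> ?G" "l \<in> L" "a \<odot>\<^bsub>M\<^esub> s = v \<oplus>\<^bsub>M\<^esub> \<one> \<odot>\<^bsub>M\<^esub> l"
      using AI unfolding I_def adjoin_def by blast
    moreover from this have "a \<odot>\<^bsub>M\<^esub> s = v \<oplus>\<^bsub>M\<^esub> l" using Lc by auto
    ultimately show "\<exists>l\<in>L. \<exists>v\<in>?G. a \<odot>\<^bsub>M\<^esub> s = v \<oplus>\<^bsub>M\<^esub> l" by blast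
  qed
  then obtain l where l: "\<And>a. a \<in> A \<Longrightarrow> l a \<in> L \<and> (\<exists>v\<in>?G. a \<odot>\<^bsub>M\<^esub> s = v \<oplus>\<^bsub>M\<^esub> l a)"
    by metis
  have "submodule (L \<inter> ?G) R M"
    using submoduleE[OF L] submoduleE[OF G] submodule_zero[OF L] submodule_zero[OF G]
    by (intro submoduleI) auto
  then obtain T where T: "finite T" "T \<subseteq> L \<inter> ?G" "L \<inter> ?G \<subseteq> submodule_gen R M T"
    using insert.IH[OF S, of "L \<inter> ?G"] by blast
  define T' where "T' = l ` A \<union> T"
  have T': "finite T'" "T' \<subseteq> L" unfolding T'_def using A(2) l T by auto
  let ?H = "submodule_gen R M T'"
  have H: "submodule ?H R M" using submodule_gen_submodule T' Lc by blast
  have HL: "?H \<subseteq> L" by (rule submodule_gen_minimal[OF L T'(2)])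
  \<comment> \<open>The same ideal for \<open>?H\<close> in place of \<open>L\<close>. Being an
    ideal, it contains \<open>I\<close> as soon as it contains the generators \<open>A\<close>, and
    for these the elements \<open>l a\<close> are witnesses.\<close>
  define J where "J = {a \<in> carrier R. a \<odot>\<^bsub>M\<^esub> s \<in> adjoin M ?G ?H \<one>}"
  have J: "ideal J R" unfolding J_def by (rule colon_ideal[OF adjoin_submodule[OF G H] s]) simp
  have "A \<subseteq> J"
  proof
    fix a assume a: "a \<in> A"
    then obtain v where "v \<in> ?G" "a \<odot>\<^bsub>M\<^esub> s = v \<oplus>\<^bsub>M\<^esub> \<one> \<odot>\<^bsub>M\<^esub> l a" using l Lc by fastforce
    moreover have "l a \<in> ?H" using a submodule_gen_subset[of T'] unfolding T'_def by blast
    ultimately show "a \<in> J" unfolding J_def adjoin_def using a A(1) by blast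
  qed
  then have IJ: "I \<subseteq> J" unfolding A(3) by (rule R.genideal_minimal[OF J])
  have "L \<subseteq> ?H"
  proof
    fix x assume x: "x \<in> L"
    let ?C = "{a \<odot>\<^bsub>M\<^esub> s | a. a \<in> carrier R}"
    have C: "submodule ?C R M" by (rule cyclic_submodule[OF s])
    have "submodule_gen R M (insert s S) \<subseteq> adjoin M ?G ?C \<one>"
    proof (rule submodule_gen_minimal[OF adjoin_submodule[OF G C]])
      have "s \<in> ?C" using s by (auto intro!: exI[of _ "\<one>"])
      then have "\<one> \<odot>\<^bsub>M\<^esub> s \<in> adjoin M ?G ?C \<one>" by (intro smult_in_adjoin[OF G C]) auto
      then show "insert s S \<subseteq> adjoin M ?G ?C \<one>"
        using s subset_adjoin[OF G C, of \<one>] submodule_gen_subset[of S] by auto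
    qed simp
    then obtain v a where va: "v \<in> ?G" "a \<in> carrier R" "x = v \<oplus>\<^bsub>M\<^esub> a \<odot>\<^bsub>M\<^esub> s"
      using x insert.prems(3) s unfolding adjoin_def by auto
    have vc: "v \<in> carrier M" and xc: "x \<in> carrier M" using va x Gc Lc by auto
    have "a \<odot>\<^bsub>M\<^esub> s = \<ominus>\<^bsub>M\<^esub> v \<oplus>\<^bsub>M\<^esub> \<one> \<odot>\<^bsub>M\<^esub> x"
      using va(2,3) vc s xc by (simp add: M.r_neg1)
    then have "a \<in> I" unfolding I_def adjoin_def using x va submoduleE(3)[OF G] by blast
    then have "a \<in> J" using IJ by blast
    then obtain v' g where g: "v' \<in> ?G" "g \<in> ?H" "a \<odot>\<^bsub>M\<^esub> s = v' \<oplus>\<^bsub>M\<^esub> \<one> \<odot>\<^bsub>M\<^esub> g"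
      unfolding J_def adjoin_def by blast
    have gc: "g \<in> carrier M" "v' \<in> carrier M" using g HL Lc Gc by auto
    \<comment> \<open>Subtracting \<open>g\<close>, which has the same coefficient of
      \<open>s\<close> modulo \<open>?G\<close>, leaves an element lying in both \<open>L\<close>
      and \<open>?G\<close>.\<close>
    have x_eq: "x = g \<oplus>\<^bsub>M\<^esub> (v \<oplus>\<^bsub>M\<^esub> v')"
      using va g(3) gc vc by (simp add: M.a_ac)
    have "v \<oplus>\<^bsub>M\<^esub> v' \<in> L"
      using submodule_add_cancel[OF L, of g "v \<oplus>\<^bsub>M\<^esub> v'"] g(2) HL x gc vc unfolding x_eq by auto
    then have "v \<oplus>\<^bsub>M\<^esub> v' \<in> submodule_gen R M T"
      using T(3) submoduleE(5)[OF G] va(1) g(1) by blast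
    then have "v \<oplus>\<^bsub>M\<^esub> v' \<in> ?H" using submodule_gen_mono[of T T'] unfolding T'_def by blast
    then show "x \<in> ?H" unfolding x_eq using submoduleE(5)[OF H] g(2) by blast
  qed
  then show ?case using T' by blast
qed

lemma noetherian_moduleI:
  assumes "noetherian_ring R" "finite S" "S \<subseteq> carrier M" "carrier M \<subseteq> submodule_gen R M S"
  shows "noetherian_module R M"
  unfolding noetherian_module_def
  using submodule_of_fg_is_fg[OF assms(1-3)] assms(4) submoduleE(1) by (meson order_trans)

text \<open>The elements generated by finite subsets of \<open>S\<close> form a submodule
  \<open>W\<close>, and each of the finitely many generators of \<open>W\<close> involves only a
  finite subset. What matters is that the generators are chosen inside \<open>S\<close>: this cuts
  an infinite family of witnesses down to a finite one.\<close>

lemma noetherian_finite_subset: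
  assumes noeth: "noetherian_module R M" and S: "S \<subseteq> carrier M"
  shows "\<exists>T. finite T \<and> T \<subseteq> S \<and> S \<subseteq> submodule_gen R M T"
proof -
  define W where "W = {x. \<exists>T. finite T \<and> T \<subseteq> S \<and> x \<in> submodule_gen R M T}"
  have sub: "submodule (submodule_gen R M T) R M" if "T \<subseteq> S" for T
    using that S by (intro submodule_gen_submodule) blast
  have W: "submodule W R M"
  proof (rule submoduleI)
    show "W \<subseteq> carrier M" unfolding W_def using sub submoduleE(1) by blast
    show "\<zero>\<^bsub>M\<^esub> \<in> W" unfolding W_def using submodule_zero[OF sub[of "{}"]] by blast
    show "\<ominus>\<^bsub>M\<^esub> a \<in> W" if "a \<in> W" for a
      using that submoduleE(3)[OF sub] unfolding W_def by blast
    show "r \<odot>\<^bsub>M\<^esub> a \<in> W" if "r \<in> carrier R" "a \<in> W" for r a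
      using that submoduleE(4)[OF sub] unfolding W_def by blast
    show "a \<oplus>\<^bsub>M\<^esub> b \<in> W" if ab: "a \<in> W" "b \<in> W" for a b
    proof -
      obtain T U where T: "finite T" "T \<subseteq> S" "a \<in> submodule_gen R M T"
        and U: "finite U" "U \<subseteq> S" "b \<in> submodule_gen R M U" using ab unfolding W_def by blast
      then have "a \<oplus>\<^bsub>M\<^esub> b \<in> submodule_gen R M (T \<union> U)"
        using submodule_gen_mono[of T "T \<union> U"] submodule_gen_mono[of U "T \<union> U"]
          submoduleE(5)[OF sub[of "T \<union> U"]] by blast
      then show ?thesis unfolding W_def using T U by blast
    qed
  qed
  have "S \<subseteq> W" unfolding W_def using submodule_gen_subset by (auto intro!: exI[of _ "{_}"])
  obtain T0 where T0: "finite T0" "T0 \<subseteq> W" "W \<subseteq> submodule_gen R M T0"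
    using noeth W unfolding noetherian_module_def by blast
  have "\<forall>x\<in>T0. \<exists>U. finite U \<and> U \<subseteq> S \<and> x \<in> submodule_gen R M U"
    using T0(2) unfolding W_def by (auto dest: subsetD)
  from bchoice[OF this] obtain f
    where f: "\<And>x. x \<in> T0 \<Longrightarrow> finite (f x) \<and> f x \<subseteq> S \<and> x \<in> submodule_gen R M (f x)" by blast
  define T where "T = \<Union>(f ` T0)"
  have T: "finite T" "T \<subseteq> S" unfolding T_def using f T0(1) by auto
  have "T0 \<subseteq> submodule_gen R M T"
  proof
    fix x assume x: "x \<in> T0"
    then have "f x \<subseteq> T" unfolding T_def by blast
    then show "x \<in> submodule_gen R M T" using f[OF x] submodule_gen_mono[of "f x" T] by blast
  qed
  then have "W \<subseteq> submodule_gen R M T"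
    using T0(3) submodule_gen_minimal[OF sub[OF T(2)]] by blast
  then show ?thesis using T \<open>S \<subseteq> W\<close> by blast
qed

end

lemma fg_module_noetherian:
  assumes "noetherian_ring R" "fg_module R M"
  shows "noetherian_module R M"
proof -
  interpret module R M using assms(2) by (simp add: fg_module_def)
  obtain S where S: "finite S" "S \<subseteq> carrier M"
    and gen: "\<And>x. x \<in> carrier M \<Longrightarrow> \<exists>c\<in>S \<rightarrow> carrier R. x = (\<Oplus>\<^bsub>M\<^esub>s\<in>S. c s \<odot>\<^bsub>M\<^esub> s)"
    using assms(2) unfolding fg_module_def by blast
  have "carrier M \<subseteq> submodule_gen R M S"
  proof
    fix x assume "x \<in> carrier M"
    then obtain c where c: "c \<in> S \<rightarrow> carrier R" "x = (\<Oplus>\<^bsub>M\<^esub>s\<in>S. c s \<odot>\<^bsub>M\<^esub> s)" using gen by blast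
    have G: "submodule (submodule_gen R M S) R M" by (rule submodule_gen_submodule[OF S(2)])
    have "(\<lambda>s. c s \<odot>\<^bsub>M\<^esub> s) \<in> S \<rightarrow> submodule_gen R M S"
      using c(1) submoduleE(4)[OF G] submodule_gen_subset[of S] by blast
    then show "x \<in> submodule_gen R M S" unfolding c(2) by (rule submodule_finsum[OF G S(1)])
  qed
  then show ?thesis using noetherian_moduleI assms(1) S by blast
qed

subsection \<open>Prime avoidance and maximal annihilators\<close>

text \<open>Multiply elements taken from each \<open>Q\<close> outside \<open>P\<close>; primality
  keeps the product outside \<open>P\<close>.\<close>

lemma (in cring) prime_not_contains_finite_Inter:
  assumes P: "primeideal P R" and "finite \<Q>" "\<And>Q. Q \<in> \<Q> \<Longrightarrow> ideal Q R" "\<And>Q. Q \<in> \<Q> \<Longrightarrow> \<not> Q \<subseteq> P"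
  shows "\<exists>w\<in>carrier R. (\<forall>Q\<in>\<Q>. w \<in> Q) \<and> w \<notin> P"
  using assms(2-)
proof (induction \<Q>)
  case empty
  have "\<one> \<notin> P" using P ideal.one_imp_carrier primeideal.I_notcarr primeideal_def by metis
  then show ?case by blast
next
  case (insert Q \<Q>)
  then obtain w where w: "w \<in> carrier R" "\<forall>Q\<in>\<Q>. w \<in> Q" "w \<notin> P" by auto
  obtain q where q: "q \<in> Q" "q \<notin> P" using insert.prems(2)[of Q] by blast
  have Q: "ideal Q R" using insert.prems by blast
  have qc: "q \<in> carrier R" using q ideal.Icarr[OF Q] by blast
  have "q \<otimes> w \<notin> P" using primeideal.I_prime[OF P qc w(1)] q w by blast
  moreover have "q \<otimes> w \<in> Q" using ideal.I_r_closed[OF Q q(1) w(1)] .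
  moreover have "q \<otimes> w \<in> Q'" if "Q' \<in> \<Q>" for Q'
    using ideal.I_l_closed[of Q' R w q] insert.prems(1) that w qc by blast
  ultimately show ?case using qc w(1) by (intro bexI[of _ "q \<otimes> w"]) auto
qed

lemma (in cring) prime_avoidance:
  assumes I: "ideal I R" and "finite \<P>" "\<And>P. P \<in> \<P> \<Longrightarrow> primeideal P R" "\<And>P. P \<in> \<P> \<Longrightarrow> \<not> I \<subseteq> P"
  shows "\<exists>z\<in>I. \<forall>P\<in>\<P>. z \<notin> P"
  using assms(2-)
proof (induction \<P> rule: finite_psubset_induct)
  case (psubset \<P>)
  have id: "ideal P R" if "P \<in> \<P>" for P using psubset.prems(1)[OF that] primeideal.axioms(1) by blast
  show ?case
  proof (cases "\<exists>P\<in>\<P>. \<exists>Q\<in>\<P>. Q \<subset> P")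
    case True
    then obtain P Q where PQ: "P \<in> \<P>" "Q \<in> \<P>" "Q \<subset> P" by blast
    then obtain z where "z \<in> I" "\<forall>P\<in>\<P> - {Q}. z \<notin> P"
      using psubset.IH[of "\<P> - {Q}"] psubset.prems by blast
    then show ?thesis using PQ by blast
  next
    case incomparable: False
    show ?thesis
    proof (cases "\<P> = {}")
      case True
      then show ?thesis using additive_subgroup.zero_closed[OF ideal.axioms(1)[OF I]] by blast
    next
      case False
      then obtain P where P: "P \<in> \<P>" by blast
      then obtain z where z: "z \<in> I" "\<forall>Q\<in>\<P> - {P}. z \<notin> Q"
        using psubset.IH[of "\<P> - {P}"] psubset.prems by blast
      show ?thesis
      proof (cases "z \<in> P")
        case False then show ?thesis using z by blast
      next
        case zP: True
        have "\<exists>w\<in>carrier R. (\<forall>Q\<in>insert I (\<P> - {P}). w \<in> Q) \<and> w \<notin> P"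
        proof (rule prime_not_contains_finite_Inter)
          show "\<not> Q \<subseteq> P" if "Q \<in> insert I (\<P> - {P})" for Q
            using that incomparable P psubset.prems by blast
          show "finite (insert I (\<P> - {P}))" using psubset.hyps by simp
          show "primeideal P R" using P psubset.prems by blast
          show "ideal Q R" if "Q \<in> insert I (\<P> - {P})" for Q using that I id by blast
        qed
        then obtain w where w: "w \<in> carrier R" "w \<in> I" "\<forall>Q\<in>\<P> - {P}. w \<in> Q" "w \<notin> P" by blast
        have zc: "z \<in> carrier R" using ideal.Icarr[OF I z(1)] .
        \<comment> \<open>Used to see that a sum with exactly one summand in \<open>Q\<close> lies
          outside \<open>Q\<close>.\<close>
        have split: "y \<in> Q" if "ideal Q R" "x \<oplus> y \<in> Q" "x \<in> Q" "y \<in> carrier R" for x y Q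
        proof -
          interpret Q: ideal Q R by fact
          have xc: "x \<in> carrier R" using Q.Icarr that by blast
          have "\<ominus> x \<oplus> (x \<oplus> y) \<in> Q" using that by blast
          then show ?thesis using xc that(4) by (simp add: r_neg1)
        qed
        have "z \<oplus> w \<in> I" using z w additive_subgroup.a_closed[OF ideal.axioms(1)[OF I]] by blast
        moreover have "z \<oplus> w \<notin> P" using split[OF id[OF P], of z w] zP w by blast
        moreover have "z \<oplus> w \<notin> Q" if "Q \<in> \<P> - {P}" for Q
          using split[OF id, of Q w z] that w z zc a_comm[of z w] by auto
        ultimately show ?thesis by blast
      qed
    qed
  qed
qed

text \<open>The maximal members of the family of annihilators of nonzero elements of
  \<open>M / K\<close> are prime and cover all zero divisors. For finiteness, choose for each such
  \<open>P\<close> an element \<open>w P\<close> with annihilator \<open>P\<close>; finitely many of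
  these, indexed by \<open>\<Q>\<close>, generate the others. For a further \<open>P\<close>, some
  \<open>a\<close> outside \<open>P\<close> lies in all members of \<open>\<Q>\<close>, hence kills
  the generators and with them \<open>w P\<close>, which is absurd.\<close>

lemma (in module) maximal_annihilators:
  assumes noeth: "noetherian_ring R" and noethM: "noetherian_module R M" and K: "submodule K R M"
  shows "\<exists>\<P>. finite \<P> \<and>
    (\<forall>P\<in>\<P>. primeideal P R \<and> (\<exists>u\<in>carrier M - K. P = {a \<in> carrier R. a \<odot>\<^bsub>M\<^esub> u \<in> K})) \<and>
    (\<forall>a\<in>carrier R. a \<notin> \<Union>\<P> \<longrightarrow> regular_mod M K a)"
proof -
  interpret N: noetherian_ring R by fact
  define ann where "ann u = {a \<in> carrier R. a \<odot>\<^bsub>M\<^esub> u \<in> K}" for u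
  define \<A> where "\<A> = ann ` (carrier M - K)"
  define \<P> where "\<P> = {P \<in> \<A>. \<forall>Q\<in>\<A>. P \<subseteq> Q \<longrightarrow> Q = P}"
  have ideal: "ideal (ann u) R" if "u \<in> carrier M" for u
    unfolding ann_def by (rule colon_ideal[OF K that])
  have above: "\<exists>P\<in>\<P>. ann u \<subseteq> P" if u: "u \<in> carrier M - K" for u
  proof -
    let ?B = "{Q \<in> \<A>. ann u \<subseteq> Q}"
    \<comment> \<open>Over a Noetherian ring a nonempty chain of ideals contains its own union, so
      Zorn's lemma applies inside the family of annihilators.\<close>
    have "\<exists>P\<in>?B. \<forall>X\<in>?B. P \<subseteq> X \<longrightarrow> X = P"
    proof (rule subset_Zorn_nonempty)
      show "?B \<noteq> {}" using u unfolding \<A>_def by blast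
      show "\<Union>\<C> \<in> ?B" if "\<C> \<noteq> {}" "subset.chain ?B \<C>" for \<C>
      proof -
        have "\<C> \<subseteq> ?B" using that(2) by (simp add: subset.chain_def)
        moreover have "subset.chain {I. ideal I R} \<C>"
          using that(2) ideal unfolding subset.chain_def \<A>_def by blast
        ultimately show ?thesis using N.ideal_chain_is_trivial[OF that(1)] by blast
      qed
    qed
    then obtain P where "P \<in> ?B" "\<forall>X\<in>?B. P \<subseteq> X \<longrightarrow> X = P" by blast
    then show ?thesis unfolding \<P>_def by blast
  qed
  have prime: "primeideal P R" if P: "P \<in> \<P>" for P
  proof -
    obtain u where u: "u \<in> carrier M" "u \<notin> K" "P = ann u" using P unfolding \<P>_def \<A>_def by blast
    show ?thesis
    proof (rule primeidealI)
      show "ideal P R" using ideal u by blast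
      show "cring R" ..
      show "carrier R \<noteq> P" using u R.one_closed smult_one[of u] unfolding ann_def by (metis (no_types, lifting) mem_Collect_eq)
      fix a b assume a: "a \<in> carrier R" and b: "b \<in> carrier R" and ab: "a \<otimes> b \<in> P"
      show "a \<in> P \<or> b \<in> P"
      proof (rule disjCI)
        assume "b \<notin> P"
        then have bu: "b \<odot>\<^bsub>M\<^esub> u \<in> carrier M - K" using u b unfolding ann_def by auto
        \<comment> \<open>Passing from \<open>u\<close> to \<open>b u\<close> can only enlarge the
          annihilator, so maximality gives equality, and \<open>a\<close> kills
          \<open>b u\<close>.\<close>
        have "ann u \<subseteq> ann (b \<odot>\<^bsub>M\<^esub> u)"
          unfolding ann_def using submoduleE(4)[OF K] u b by (auto simp: smult_commute[of _ b])
        then have "ann (b \<odot>\<^bsub>M\<^esub> u) = P" using P u bu unfolding \<P>_def \<A>_def by blast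
        moreover have "a \<in> ann (b \<odot>\<^bsub>M\<^esub> u)"
          using ab a b u unfolding ann_def by (auto simp: smult_assoc1)
        ultimately show "a \<in> P" by blast
      qed
    qed
  qed
  have "\<forall>P\<in>\<P>. \<exists>u. u \<in> carrier M - K \<and> P = ann u" unfolding \<P>_def \<A>_def by blast
  then obtain w where w: "\<And>P. P \<in> \<P> \<Longrightarrow> w P \<in> carrier M - K \<and> P = ann (w P)" by metis
  obtain T where T: "finite T" "T \<subseteq> w ` \<P>" "w ` \<P> \<subseteq> submodule_gen R M T"
    using noetherian_finite_subset[OF noethM, of "w ` \<P>"] w by blast
  obtain \<Q> where Q: "finite \<Q>" "\<Q> \<subseteq> \<P>" "T = w ` \<Q>" using finite_subset_image[OF T(1,2)] by blast
  have "\<P> \<subseteq> \<Q>"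
  proof (rule ccontr)
    assume "\<not> \<P> \<subseteq> \<Q>"
    then obtain P where P: "P \<in> \<P>" "P \<notin> \<Q>" by blast
    have "\<not> Q \<subseteq> P" if "Q \<in> \<Q>" for Q using that P Q(2) unfolding \<P>_def by blast
    then obtain a where a: "a \<in> carrier R" "\<forall>Q\<in>\<Q>. a \<in> Q" "a \<notin> P"
      using R.prime_not_contains_finite_Inter[OF prime[OF P(1)] Q(1)] prime primeideal.axioms(1) Q(2)
      by (metis subsetD)
    have "T \<subseteq> {u \<in> carrier M. a \<odot>\<^bsub>M\<^esub> u \<in> K}"
    proof
      fix u assume "u \<in> T"
      then obtain Q' where Q': "Q' \<in> \<Q>" "u = w Q'" unfolding Q(3) by blast
      then have "a \<in> ann u" using a(2) w[of Q'] Q(2) by blast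
      then show "u \<in> {u \<in> carrier M. a \<odot>\<^bsub>M\<^esub> u \<in> K}"
        using w[of Q'] Q' Q(2) unfolding ann_def by blast
    qed
    then have "submodule_gen R M T \<subseteq> {u \<in> carrier M. a \<odot>\<^bsub>M\<^esub> u \<in> K}"
      by (rule submodule_gen_minimal[OF colon_submodule[OF K a(1)]])
    then have "a \<in> ann (w P)" using T(3) P(1) a(1) unfolding ann_def by blast
    then show False using w[OF P(1)] a(3) by blast
  qed
  then have "finite \<P>" using Q(1) finite_subset by blast
  moreover have "regular_mod M K a" if a: "a \<in> carrier R" "a \<notin> \<Union>\<P>" for a
    unfolding regular_mod_def
  proof (intro ballI impI, rule ccontr)
    fix u assume u: "u \<in> carrier M" "a \<odot>\<^bsub>M\<^esub> u \<in> K" "u \<notin> K"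
    then obtain P where "P \<in> \<P>" "ann u \<subseteq> P" using above by blast
    then show False using a u unfolding ann_def by blast
  qed
  moreover have "\<exists>u\<in>carrier M - K. P = {a \<in> carrier R. a \<odot>\<^bsub>M\<^esub> u \<in> K}" if "P \<in> \<P>" for P
    using w[OF that] unfolding ann_def by blast
  ultimately show ?thesis
    using prime by (intro exI[of _ \<P>]) blast
qed

subsection \<open>Depth of quotients\<close>

text \<open>Vanishing of \<open>Hom(k, M / K)\<close> for the residue field \<open>k\<close>. For
  Noetherian \<open>M\<close> over the local ring this means that the maximal ideal contains an
  element regular on \<open>M / K\<close>: one direction is \<open>regular_socle_free\<close>, the
  other is prime avoidance.\<close>

definition socle_free :: "('r, 'x) ring_scheme \<Rightarrow> ('r, 'm, 'z) module_scheme \<Rightarrow> 'm set \<Rightarrow> bool" where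
  "socle_free R M K \<longleftrightarrow> (\<forall>u\<in>carrier M. (\<forall>a\<in>max_ideal R. a \<odot>\<^bsub>M\<^esub> u \<in> K) \<longrightarrow> u \<in> K)"

text \<open>For a submodule \<open>K\<close>, this says that the depth of \<open>M / K\<close> is at least the given number.\<close>

fun depth_ge :: "('r, 'x) ring_scheme \<Rightarrow> ('r, 'm, 'z) module_scheme \<Rightarrow> nat \<Rightarrow> 'm set \<Rightarrow> bool" where
  "depth_ge R M 0 K \<longleftrightarrow> True"
| "depth_ge R M (Suc k) K \<longleftrightarrow>
     (\<exists>z\<in>max_ideal R. regular_mod M K z \<and> depth_ge R M k (adjoin M K (carrier M) z))"

text \<open>Sets of ring elements that cannot exhaust the maximal ideal, by prime avoidance.\<close>

definition avoidable :: "('r, 'x) ring_scheme \<Rightarrow> 'r set \<Rightarrow> bool" where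
  "avoidable R Z \<longleftrightarrow> (\<exists>\<P>. finite \<P> \<and> (\<forall>P\<in>\<P>. primeideal P R \<and> \<not> max_ideal R \<subseteq> P) \<and> Z \<subseteq> \<Union>\<P>)"

lemma avoidable_Un:
  assumes "avoidable R Y" "avoidable R Z" shows "avoidable R (Y \<union> Z)"
proof -
  obtain \<P> \<Q> where "finite \<P>" "\<forall>P\<in>\<P>. primeideal P R \<and> \<not> max_ideal R \<subseteq> P" "Y \<subseteq> \<Union>\<P>"
    "finite \<Q>" "\<forall>P\<in>\<Q>. primeideal P R \<and> \<not> max_ideal R \<subseteq> P" "Z \<subseteq> \<Union>\<Q>"
    using assms unfolding avoidable_def by blast
  then show ?thesis unfolding avoidable_def by (intro exI[of _ "\<P> \<union> \<Q>"]) auto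
qed

context module
begin

lemma in_adjoin_carrier_iff:
  assumes K: "submodule K R M" and z: "z \<in> carrier R"
  shows "w \<in> adjoin M K (carrier M) z \<longleftrightarrow> w \<in> carrier M \<and> (\<exists>v\<in>carrier M. w \<ominus>\<^bsub>M\<^esub> z \<odot>\<^bsub>M\<^esub> v \<in> K)"
proof
  assume "w \<in> adjoin M K (carrier M) z"
  then obtain k v where kv: "k \<in> K" "v \<in> carrier M" "w = k \<oplus>\<^bsub>M\<^esub> z \<odot>\<^bsub>M\<^esub> v" unfolding adjoin_def by blast
  then have "k \<in> carrier M" using submoduleE(1)[OF K] by blast
  then have "w \<ominus>\<^bsub>M\<^esub> z \<odot>\<^bsub>M\<^esub> v = k" and wc: "w \<in> carrier M" using kv z by (auto simp: M.minus_eq M.a_assoc M.r_neg)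
  then have "w \<ominus>\<^bsub>M\<^esub> z \<odot>\<^bsub>M\<^esub> v \<in> K" using kv(1) by simp
  then show "w \<in> carrier M \<and> (\<exists>v\<in>carrier M. w \<ominus>\<^bsub>M\<^esub> z \<odot>\<^bsub>M\<^esub> v \<in> K)" using kv(2) wc by blast
next
  assume "w \<in> carrier M \<and> (\<exists>v\<in>carrier M. w \<ominus>\<^bsub>M\<^esub> z \<odot>\<^bsub>M\<^esub> v \<in> K)"
  then obtain v where v: "w \<in> carrier M" "v \<in> carrier M" "w \<ominus>\<^bsub>M\<^esub> z \<odot>\<^bsub>M\<^esub> v \<in> K" by blast
  moreover have "w = (w \<ominus>\<^bsub>M\<^esub> z \<odot>\<^bsub>M\<^esub> v) \<oplus>\<^bsub>M\<^esub> z \<odot>\<^bsub>M\<^esub> v"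
    using v z by (simp add: M.minus_eq M.a_assoc M.l_neg)
  ultimately show "w \<in> adjoin M K (carrier M) z" unfolding adjoin_def by blast
qed

lemma adjoin_commute:
  assumes K: "submodule K R M" and y: "y \<in> carrier R" and z: "z \<in> carrier R"
  shows "adjoin M (adjoin M K (carrier M) y) (carrier M) z = adjoin M (adjoin M K (carrier M) z) (carrier M) y"
proof -
  have "adjoin M (adjoin M K (carrier M) y) (carrier M) z \<subseteq> adjoin M (adjoin M K (carrier M) z) (carrier M) y"
    if y: "y \<in> carrier R" and z: "z \<in> carrier R" for y z
  proof
    fix w assume "w \<in> adjoin M (adjoin M K (carrier M) y) (carrier M) z"
    then obtain k a b where k: "k \<in> K" "a \<in> carrier M" "b \<in> carrier M"
      "w = (k \<oplus>\<^bsub>M\<^esub> y \<odot>\<^bsub>M\<^esub> a) \<oplus>\<^bsub>M\<^esub> z \<odot>\<^bsub>M\<^esub> b" unfolding adjoin_def by blast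
    then have "k \<in> carrier M" using submoduleE(1)[OF K] by blast
    then have "w = (k \<oplus>\<^bsub>M\<^esub> z \<odot>\<^bsub>M\<^esub> b) \<oplus>\<^bsub>M\<^esub> y \<odot>\<^bsub>M\<^esub> a" using k y z by (simp add: M.a_ac)
    then show "w \<in> adjoin M (adjoin M K (carrier M) z) (carrier M) y" unfolding adjoin_def using k by blast
  qed
  then show ?thesis using y z by blast
qed

text \<open>If \<open>y u = w v\<close> modulo \<open>K\<close>, regularity of \<open>w\<close>
  modulo \<open>y\<close> makes \<open>v\<close> a multiple \<open>y v'\<close> modulo
  \<open>K\<close>, and cancelling \<open>y\<close> leaves \<open>u = w v'\<close> modulo
  \<open>K\<close>.\<close>

lemma regular_mod_swap:
  assumes K: "submodule K R M" and y: "y \<in> carrier R" and w: "w \<in> carrier R"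
    and regy: "regular_mod M K y" and regw: "regular_mod M (adjoin M K (carrier M) y) w"
  shows "regular_mod M (adjoin M K (carrier M) w) y"
  unfolding regular_mod_def
proof (intro ballI impI)
  fix u assume u: "u \<in> carrier M" and yu: "y \<odot>\<^bsub>M\<^esub> u \<in> adjoin M K (carrier M) w"
  note Kc = submoduleE(1)[OF K]
  have sy: "submodule (adjoin M K (carrier M) y) R M" by (rule adjoin_submodule[OF K carrier_is_submodule y])
  obtain k v where k: "k \<in> K" "v \<in> carrier M" "y \<odot>\<^bsub>M\<^esub> u = k \<oplus>\<^bsub>M\<^esub> w \<odot>\<^bsub>M\<^esub> v"
    using yu unfolding adjoin_def by blast
  have "k \<in> adjoin M K (carrier M) y" using subset_adjoin[OF K carrier_is_submodule y] k by blast
  moreover have "k \<oplus>\<^bsub>M\<^esub> w \<odot>\<^bsub>M\<^esub> v \<in> adjoin M K (carrier M) y"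
    using smult_in_adjoin[OF K carrier_is_submodule y u] k by simp
  ultimately have "w \<odot>\<^bsub>M\<^esub> v \<in> adjoin M K (carrier M) y"
    using submodule_add_cancel[OF sy] k w by simp
  then have "v \<in> adjoin M K (carrier M) y" using regw k unfolding regular_mod_def by blast
  then obtain k' v' where v: "k' \<in> K" "v' \<in> carrier M" "v = k' \<oplus>\<^bsub>M\<^esub> y \<odot>\<^bsub>M\<^esub> v'" unfolding adjoin_def by blast
  have kc: "k \<in> carrier M" "k' \<in> carrier M" using k v Kc by auto
  have "y \<odot>\<^bsub>M\<^esub> u = (k \<oplus>\<^bsub>M\<^esub> w \<odot>\<^bsub>M\<^esub> k') \<oplus>\<^bsub>M\<^esub> y \<odot>\<^bsub>M\<^esub> (w \<odot>\<^bsub>M\<^esub> v')"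
    unfolding k(3) v(3) using kc v y w by (simp add: smult_r_distr M.a_assoc smult_commute[of w y])
  then have "y \<odot>\<^bsub>M\<^esub> (u \<ominus>\<^bsub>M\<^esub> w \<odot>\<^bsub>M\<^esub> v') = k \<oplus>\<^bsub>M\<^esub> w \<odot>\<^bsub>M\<^esub> k'"
    using u v y w kc by (subst smult_minus_distr) (simp_all add: M.minus_eq M.a_assoc M.r_neg)
  moreover have "k \<oplus>\<^bsub>M\<^esub> w \<odot>\<^bsub>M\<^esub> k' \<in> K" using submoduleE(4,5)[OF K] k v w by blast
  ultimately have "u \<ominus>\<^bsub>M\<^esub> w \<odot>\<^bsub>M\<^esub> v' \<in> K" using regy u v w unfolding regular_mod_def by simp
  then show "u \<in> adjoin M K (carrier M) w" using in_adjoin_carrier_iff[OF K w] u v by blast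
qed

end

section \<open>Zero divisors, socles and depth over a Noetherian local ring\<close>

context noetherian_local_ring
begin

lemma max_ideal_maximal: "maximalideal (max_ideal R) R"
  unfolding max_ideal_def using theI'[OF unique_maximal] .

lemma max_ideal_ideal: "ideal (max_ideal R) R"
  using max_ideal_maximal maximalideal.axioms(1) by blast

lemma max_ideal_closed: "a \<in> max_ideal R \<Longrightarrow> a \<in> carrier R"
  using ideal.Icarr[OF max_ideal_ideal] .

lemma one_notin_max_ideal: "\<one> \<notin> max_ideal R"
  using ideal.one_imp_carrier[OF max_ideal_ideal] maximalideal.I_notcarr[OF max_ideal_maximal] by auto

text \<open>Zorn's lemma, again with chains that contain their union, yields a maximal ideal above
  \<open>I\<close>; by uniqueness it is the given one.\<close>

lemma proper_ideal_subset_max_ideal: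
  assumes I: "ideal I R" "\<one> \<notin> I" shows "I \<subseteq> max_ideal R"
proof -
  let ?B = "{J. ideal J R \<and> I \<subseteq> J \<and> \<one> \<notin> J}"
  have "\<exists>P\<in>?B. \<forall>X\<in>?B. P \<subseteq> X \<longrightarrow> X = P"
  proof (rule subset_Zorn_nonempty)
    show "?B \<noteq> {}" using I by blast
    show "\<Union>\<C> \<in> ?B" if "\<C> \<noteq> {}" "subset.chain ?B \<C>" for \<C>
    proof -
      have "\<C> \<subseteq> ?B" using that(2) by (simp add: subset.chain_def)
      moreover have "subset.chain {I. ideal I R} \<C>"
        using that(2) unfolding subset.chain_def by blast
      ultimately show ?thesis using ideal_chain_is_trivial[OF that(1)] by blast
    qed
  qed
  then obtain P where P: "ideal P R" "I \<subseteq> P" "\<one> \<notin> P" and max: "\<forall>X\<in>?B. P \<subseteq> X \<longrightarrow> X = P" by blast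
  have "maximalideal P R"
  proof (rule maximalidealI[OF P(1)])
    show "carrier R \<noteq> P" using P(3) by auto
    show "J = P \<or> J = carrier R" if "ideal J R" "P \<subseteq> J" "J \<subseteq> carrier R" for J
      using max that P ideal.one_imp_carrier[OF that(1)] by blast
  qed
  then have "P = max_ideal R" using unique_maximal max_ideal_maximal by blast
  then show ?thesis using P by blast
qed

lemma unit_if_notin_max_ideal:
  assumes "a \<in> carrier R" "a \<notin> max_ideal R" shows "\<exists>b\<in>carrier R. b \<otimes> a = \<one>"
proof -
  have "\<one> \<in> PIdl a"
    using proper_ideal_subset_max_ideal[OF cgenideal_ideal[OF assms(1)]] cgenideal_self[OF assms(1)] assms(2)
    by blast
  then show ?thesis unfolding cgenideal_def by force
qed

lemma avoid:
  assumes "avoidable R Z" shows "\<exists>z\<in>max_ideal R. z \<notin> Z"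
proof -
  obtain \<P> where "finite \<P>" "\<forall>P\<in>\<P>. primeideal P R \<and> \<not> max_ideal R \<subseteq> P" "Z \<subseteq> \<Union>\<P>"
    using assms unfolding avoidable_def by blast
  then show ?thesis using prime_avoidance[OF max_ideal_ideal, of \<P>] by blast
qed

text \<open>The primes covering the zero divisors are annihilators of nonzero classes in
  \<open>M / K\<close>; if one of them contained the maximal ideal, its class would be a nonzero
  socle element.\<close>

lemma zero_divisors_avoidable:
  assumes "module R M" "noetherian_module R M" "submodule K R M" "socle_free R M K"
  shows "avoidable R {a \<in> carrier R. \<not> regular_mod M K a}"
proof -
  interpret module R M by fact
  obtain \<P> where P: "finite \<P>"
    "\<forall>P\<in>\<P>. primeideal P R \<and> (\<exists>u\<in>carrier M - K. P = {a \<in> carrier R. a \<odot>\<^bsub>M\<^esub> u \<in> K})"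
    "\<forall>a\<in>carrier R. a \<notin> \<Union>\<P> \<longrightarrow> regular_mod M K a"
    using maximal_annihilators[OF noetherian_ring_axioms assms(2,3)] by (elim exE conjE) (rule that)
  have "primeideal P R \<and> \<not> max_ideal R \<subseteq> P" if PP: "P \<in> \<P>" for P
  proof -
    obtain u where u: "primeideal P R" "u \<in> carrier M" "u \<notin> K" "P = {a \<in> carrier R. a \<odot>\<^bsub>M\<^esub> u \<in> K}"
      using P(2) PP by blast
    then have "\<not> (\<forall>a\<in>max_ideal R. a \<odot>\<^bsub>M\<^esub> u \<in> K)" using assms(4) unfolding socle_free_def by blast
    then show ?thesis using u(1,4) by blast
  qed
  moreover have "{a \<in> carrier R. \<not> regular_mod M K a} \<subseteq> \<Union>\<P>" using P(3) by blast
  ultimately show ?thesis unfolding avoidable_def using P(1) by (intro exI[of _ \<P>] conjI ballI) auto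
qed

lemma regular_socle_free: "z \<in> max_ideal R \<Longrightarrow> regular_mod M K z \<Longrightarrow> socle_free R M K"
  unfolding socle_free_def regular_mod_def by blast

text \<open>Both socles are isomorphic to \<open>Ext\<^sup>1(k, M / K)\<close> for the residue field \<open>k\<close>; multiplication by \<open>y\<close> followed by division
  by \<open>z\<close> realises the isomorphism.\<close>

lemma socle_free_exchange:
  assumes "module R M" and K: "submodule K R M"
    and y: "y \<in> max_ideal R" "regular_mod M K y" and z: "z \<in> max_ideal R" "regular_mod M K z"
    and free: "socle_free R M (adjoin M K (carrier M) y)"
  shows "socle_free R M (adjoin M K (carrier M) z)"
  unfolding socle_free_def
proof (intro ballI impI)
  interpret module R M by fact
  note Kc = submoduleE(1)[OF K] and mc = max_ideal_closed
  have yc: "y \<in> carrier R" and zc: "z \<in> carrier R" using y z mc by auto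
  fix u assume u: "u \<in> carrier M" and soc: "\<forall>a\<in>max_ideal R. a \<odot>\<^bsub>M\<^esub> u \<in> adjoin M K (carrier M) z"
  \<comment> \<open>The relation \<open>y u = z v\<close> modulo \<open>K\<close> sends the socle
    class of \<open>u\<close> modulo \<open>z\<close> to that of \<open>v\<close> modulo
    \<open>y\<close>.\<close>
  obtain k v where k: "k \<in> K" "v \<in> carrier M" "y \<odot>\<^bsub>M\<^esub> u = k \<oplus>\<^bsub>M\<^esub> z \<odot>\<^bsub>M\<^esub> v"
    using soc y unfolding adjoin_def by blast
  have kc: "k \<in> carrier M" using k Kc by auto
  have "a \<odot>\<^bsub>M\<^esub> v \<in> adjoin M K (carrier M) y" if a: "a \<in> max_ideal R" for a
  proof -
    have ac: "a \<in> carrier R" using a mc by auto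
    obtain k' w where k': "k' \<in> K" "w \<in> carrier M" "a \<odot>\<^bsub>M\<^esub> u = k' \<oplus>\<^bsub>M\<^esub> z \<odot>\<^bsub>M\<^esub> w"
      using soc a unfolding adjoin_def by blast
    have k'c: "k' \<in> carrier M" using k' Kc by auto
    \<comment> \<open>Modulo \<open>K\<close>, the product \<open>a y u\<close> equals both
      \<open>z a v\<close> and \<open>z y w\<close>. Cancelling \<open>z\<close> will put
      \<open>a v\<close> into \<open>K + y M\<close>, so that \<open>v\<close> represents a socle
      element.\<close>
    have "a \<odot>\<^bsub>M\<^esub> k \<oplus>\<^bsub>M\<^esub> z \<odot>\<^bsub>M\<^esub> (a \<odot>\<^bsub>M\<^esub> v) = y \<odot>\<^bsub>M\<^esub> k' \<oplus>\<^bsub>M\<^esub> z \<odot>\<^bsub>M\<^esub> (y \<odot>\<^bsub>M\<^esub> w)"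
    proof -
      have "a \<odot>\<^bsub>M\<^esub> (y \<odot>\<^bsub>M\<^esub> u) = y \<odot>\<^bsub>M\<^esub> (a \<odot>\<^bsub>M\<^esub> u)" using ac yc u smult_commute by blast
      then show ?thesis unfolding k(3) k'(3)
        using ac yc zc kc k'c k k' by (simp add: smult_r_distr smult_commute[of a z] smult_commute[of y z])
    qed
    then have "z \<odot>\<^bsub>M\<^esub> (a \<odot>\<^bsub>M\<^esub> v) = \<ominus>\<^bsub>M\<^esub> (a \<odot>\<^bsub>M\<^esub> k) \<oplus>\<^bsub>M\<^esub> (y \<odot>\<^bsub>M\<^esub> k' \<oplus>\<^bsub>M\<^esub> z \<odot>\<^bsub>M\<^esub> (y \<odot>\<^bsub>M\<^esub> w))"
      using ac zc kc k by (metis M.r_neg1 smult_closed)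
    then have "z \<odot>\<^bsub>M\<^esub> (a \<odot>\<^bsub>M\<^esub> v \<ominus>\<^bsub>M\<^esub> y \<odot>\<^bsub>M\<^esub> w) = \<ominus>\<^bsub>M\<^esub> (a \<odot>\<^bsub>M\<^esub> k) \<oplus>\<^bsub>M\<^esub> y \<odot>\<^bsub>M\<^esub> k'"
      using ac yc zc kc k'c k k' by (subst smult_minus_distr) (simp_all add: M.minus_eq M.a_assoc M.r_neg)
    moreover have "\<ominus>\<^bsub>M\<^esub> (a \<odot>\<^bsub>M\<^esub> k) \<oplus>\<^bsub>M\<^esub> y \<odot>\<^bsub>M\<^esub> k' \<in> K" using submoduleE(3,4,5)[OF K] k k' ac yc by blast
    ultimately have "a \<odot>\<^bsub>M\<^esub> v \<ominus>\<^bsub>M\<^esub> y \<odot>\<^bsub>M\<^esub> w \<in> K"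
      using z(2) k k' ac yc unfolding regular_mod_def by simp
    then show ?thesis using in_adjoin_carrier_iff[OF K yc] k k' ac by blast
  qed
  \<comment> \<open>As this socle is zero, \<open>v = y v'\<close> modulo \<open>K\<close>; then
    \<open>y u = y z v'\<close> modulo \<open>K\<close>, and cancelling \<open>y\<close> gives
    \<open>u = z v'\<close> modulo \<open>K\<close>.\<close>
  then have "v \<in> adjoin M K (carrier M) y" using free k unfolding socle_free_def by blast
  then obtain k' v' where v: "k' \<in> K" "v' \<in> carrier M" "v = k' \<oplus>\<^bsub>M\<^esub> y \<odot>\<^bsub>M\<^esub> v'" unfolding adjoin_def by blast
  have k'c: "k' \<in> carrier M" using v Kc by auto
  have "y \<odot>\<^bsub>M\<^esub> u = (k \<oplus>\<^bsub>M\<^esub> z \<odot>\<^bsub>M\<^esub> k') \<oplus>\<^bsub>M\<^esub> y \<odot>\<^bsub>M\<^esub> (z \<odot>\<^bsub>M\<^esub> v')"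
    unfolding k(3) v(3) using kc k'c v yc zc by (simp add: smult_r_distr M.a_assoc smult_commute[of z y])
  then have "y \<odot>\<^bsub>M\<^esub> (u \<ominus>\<^bsub>M\<^esub> z \<odot>\<^bsub>M\<^esub> v') = k \<oplus>\<^bsub>M\<^esub> z \<odot>\<^bsub>M\<^esub> k'"
    using u v yc zc kc k'c by (subst smult_minus_distr) (simp_all add: M.minus_eq M.a_assoc M.r_neg)
  moreover have "k \<oplus>\<^bsub>M\<^esub> z \<odot>\<^bsub>M\<^esub> k' \<in> K" using submoduleE(4,5)[OF K] k v zc by blast
  ultimately have "u \<ominus>\<^bsub>M\<^esub> z \<odot>\<^bsub>M\<^esub> v' \<in> K" using y(2) u v zc unfolding regular_mod_def by simp
  then show "u \<in> adjoin M K (carrier M) z" using in_adjoin_carrier_iff[OF K zc] u v by blast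
qed

text \<open>\<open>depth_ge\<close> offers only some regular \<open>y\<close> modulo which the bound
  drops by one; the claim is that any regular \<open>z\<close> does. The two are compared through an
  auxiliary element \<open>w\<close> that forms regular pairs with both. Its existence requires the
  quotient by \<open>z\<close> to be socle-free, and this is what \<open>socle_free_exchange\<close>
  provides.\<close>

lemma depth_ge_adjoin:
  assumes "module R M" "noetherian_module R M"
  shows "submodule K R M \<Longrightarrow> z \<in> max_ideal R \<Longrightarrow> regular_mod M K z \<Longrightarrow> depth_ge R M (Suc k) K \<Longrightarrow>
    depth_ge R M k (adjoin M K (carrier M) z)"
proof (induction k arbitrary: K z)
  case (Suc k)
  interpret module R M by fact
  note K = Suc.prems(1) and z = Suc.prems(2,3)
  let ?ad = "\<lambda>K x. adjoin M K (carrier M) x"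
  have sub: "submodule (?ad K x) R M" if "x \<in> max_ideal R" for x
    using adjoin_submodule[OF K carrier_is_submodule max_ideal_closed[OF that]] .
  obtain y where y: "y \<in> max_ideal R" "regular_mod M K y" "depth_ge R M (Suc k) (?ad K y)"
    using Suc.prems(4) by (auto simp del: depth_ge.simps(2) simp: depth_ge.simps(2)[of _ _ "Suc k"])
  then have freey: "socle_free R M (?ad K y)" using regular_socle_free by (meson depth_ge.simps(2))
  have freez: "socle_free R M (?ad K z)"
    by (rule socle_free_exchange[OF assms(1) K y(1,2) z freey])
  have free: "socle_free R M K" using regular_socle_free y by blast
  have "avoidable R ({a \<in> carrier R. \<not> regular_mod M K a} \<union> {a \<in> carrier R. \<not> regular_mod M (?ad K y) a}
      \<union> {a \<in> carrier R. \<not> regular_mod M (?ad K z) a})"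
    by (intro avoidable_Un zero_divisors_avoidable assms K sub free freey freez y z)
  from avoid[OF this] obtain w where w: "w \<in> max_ideal R" "regular_mod M K w"
    "regular_mod M (?ad K y) w" "regular_mod M (?ad K z) w" using max_ideal_closed by blast
  note yc = max_ideal_closed[OF y(1)] and zc = max_ideal_closed[OF z(1)] and wc = max_ideal_closed[OF w(1)]
  \<comment> \<open>The bound is carried from \<open>y\<close> to \<open>w\<close>, then from
    \<open>w\<close> to \<open>z\<close>. Each passage applies the induction hypothesis one level
    down and swaps the two adjoined elements.\<close>
  have "depth_ge R M k (?ad (?ad K y) w)" by (rule Suc.IH[OF sub[OF y(1)] w(1,3) y(3)])
  then have "depth_ge R M k (?ad (?ad K w) y)" unfolding adjoin_commute[OF K yc wc] .
  moreover have "regular_mod M (?ad K w) y" by (rule regular_mod_swap[OF K yc wc y(2) w(3)])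
  ultimately have "depth_ge R M (Suc k) (?ad K w)" using y(1) by auto
  moreover have "regular_mod M (?ad K w) z" by (rule regular_mod_swap[OF K zc wc z(2) w(4)])
  ultimately have "depth_ge R M k (?ad (?ad K w) z)"
    using Suc.IH[OF sub[OF w(1)] z(1)] by blast
  then have "depth_ge R M k (?ad (?ad K z) w)" unfolding adjoin_commute[OF K wc zc] .
  then show ?case using w by auto
qed simp

text \<open>An element regular on all three quotients exists because a union of three avoidable sets
  is avoidable, and \<open>depth_ge_adjoin\<close> lowers all three bounds in step whatever element
  was picked. The accumulator \<open>xs\<close> holds the elements already chosen; later ones are
  put in front.\<close>

lemma common_weakly_regular_sequence:
  assumes A: "module R A" "noetherian_module R A" and B: "module R B" "noetherian_module R B"
    and C: "module R C" "noetherian_module R C"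
  shows "set xs \<subseteq> max_ideal R \<Longrightarrow>
    depth_ge R A n (seq_mult A (carrier A) xs) \<Longrightarrow> weakly_regular A xs \<Longrightarrow>
    depth_ge R B n (seq_mult B (carrier B) xs) \<Longrightarrow> weakly_regular B xs \<Longrightarrow>
    depth_ge R C n (seq_mult C (carrier C) xs) \<Longrightarrow> weakly_regular C xs \<Longrightarrow>
    \<exists>ys. length ys = n \<and> set ys \<subseteq> max_ideal R \<and> weakly_regular A (ys @ xs) \<and>
      weakly_regular B (ys @ xs) \<and> weakly_regular C (ys @ xs)"
proof (induction n arbitrary: xs)
  case (Suc n)
  have xs: "set xs \<subseteq> carrier R" using Suc.prems(1) max_ideal_closed by blast
  note sub = module.seq_mult_submodule[OF _ module.carrier_is_submodule xs]
  note sA = sub[OF A(1) A(1)] and sB = sub[OF B(1) B(1)] and sC = sub[OF C(1) C(1)]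
  have "avoidable R ({a \<in> carrier R. \<not> regular_mod A (seq_mult A (carrier A) xs) a} \<union>
      {a \<in> carrier R. \<not> regular_mod B (seq_mult B (carrier B) xs) a} \<union>
      {a \<in> carrier R. \<not> regular_mod C (seq_mult C (carrier C) xs) a})"
    by (intro avoidable_Un zero_divisors_avoidable A B C sA sB sC)
      (use Suc.prems regular_socle_free in \<open>meson depth_ge.simps(2)\<close>)+
  from avoid[OF this] obtain z where z: "z \<in> max_ideal R"
    "regular_mod A (seq_mult A (carrier A) xs) z" "regular_mod B (seq_mult B (carrier B) xs) z"
    "regular_mod C (seq_mult C (carrier C) xs) z" using max_ideal_closed by blast
  have "\<exists>ys. length ys = n \<and> set ys \<subseteq> max_ideal R \<and> weakly_regular A (ys @ z # xs) \<and>
      weakly_regular B (ys @ z # xs) \<and> weakly_regular C (ys @ z # xs)"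
    using Suc.prems z depth_ge_adjoin[OF A sA z(1,2)] depth_ge_adjoin[OF B sB z(1,3)]
      depth_ge_adjoin[OF C sC z(1,4)]
    by (intro Suc.IH) auto
  then obtain ys where "length ys = n" "set ys \<subseteq> max_ideal R" "weakly_regular A (ys @ z # xs)"
      "weakly_regular B (ys @ z # xs)" "weakly_regular C (ys @ z # xs)" by blast
  then show ?case using z(1) by (intro exI[of _ "ys @ [z]"]) auto
qed simp

end

subsection \<open>Comparison with regular sequences\<close>

context module
begin

lemma quot_module_coset_eq_iff:
  assumes "submodule H R M" "u \<in> carrier M"
  shows "H +>\<^bsub>M\<^esub> u = H \<longleftrightarrow> u \<in> H"
proof
  assume "H +>\<^bsub>M\<^esub> u = H"
  moreover have "\<zero>\<^bsub>M\<^esub> \<oplus>\<^bsub>M\<^esub> u \<in> H +>\<^bsub>M\<^esub> u"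
    unfolding a_r_coset_def' using submodule_zero[OF assms(1)] by blast
  ultimately show "u \<in> H" using assms(2) by simp
next
  assume "u \<in> H"
  then show "H +>\<^bsub>M\<^esub> u = H"
    using M.a_coset_join2[OF assms(2)] assms(1) submodule.axioms(1) by blast
qed

lemma in_coset_self:
  assumes "submodule H R M" "u \<in> carrier M" shows "u \<in> H +>\<^bsub>M\<^esub> u"
proof -
  have "\<zero>\<^bsub>M\<^esub> \<oplus>\<^bsub>M\<^esub> u \<in> H +>\<^bsub>M\<^esub> u"
    unfolding a_r_coset_def' using submodule_zero[OF assms(1)] by blast
  then show ?thesis using assms(2) by simp
qed

end

text \<open>The scalar multiple of a coset is a union over its representatives. If
  \<open>a u\<close> lies in \<open>H\<close>, every representative contributes \<open>H\<close>;
  conversely \<open>a u\<close> belongs to that union, so the union can equal \<open>H\<close> only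
  if \<open>a u\<close> lies in \<open>H\<close>.\<close>

lemma nonzerodivisor_on_quot_module_iff:
  fixes M :: "('r, 'm) module"
  assumes "module R M" and H: "submodule H R M" and a: "a \<in> carrier R"
  shows "nonzerodivisor_on (quot_module M H) a \<longleftrightarrow> regular_mod M H a"
proof -
  interpret module R M by fact
  have "(\<Union>x\<in>H +>\<^bsub>M\<^esub> u. H +>\<^bsub>M\<^esub> (a \<odot>\<^bsub>M\<^esub> x)) = H \<longleftrightarrow> a \<odot>\<^bsub>M\<^esub> u \<in> H" if u: "u \<in> carrier M" for u
  proof
    assume "(\<Union>x\<in>H +>\<^bsub>M\<^esub> u. H +>\<^bsub>M\<^esub> (a \<odot>\<^bsub>M\<^esub> x)) = H"
    then show "a \<odot>\<^bsub>M\<^esub> u \<in> H"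
      using in_coset_self[OF H u] in_coset_self[OF H, of "a \<odot>\<^bsub>M\<^esub> u"] a u by blast
  next
    assume au: "a \<odot>\<^bsub>M\<^esub> u \<in> H"
    have "H +>\<^bsub>M\<^esub> (a \<odot>\<^bsub>M\<^esub> x) = H" if x: "x \<in> H +>\<^bsub>M\<^esub> u" for x
    proof -
      obtain h where h: "h \<in> H" "x = h \<oplus>\<^bsub>M\<^esub> u" using x unfolding a_r_coset_def' by blast
      then have hc: "h \<in> carrier M" using submoduleE(1)[OF H] by blast
      have "a \<odot>\<^bsub>M\<^esub> x = a \<odot>\<^bsub>M\<^esub> h \<oplus>\<^bsub>M\<^esub> a \<odot>\<^bsub>M\<^esub> u" unfolding h(2) using hc u a by (simp add: smult_r_distr)
      then have "a \<odot>\<^bsub>M\<^esub> x \<in> H" using submoduleE(4,5)[OF H] h au a by simp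
      then show ?thesis using quot_module_coset_eq_iff[OF H] submoduleE(1)[OF H] by blast
    qed
    then show "(\<Union>x\<in>H +>\<^bsub>M\<^esub> u. H +>\<^bsub>M\<^esub> (a \<odot>\<^bsub>M\<^esub> x)) = H" using in_coset_self[OF H u] by blast
  qed
  then show ?thesis
    unfolding nonzerodivisor_on_def regular_mod_def quot_module_def A_RCOSETS_def'
    by (simp add: quot_module_coset_eq_iff[OF H])
qed

lemma seq_submodule_snoc:
  fixes M :: "('r, 'm) module"
  assumes "module R M" "set ys \<subseteq> carrier R" "x \<in> carrier R"
  shows "seq_submodule M (ys @ [x]) = adjoin M (seq_submodule M ys) (carrier M) x"
proof -
  interpret module R M by fact
  let ?n = "length ys"
  have ysc: "ys ! i \<in> carrier R" if "i < ?n" for i using assms(2) that nth_mem by blast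
  have eq: "(\<Oplus>\<^bsub>M\<^esub>i\<in>{..<length (ys @ [x])}. ((ys @ [x]) ! i) \<odot>\<^bsub>M\<^esub> f i) =
    (\<Oplus>\<^bsub>M\<^esub>i\<in>{..<?n}. (ys ! i) \<odot>\<^bsub>M\<^esub> f i) \<oplus>\<^bsub>M\<^esub> x \<odot>\<^bsub>M\<^esub> f ?n"
    if f: "f \<in> {..<Suc ?n} \<rightarrow> carrier M" for f
  proof -
    have fc: "f i \<in> carrier M" if "i < Suc ?n" for i using f that by auto
    have *: "(\<Oplus>\<^bsub>M\<^esub>i\<in>{..<?n}. ((ys @ [x]) ! i) \<odot>\<^bsub>M\<^esub> f i) = (\<Oplus>\<^bsub>M\<^esub>i\<in>{..<?n}. (ys ! i) \<odot>\<^bsub>M\<^esub> f i)"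
      using fc ysc by (intro M.finsum_cong') (auto simp: nth_append)
    have c: "(\<Oplus>\<^bsub>M\<^esub>i\<in>{..<?n}. (ys ! i) \<odot>\<^bsub>M\<^esub> f i) \<in> carrier M"
      using fc ysc by (intro M.finsum_closed) auto
    have "(\<Oplus>\<^bsub>M\<^esub>i\<in>insert ?n {..<?n}. ((ys @ [x]) ! i) \<odot>\<^bsub>M\<^esub> f i) =
      ((ys @ [x]) ! ?n) \<odot>\<^bsub>M\<^esub> f ?n \<oplus>\<^bsub>M\<^esub> (\<Oplus>\<^bsub>M\<^esub>i\<in>{..<?n}. ((ys @ [x]) ! i) \<odot>\<^bsub>M\<^esub> f i)"
      using fc ysc assms(3) by (intro M.finsum_insert) (auto simp: nth_append)
    then show ?thesis using * c fc assms(3) by (simp add: lessThan_Suc M.a_comm)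
  qed
  show ?thesis
  proof (intro equalityI subsetI)
    fix w assume "w \<in> seq_submodule M (ys @ [x])"
    then obtain f where f: "f \<in> {..<Suc ?n} \<rightarrow> carrier M"
      "w = (\<Oplus>\<^bsub>M\<^esub>i\<in>{..<length (ys @ [x])}. ((ys @ [x]) ! i) \<odot>\<^bsub>M\<^esub> f i)"
      unfolding seq_submodule_def by auto
    moreover have "f \<in> {..<?n} \<rightarrow> carrier M" "f ?n \<in> carrier M" using f(1) by auto
    ultimately show "w \<in> adjoin M (seq_submodule M ys) (carrier M) x"
      unfolding f(2) eq[OF f(1)] adjoin_def seq_submodule_def by blast
  next
    fix w assume "w \<in> adjoin M (seq_submodule M ys) (carrier M) x"
    then obtain f a where f: "f \<in> {..<?n} \<rightarrow> carrier M" "a \<in> carrier M"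
      "w = (\<Oplus>\<^bsub>M\<^esub>i\<in>{..<?n}. (ys ! i) \<odot>\<^bsub>M\<^esub> f i) \<oplus>\<^bsub>M\<^esub> x \<odot>\<^bsub>M\<^esub> a"
      unfolding adjoin_def seq_submodule_def by blast
    let ?g = "f(?n := a)"
    have g: "?g \<in> {..<Suc ?n} \<rightarrow> carrier M" using f by (auto simp: less_Suc_eq)
    have "(\<Oplus>\<^bsub>M\<^esub>i\<in>{..<?n}. (ys ! i) \<odot>\<^bsub>M\<^esub> ?g i) = (\<Oplus>\<^bsub>M\<^esub>i\<in>{..<?n}. (ys ! i) \<odot>\<^bsub>M\<^esub> f i)"
      using f ysc by (intro M.finsum_cong') auto
    then have "w = (\<Oplus>\<^bsub>M\<^esub>i\<in>{..<length (ys @ [x])}. ((ys @ [x]) ! i) \<odot>\<^bsub>M\<^esub> ?g i)"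
      unfolding eq[OF g] f(3) by simp
    moreover have "?g \<in> {..<length (ys @ [x])} \<rightarrow> carrier M" using g by simp
    ultimately show "w \<in> seq_submodule M (ys @ [x])" unfolding seq_submodule_def by blast
  qed
qed

lemma seq_submodule_Nil: "module R M \<Longrightarrow> seq_submodule M [] = {\<zero>\<^bsub>M\<^esub>}"
  unfolding seq_submodule_def using abelian_monoid.finsum_empty[of M]
  by (auto simp: module_def abelian_group_def)

text \<open>\<open>rev\<close> reconciles two conventions: a regular sequence grows at the end of
  the list, \<open>seq_mult\<close> at its head.\<close>

lemma seq_submodule_rev:
  assumes "module R M" "set xs \<subseteq> carrier R"
  shows "seq_submodule M (rev xs) = seq_mult M (carrier M) xs"
  using assms(2) by (induction xs) (auto simp: seq_submodule_Nil[OF assms(1)] seq_submodule_snoc[OF assms(1)])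

lemma seq_submodule_submodule:
  assumes "module R M" "set xs \<subseteq> carrier R"
  shows "submodule (seq_submodule M xs) R M"
  using seq_submodule_rev[of R M "rev xs"] assms
    module.seq_mult_submodule[OF assms(1) module.carrier_is_submodule[OF assms(1)], of "rev xs"] by simp

lemma self_module_module: "cring R \<Longrightarrow> module R (self_module R)"
proof -
  assume "cring R"
  then interpret cring R .
  show ?thesis
  proof (rule moduleI)
    show "cring R" by fact
    show "abelian_group (self_module R)"
      by (rule abelian_groupI) (auto simp: self_module_def a_ac intro: l_neg)
  qed (auto simp: self_module_def m_assoc l_distr r_distr)
qed

lemma self_module_simps [simp]:
  "carrier (self_module R) = carrier R" "zero (self_module R) = zero R"
  "add (self_module R) = add R" "smult (self_module R) = mult R"
  by (simp_all add: self_module_def)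

section \<open>From the supremum defining the depth to iterated quotients and back\<close>

context noetherian_local_ring
begin

lemma self_module_noetherian: "noetherian_module R (self_module R)"
proof -
  interpret S: module R "self_module R" by (rule self_module_module) (rule is_cring)
  have G: "submodule (submodule_gen R (self_module R) {\<one>}) R (self_module R)"
    by (rule S.submodule_gen_submodule) simp
  show ?thesis
  proof (rule S.noetherian_moduleI[of "{\<one>}", OF noetherian_ring_axioms])
    show "carrier (self_module R) \<subseteq> submodule_gen R (self_module R) {\<one>}"
    proof
      fix a assume a: "a \<in> carrier (self_module R)"
      show "a \<in> submodule_gen R (self_module R) {\<one>}"
        using S.submoduleE(4)[OF G, of a "\<one>"] S.submodule_gen_subset[of "{\<one>}"] a by simp
    qed
  qed auto
qed

text \<open>Here \<open>i\<close> elements have been used and \<open>k\<close> are still to come;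
  \<open>xs ! i\<close> is the witness for the next step.\<close>

lemma depth_ge_if_regular_sequence:
  fixes M :: "('a, 'm) module"
  assumes M: "module R M" and reg: "regular_sequence R M xs" and xs: "set xs \<subseteq> max_ideal R"
  shows "k + i \<le> length xs \<Longrightarrow> depth_ge R M k (seq_submodule M (take i xs))"
proof (induction k arbitrary: i)
  case (Suc k)
  then have i: "i < length xs" by simp
  have xc: "set xs \<subseteq> carrier R" using xs max_ideal_closed by blast
  have xi: "xs ! i \<in> max_ideal R" using xs i by auto
  have tk: "set (take i xs) \<subseteq> carrier R" using xc by (meson order_trans set_take_subset)
  have "regular_mod M (seq_submodule M (take i xs)) (xs ! i)"
    using reg i nonzerodivisor_on_quot_module_iff[OF M seq_submodule_submodule[OF M tk] max_ideal_closed[OF xi]]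
    unfolding regular_sequence_def by blast
  moreover have "depth_ge R M k (adjoin M (seq_submodule M (take i xs)) (carrier M) (xs ! i))"
    using Suc.IH[of "Suc i"] Suc.prems seq_submodule_snoc[OF M tk max_ideal_closed[OF xi]]
    by (simp add: take_Suc_conv_app_nth[OF i])
  ultimately show ?case using xi by auto
qed simp

text \<open>Every element is regular on a zero quotient, so the zero of the ring is a witness at
  every step.\<close>

lemma depth_ge_zero_module:
  assumes "module R M" shows "submodule K R M \<Longrightarrow> carrier M \<subseteq> K \<Longrightarrow> depth_ge R M k K"
proof (induction k arbitrary: K)
  case (Suc k)
  interpret module R M by fact
  have z: "\<zero> \<in> max_ideal R" using additive_subgroup.zero_closed[OF ideal.axioms(1)[OF max_ideal_ideal]] .
  have "regular_mod M K \<zero>" unfolding regular_mod_def using Suc.prems by blast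
  moreover have "depth_ge R M k (adjoin M K (carrier M) \<zero>)"
    using Suc.IH[OF adjoin_submodule[OF Suc.prems(1) carrier_is_submodule]]
      subset_adjoin[OF Suc.prems(1) carrier_is_submodule] Suc.prems by auto
  ultimately show ?case using z by auto
qed simp

lemma depth_ge_if_depth:
  fixes M :: "('a, 'm) module"
  assumes M: "module R M" and depth: "depth R M \<ge> enat t"
  shows "depth_ge R M t {\<zero>\<^bsub>M\<^esub>}"
proof (cases "zero_module M \<or> t = 0")
  case True
  then show ?thesis
    using depth_ge_zero_module[OF M module.zero_submodule[OF M]] unfolding zero_module_def by auto
next
  case False
  \<comment> \<open>If no sequence reached length \<open>t\<close>, the supremum would be at most
    \<open>t'\<close>, one below \<open>t\<close>; this is why \<open>t = 0\<close> is treated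
    apart.\<close>
  then obtain t' where t: "t = Suc t'" by (cases t) auto
  have "\<exists>xs. regular_sequence R M xs \<and> set xs \<subseteq> max_ideal R \<and> t \<le> length xs"
  proof (rule ccontr)
    assume no: "\<not> (\<exists>xs. regular_sequence R M xs \<and> set xs \<subseteq> max_ideal R \<and> t \<le> length xs)"
    have "Sup {enat (length xs) | xs. regular_sequence R M xs \<and> set xs \<subseteq> max_ideal R} \<le> enat t'"
    proof (rule Sup_least)
      fix n assume "n \<in> {enat (length xs) | xs. regular_sequence R M xs \<and> set xs \<subseteq> max_ideal R}"
      then obtain xs where "n = enat (length xs)" "regular_sequence R M xs" "set xs \<subseteq> max_ideal R" by blast
      then show "n \<le> enat t'" using no t by force
    qed
    then have "enat t \<le> enat t'" using depth False unfolding depth_def by (simp del: enat_ord_simps)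
    then show False using t by simp
  qed
  then obtain xs where xs: "regular_sequence R M xs" "set xs \<subseteq> max_ideal R" "t \<le> length xs" by blast
  show ?thesis
    using depth_ge_if_regular_sequence[OF M xs(1,2), of t 0] xs(3) seq_submodule_Nil[OF M] by simp
qed

text \<open>The nonvanishing condition comes from locality: the ideal generated by the sequence
  stays inside the maximal ideal and so misses \<open>\<one>\<close>.\<close>

lemma regular_sequence_self_if_weakly_regular:
  assumes xs: "set xs \<subseteq> max_ideal R" and reg: "weakly_regular (self_module R) xs"
  shows "regular_sequence R (self_module R) (rev xs)"
proof -
  let ?S = "self_module R"
  have S: "module R ?S" by (rule self_module_module) (rule is_cring)
  interpret S: module R ?S by (rule S)
  have xc: "set xs \<subseteq> carrier R" using xs max_ideal_closed by blast
  have "\<forall>i<length xs. nonzerodivisor_on (quot_module ?S (seq_submodule ?S (take i (rev xs)))) (rev xs ! i)"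
    using xc reg
  proof (induction xs)
    case (Cons x xs)
    have sub: "submodule (seq_submodule ?S (rev xs)) R ?S"
      by (rule seq_submodule_submodule[OF S]) (use Cons.prems in auto)
    have "nonzerodivisor_on (quot_module ?S (seq_submodule ?S (rev xs))) x"
      using nonzerodivisor_on_quot_module_iff[OF S sub, of x] Cons.prems seq_submodule_rev[OF S, of xs] by simp
    then show ?case using Cons by (auto simp: nth_append less_Suc_eq)
  qed simp
  moreover have "\<not> zero_module (quot_module ?S (seq_submodule ?S (rev xs)))"
  proof
    let ?H = "seq_submodule ?S (rev xs)"
    have H: "submodule ?H R ?S" by (rule seq_submodule_submodule[OF S]) (use xc in auto)
    have mm: "submodule (max_ideal R) R ?S"
    proof (rule S.submoduleI)
      interpret I: ideal "max_ideal R" R by (rule max_ideal_ideal)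
      show "max_ideal R \<subseteq> carrier ?S" using max_ideal_closed by auto
      show "\<ominus>\<^bsub>?S\<^esub> a \<in> max_ideal R" if a: "a \<in> max_ideal R" for a
      proof -
        have "\<ominus>\<^bsub>?S\<^esub> a = \<ominus> a" using a max_ideal_closed
          by (intro S.M.minus_equality) (auto simp: l_neg)
        then show ?thesis using a by simp
      qed
    qed (auto simp: ideal.I_l_closed[OF max_ideal_ideal] additive_subgroup.a_closed[OF ideal.axioms(1)[OF max_ideal_ideal]]
        additive_subgroup.zero_closed[OF ideal.axioms(1)[OF max_ideal_ideal]])
    have "seq_mult ?S (carrier R) ys \<subseteq> max_ideal R" if "set ys \<subseteq> max_ideal R" for ys
      using that
    proof (induction ys)
      case Nil then show ?case using S.submodule_zero[OF mm] by simp
    next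
      case (Cons y ys)
      then show ?case
        using ideal.I_r_closed[OF max_ideal_ideal, of y]
          S.adjoin_minimal[OF mm, of "seq_mult ?S (carrier R) ys" "carrier R" y] by simp
    qed
    then have "?H \<subseteq> max_ideal R" using seq_submodule_rev[OF S xc] xs by simp
    then have one: "\<one> \<notin> ?H" using one_notin_max_ideal by blast
    assume "zero_module (quot_module ?S ?H)"
    then have "?H +>\<^bsub>?S\<^esub> \<one> = ?H"
      unfolding zero_module_def quot_module_def A_RCOSETS_def' by auto
    then show False using S.quot_module_coset_eq_iff[OF H, of "\<one>"] one by simp
  qed
  ultimately show ?thesis unfolding regular_sequence_def using xc by simp
qed

text \<open>If the quotient of the ring by the sequence had zero socle, prime avoidance would extend
  the sequence to a regular one of length \<open>t + 1\<close>, against the value of the depth. The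
  element \<open>s\<close> represents a nonzero socle class.\<close>

lemma common_maximal_regular_sequence:
  fixes X :: "('a, 'm) module" and Y :: "('a, 'n) module"
  assumes depth: "depth R (self_module R) = enat t" and X: "X \<in> Deep R" and Y: "Y \<in> Deep R"
  shows "\<exists>xs s. length xs = t \<and> set xs \<subseteq> max_ideal R \<and>
    weakly_regular (self_module R) xs \<and> weakly_regular X xs \<and> weakly_regular Y xs \<and>
    s \<in> carrier R \<and> s \<notin> seq_mult (self_module R) (carrier R) xs \<and>
    (\<forall>a\<in>max_ideal R. a \<otimes> s \<in> seq_mult (self_module R) (carrier R) xs)"
proof -
  let ?S = "self_module R"
  have S: "module R ?S" by (rule self_module_module) (rule is_cring)
  interpret S: module R ?S by (rule S)
  have mX: "module R X" "noetherian_module R X" and mY: "module R Y" "noetherian_module R Y"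
    using X Y fg_module_noetherian[OF noetherian_ring_axioms] by (auto simp: Deep_def fg_module_def)
  have "\<exists>xs. length xs = t \<and> set xs \<subseteq> max_ideal R \<and> weakly_regular ?S (xs @ []) \<and>
      weakly_regular X (xs @ []) \<and> weakly_regular Y (xs @ [])"
    using depth_ge_if_depth[OF S, of t] depth_ge_if_depth[OF mX(1), of t] depth_ge_if_depth[OF mY(1), of t]
      depth X Y
    by (intro common_weakly_regular_sequence S self_module_noetherian mX mY) (auto simp: Deep_def)
  then obtain xs where xs: "length xs = t" "set xs \<subseteq> max_ideal R" "weakly_regular ?S xs"
    "weakly_regular X xs" "weakly_regular Y xs" by auto
  let ?I = "seq_mult ?S (carrier ?S) xs"
  have I: "submodule ?I R ?S"
    using S.seq_mult_submodule[OF S.carrier_is_submodule] xs(2) max_ideal_closed by blast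
  have "\<not> socle_free R ?S ?I"
  proof
    assume "socle_free R ?S ?I"
    then obtain z where z: "z \<in> max_ideal R" "regular_mod ?S ?I z"
      using avoid[OF zero_divisors_avoidable[OF S self_module_noetherian I]] max_ideal_closed by blast
    have "regular_sequence R ?S (rev (z # xs))"
      by (rule regular_sequence_self_if_weakly_regular) (use z xs in auto)
    then have "enat (length (rev (z # xs))) \<in>
        {enat (length xs) | xs. regular_sequence R ?S xs \<and> set xs \<subseteq> max_ideal R}"
      using z(1) xs(2) by (intro CollectI exI[of _ "rev (z # xs)"]) auto
    then have "enat (length (rev (z # xs))) \<le>
        Sup {enat (length xs) | xs. regular_sequence R ?S xs \<and> set xs \<subseteq> max_ideal R}"
      by (rule Sup_upper)
    \<comment> \<open>Otherwise the depth would be \<open>\<infinity>\<close> by convention and not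
      the supremum.\<close>
    moreover have "\<not> zero_module ?S" using depth unfolding depth_def by auto
    ultimately show False using depth xs(1) unfolding depth_def by simp
  qed
  then show ?thesis using xs unfolding socle_free_def by auto
qed

end

subsection \<open>Powers and modules of homomorphisms\<close>

lemma power_module_simps [simp]:
  "carrier (power_module M n) = {..<n} \<rightarrow>\<^sub>E carrier M"
  "zero (power_module M n) = (\<lambda>i\<in>{..<n}. \<zero>\<^bsub>M\<^esub>)"
  "add (power_module M n) = (\<lambda>v w. \<lambda>i\<in>{..<n}. v i \<oplus>\<^bsub>M\<^esub> w i)"
  "smult (power_module M n) = (\<lambda>a v. \<lambda>i\<in>{..<n}. a \<odot>\<^bsub>M\<^esub> v i)"
  by (simp_all add: power_module_def)

lemma Hom_module_simps [simp]:
  "carrier (Hom_module R M N) = mod_hom R M N"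
  "zero (Hom_module R M N) = (\<lambda>x\<in>carrier M. \<zero>\<^bsub>N\<^esub>)"
  "add (Hom_module R M N) = (\<lambda>f g. \<lambda>x\<in>carrier M. f x \<oplus>\<^bsub>N\<^esub> g x)"
  "smult (Hom_module R M N) = (\<lambda>a f. \<lambda>x\<in>carrier M. a \<odot>\<^bsub>N\<^esub> f x)"
  by (simp_all add: Hom_module_def)

lemma power_module_module:
  assumes "module R M" shows "module R (power_module M n)"
proof -
  interpret module R M by fact
  have mem: "v i \<in> carrier M" if "v \<in> {..<n} \<rightarrow>\<^sub>E carrier M" "i < n" for v i
    using that by (auto dest: PiE_mem)
  have eqI: "v = w" if "v \<in> {..<n} \<rightarrow>\<^sub>E carrier M" "w \<in> {..<n} \<rightarrow>\<^sub>E carrier M" "\<And>i. i < n \<Longrightarrow> v i = w i" for v w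
    using that by (intro extensionalityI[of v "{..<n}"]) (auto simp: PiE_def)
  let ?P = "power_module M n"
  have add: "v \<oplus>\<^bsub>?P\<^esub> w \<in> carrier ?P" if "v \<in> carrier ?P" "w \<in> carrier ?P" for v w
    using that mem by simp
  have smult: "a \<odot>\<^bsub>?P\<^esub> v \<in> carrier ?P" if "a \<in> carrier R" "v \<in> carrier ?P" for a v
    using that mem by simp
  have zero: "\<zero>\<^bsub>?P\<^esub> \<in> carrier ?P" by simp
  show ?thesis
  proof (rule moduleI)
    show "cring R" by (rule R.is_cring)
    show "abelian_group ?P"
    proof (rule abelian_groupI)
      fix v assume v: "v \<in> carrier ?P"
      show "\<zero>\<^bsub>?P\<^esub> \<oplus>\<^bsub>?P\<^esub> v = v"
        using v mem by (intro eqI) auto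
      have "(\<lambda>i\<in>{..<n}. \<ominus>\<^bsub>M\<^esub> v i) \<oplus>\<^bsub>?P\<^esub> v = \<zero>\<^bsub>?P\<^esub>"
        using v mem by (simp add: M.l_neg cong: restrict_cong)
      then show "\<exists>w\<in>carrier ?P. w \<oplus>\<^bsub>?P\<^esub> v = \<zero>\<^bsub>?P\<^esub>"
        using v mem by (intro bexI[of _ "\<lambda>i\<in>{..<n}. \<ominus>\<^bsub>M\<^esub> v i"]) auto
      fix w assume w: "w \<in> carrier ?P"
      show "v \<oplus>\<^bsub>?P\<^esub> w = w \<oplus>\<^bsub>?P\<^esub> v"
        using v w mem by (simp add: M.a_comm cong: restrict_cong)
      fix u assume u: "u \<in> carrier ?P"
      show "v \<oplus>\<^bsub>?P\<^esub> w \<oplus>\<^bsub>?P\<^esub> u = v \<oplus>\<^bsub>?P\<^esub> (w \<oplus>\<^bsub>?P\<^esub> u)"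
        using u v w mem by (simp add: M.a_assoc cong: restrict_cong)
    qed (rule add zero; assumption)+
    fix v assume v: "v \<in> carrier ?P"
    show "\<one>\<^bsub>R\<^esub> \<odot>\<^bsub>?P\<^esub> v = v" using v mem by (intro eqI) auto
    fix a assume a: "a \<in> carrier R"
    show "a \<odot>\<^bsub>?P\<^esub> v \<in> carrier ?P" by (rule smult[OF a v])
    show "(a \<oplus>\<^bsub>R\<^esub> b) \<odot>\<^bsub>?P\<^esub> v = a \<odot>\<^bsub>?P\<^esub> v \<oplus>\<^bsub>?P\<^esub> b \<odot>\<^bsub>?P\<^esub> v" if "b \<in> carrier R" for b
      using a v that mem by (simp add: smult_l_distr cong: restrict_cong)
    show "(a \<otimes>\<^bsub>R\<^esub> b) \<odot>\<^bsub>?P\<^esub> v = a \<odot>\<^bsub>?P\<^esub> (b \<odot>\<^bsub>?P\<^esub> v)" if "b \<in> carrier R" for b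
      using a v that mem by (simp add: smult_assoc1 cong: restrict_cong)
    show "a \<odot>\<^bsub>?P\<^esub> (v \<oplus>\<^bsub>?P\<^esub> w) = a \<odot>\<^bsub>?P\<^esub> v \<oplus>\<^bsub>?P\<^esub> a \<odot>\<^bsub>?P\<^esub> w" if "w \<in> carrier ?P" for w
      using a v that mem by (simp add: smult_r_distr cong: restrict_cong)
  qed
qed

lemma Hom_module_module:
  assumes "module R A" "module R B" shows "module R (Hom_module R A B)"
proof -
  interpret A: module R A by fact
  interpret B: module R B by fact
  let ?H = "Hom_module R A B"
  have add: "f \<oplus>\<^bsub>?H\<^esub> g \<in> mod_hom R A B" if "f \<in> mod_hom R A B" "g \<in> mod_hom R A B" for f g
    using mod_hom_closed[OF that(1)] mod_hom_closed[OF that(2)] mod_hom_add[OF that(1)] mod_hom_add[OF that(2)]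
      mod_hom_smult[OF that(1)] mod_hom_smult[OF that(2)]
    by (intro mod_homI) (auto simp: B.M.a_ac B.smult_r_distr)
  have smult: "a \<odot>\<^bsub>?H\<^esub> f \<in> mod_hom R A B" if "a \<in> carrier R" "f \<in> mod_hom R A B" for a f
    using that(1) mod_hom_closed[OF that(2)] mod_hom_add[OF that(2)] mod_hom_smult[OF that(2)]
    by (intro mod_homI) (auto simp: B.smult_r_distr B.smult_commute[of _ a])
  have zero: "\<zero>\<^bsub>?H\<^esub> \<in> mod_hom R A B" by (rule mod_homI) auto
  have unit: "a \<odot>\<^bsub>?H\<^esub> f = f" if "f \<in> mod_hom R A B" "\<And>x. x \<in> carrier A \<Longrightarrow> a \<odot>\<^bsub>B\<^esub> f x = f x" for a f
    using mod_hom_extensional[OF that(1)] that(2) by (auto simp: extensional_def)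
  show ?thesis
  proof (rule moduleI)
    show "cring R" by (rule A.R.is_cring)
    show "abelian_group ?H"
    proof (rule abelian_groupI)
      fix f assume f: "f \<in> carrier ?H"
      then have f': "f \<in> mod_hom R A B" by simp
      show "\<zero>\<^bsub>?H\<^esub> \<oplus>\<^bsub>?H\<^esub> f = f"
        using mod_hom_extensional[OF f'] mod_hom_closed[OF f'] by (auto simp: extensional_def)
      show "\<exists>g\<in>carrier ?H. g \<oplus>\<^bsub>?H\<^esub> f = \<zero>\<^bsub>?H\<^esub>"
      proof (rule bexI)
        \<comment> \<open>The additive inverse is taken as the multiple by minus one, so that
          closure under \<open>smult\<close> applies.\<close>
        show "(\<ominus>\<^bsub>R\<^esub> \<one>\<^bsub>R\<^esub>) \<odot>\<^bsub>?H\<^esub> f \<in> carrier ?H" using smult f by simp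
        show "(\<ominus>\<^bsub>R\<^esub> \<one>\<^bsub>R\<^esub>) \<odot>\<^bsub>?H\<^esub> f \<oplus>\<^bsub>?H\<^esub> f = \<zero>\<^bsub>?H\<^esub>"
          using mod_hom_closed[OF f'] by (auto simp: B.smult_l_minus B.M.l_neg intro!: restrict_ext)
      qed
    qed (use add zero in \<open>auto simp: mod_hom_closed B.M.a_ac intro!: restrict_ext\<close>)
  qed (use smult unit in \<open>auto simp: mod_hom_closed B.smult_l_distr B.smult_r_distr B.smult_assoc1 intro!: restrict_ext\<close>)
qed

text \<open>Coordinatewise witnesses can be assembled into vectors, so multiples of a power are the
  power of the multiples. Thus a vector outside the multiples has a single coordinate that shows it;
  both the homomorphism and the retraction of the final proof are found in this way.\<close>

lemma power_module_seq_mult_iff: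
  assumes M: "module R M" and xs: "set xs \<subseteq> carrier R" and v: "v \<in> {..<n} \<rightarrow>\<^sub>E carrier M"
  shows "v \<in> seq_mult (power_module M n) ({..<n} \<rightarrow>\<^sub>E carrier M) xs \<longleftrightarrow>
    (\<forall>i<n. v i \<in> seq_mult M (carrier M) xs)"
  using xs v
proof (induction xs arbitrary: v)
  case Nil
  then show ?case by (auto simp: PiE_def intro!: extensionalityI[of v "{..<n}"])
next
  case (Cons x xs)
  interpret module R M by fact
  let ?E = "{..<n} \<rightarrow>\<^sub>E carrier M"
  have xc: "x \<in> carrier R" and xs: "set xs \<subseteq> carrier R" using Cons.prems by auto
  have sub: "seq_mult M (carrier M) xs \<subseteq> carrier M"
    using submoduleE(1)[OF seq_mult_submodule[OF carrier_is_submodule xs]] .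
  have subE: "seq_mult (power_module M n) ?E xs \<subseteq> ?E"
    using module.submoduleE(1)[OF power_module_module[OF M, of n] module.seq_mult_submodule[OF
      power_module_module[OF M, of n] module.carrier_is_submodule[OF power_module_module[OF M, of n]] xs]] by simp
  show ?case
  proof
    assume "v \<in> seq_mult (power_module M n) ?E (x # xs)"
    then obtain u a where ua: "u \<in> seq_mult (power_module M n) ?E xs" "a \<in> ?E"
      "v = (\<lambda>i\<in>{..<n}. u i \<oplus>\<^bsub>M\<^esub> (\<lambda>i\<in>{..<n}. x \<odot>\<^bsub>M\<^esub> a i) i)" unfolding seq_mult.simps adjoin_def by auto
    show "\<forall>i<n. v i \<in> seq_mult M (carrier M) (x # xs)"
    proof (intro allI impI)
      fix i assume i: "i < n"
      have "v i = u i \<oplus>\<^bsub>M\<^esub> x \<odot>\<^bsub>M\<^esub> a i" using ua(3) i by simp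
      moreover have "u i \<in> seq_mult M (carrier M) xs" using Cons.IH[OF xs] ua(1) subE i by blast
      moreover have "a i \<in> carrier M" using ua(2) i by (auto dest: PiE_mem)
      ultimately show "v i \<in> seq_mult M (carrier M) (x # xs)" unfolding seq_mult.simps adjoin_def by blast
    qed
  next
    assume "\<forall>i<n. v i \<in> seq_mult M (carrier M) (x # xs)"
    then have "\<forall>i<n. \<exists>u a. u \<in> seq_mult M (carrier M) xs \<and> a \<in> carrier M \<and> v i = u \<oplus>\<^bsub>M\<^esub> x \<odot>\<^bsub>M\<^esub> a"
      unfolding seq_mult.simps adjoin_def by blast
    then obtain u a where ua: "\<And>i. i < n \<Longrightarrow> u i \<in> seq_mult M (carrier M) xs \<and> a i \<in> carrier M \<and>
        v i = u i \<oplus>\<^bsub>M\<^esub> x \<odot>\<^bsub>M\<^esub> a i" by metis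
    let ?u = "\<lambda>i\<in>{..<n}. u i" and ?a = "\<lambda>i\<in>{..<n}. a i"
    have uE: "?u \<in> ?E" and aE: "?a \<in> ?E" using ua sub by auto
    have "?u \<in> seq_mult (power_module M n) ?E xs"
      by (subst Cons.IH[OF xs uE]) (simp add: ua)
    moreover have "v = ?u \<oplus>\<^bsub>power_module M n\<^esub> x \<odot>\<^bsub>power_module M n\<^esub> ?a"
      using Cons.prems(2) ua by (intro extensionalityI[of v "{..<n}"]) (auto simp: PiE_def)
    ultimately show "v \<in> seq_mult (power_module M n) ?E (x # xs)"
      unfolding seq_mult.simps adjoin_def using aE by blast
  qed
qed

lemma power_module_weakly_regular:
  assumes M: "module R M" and xs: "set xs \<subseteq> carrier R" and reg: "weakly_regular M xs"
  shows "weakly_regular (power_module M n) xs"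
  using xs reg
proof (induction xs)
  case (Cons x xs)
  interpret module R M by fact
  have xc: "x \<in> carrier R" and xs: "set xs \<subseteq> carrier R" using Cons.prems by auto
  let ?E = "{..<n} \<rightarrow>\<^sub>E carrier M"
  have "v \<in> seq_mult (power_module M n) ?E xs"
    if v: "v \<in> ?E" and xv: "(\<lambda>i\<in>{..<n}. x \<odot>\<^bsub>M\<^esub> v i) \<in> seq_mult (power_module M n) ?E xs" for v
  proof -
    have vi: "v i \<in> carrier M" if "i < n" for i using v that by (auto dest: PiE_mem)
    then have xvE: "(\<lambda>i\<in>{..<n}. x \<odot>\<^bsub>M\<^esub> v i) \<in> ?E" using xc by auto
    have "v i \<in> seq_mult M (carrier M) xs" if "i < n" for i
      using power_module_seq_mult_iff[OF M xs xvE] xv vi that Cons.prems(2) by (simp add: regular_mod_def)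
    then show ?thesis using power_module_seq_mult_iff[OF M xs v] by blast
  qed
  then show ?case using Cons by (simp add: regular_mod_def)
qed simp

subsection \<open>Free modules\<close>

text \<open>Recursion on the number of terms spares the closure conditions attached to sums over
  sets; \<open>lincomb_cong\<close> holds without any.\<close>

primrec lincomb :: "('r, 'm, 'z) module_scheme \<Rightarrow> (nat \<Rightarrow> 'r) \<Rightarrow> (nat \<Rightarrow> 'm) \<Rightarrow> nat \<Rightarrow> 'm" where
  "lincomb M a v 0 = \<zero>\<^bsub>M\<^esub>"
| "lincomb M a v (Suc k) = lincomb M a v k \<oplus>\<^bsub>M\<^esub> a k \<odot>\<^bsub>M\<^esub> v k"

definition unit_vec :: "('r, 'x) ring_scheme \<Rightarrow> nat \<Rightarrow> nat \<Rightarrow> (nat \<Rightarrow> 'r)" where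
  "unit_vec R n i = (\<lambda>j\<in>{..<n}. if j = i then \<one>\<^bsub>R\<^esub> else \<zero>\<^bsub>R\<^esub>)"

definition free_hom ::
    "('r, 'x) ring_scheme \<Rightarrow> nat \<Rightarrow> ('r, 'm) module \<Rightarrow> (nat \<Rightarrow> 'm) \<Rightarrow> ((nat \<Rightarrow> 'r) \<Rightarrow> 'm)" where
  "free_hom R n M v = (\<lambda>a\<in>carrier (free_module R n). lincomb M a v n)"

lemma lincomb_cong:
  "(\<And>i. i < k \<Longrightarrow> a i = a' i) \<Longrightarrow> (\<And>i. i < k \<Longrightarrow> v i = v' i) \<Longrightarrow> lincomb M a v k = lincomb M a' v' k"
  by (induction k) auto

context module
begin

lemma lincomb_submodule:
  assumes "submodule K R M"
  shows "(\<And>i. i < k \<Longrightarrow> a i \<in> carrier R) \<Longrightarrow> (\<And>i. i < k \<Longrightarrow> v i \<in> K) \<Longrightarrow> lincomb M a v k \<in> K"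
  by (induction k) (auto simp: submodule_zero[OF assms] submoduleE(4,5)[OF assms])

lemma lincomb_closed:
  "(\<And>i. i < k \<Longrightarrow> a i \<in> carrier R) \<Longrightarrow> (\<And>i. i < k \<Longrightarrow> v i \<in> carrier M) \<Longrightarrow> lincomb M a v k \<in> carrier M"
  using lincomb_submodule[OF carrier_is_submodule] by blast

lemma lincomb_add:
  assumes "\<And>i. i < k \<Longrightarrow> a i \<in> carrier R" "\<And>i. i < k \<Longrightarrow> b i \<in> carrier R" "\<And>i. i < k \<Longrightarrow> v i \<in> carrier M"
  shows "lincomb M (\<lambda>i. a i \<oplus>\<^bsub>R\<^esub> b i) v k = lincomb M a v k \<oplus>\<^bsub>M\<^esub> lincomb M b v k"
  using assms
proof (induction k)
  case (Suc k)
  have "lincomb M a v k \<in> carrier M" "lincomb M b v k \<in> carrier M" using Suc.prems by (auto intro: lincomb_closed)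
  then show ?case using Suc by (simp add: smult_l_distr M.a_ac)
qed simp

lemma lincomb_smult:
  assumes "r \<in> carrier R" "\<And>i. i < k \<Longrightarrow> a i \<in> carrier R" "\<And>i. i < k \<Longrightarrow> v i \<in> carrier M"
  shows "lincomb M (\<lambda>i. r \<otimes>\<^bsub>R\<^esub> a i) v k = r \<odot>\<^bsub>M\<^esub> lincomb M a v k"
  using assms
proof (induction k)
  case (Suc k)
  have "lincomb M a v k \<in> carrier M" using Suc.prems by (auto intro: lincomb_closed)
  then show ?case using Suc by (simp add: smult_r_distr smult_assoc1)
qed simp

lemma lincomb_unit:
  assumes "\<And>j. j < k \<Longrightarrow> v j \<in> carrier M"
  shows "lincomb M (\<lambda>j. if j = i then \<one>\<^bsub>R\<^esub> else \<zero>\<^bsub>R\<^esub>) v k = (if i < k then v i else \<zero>\<^bsub>M\<^esub>)"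
  using assms by (induction k) (auto simp: less_Suc_eq)

lemma free_mem: "a \<in> carrier (free_module R n) \<Longrightarrow> i < n \<Longrightarrow> a i \<in> carrier R"
  by (auto dest: PiE_mem)

end

context cring
begin

lemma free_module_module: "module R (free_module R n)"
  by (rule power_module_module[OF self_module_module]) (rule is_cring)

lemma unit_vec_closed: "unit_vec R n i \<in> carrier (free_module R n)"
  unfolding unit_vec_def by auto

lemma free_hom_hom:
  assumes "module R V" "\<And>i. i < n \<Longrightarrow> v i \<in> carrier V"
  shows "free_hom R n V v \<in> mod_hom R (free_module R n) V"
proof -
  interpret V: module R V by fact
  interpret F: module R "free_module R n" by (rule free_module_module)
  show ?thesis
  proof (rule mod_homI)
    show "free_hom R n V v \<in> extensional (carrier (free_module R n))" unfolding free_hom_def by simp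
    fix a assume a: "a \<in> carrier (free_module R n)"
    note am = V.free_mem[OF a]
    show "free_hom R n V v a \<in> carrier V"
      unfolding free_hom_def using a am assms(2) by (auto intro: V.lincomb_closed)
    { fix b assume b: "b \<in> carrier (free_module R n)"
      note bm = V.free_mem[OF b]
      have "lincomb V (a \<oplus>\<^bsub>free_module R n\<^esub> b) v n = lincomb V (\<lambda>i. a i \<oplus>\<^bsub>R\<^esub> b i) v n"
        by (rule lincomb_cong) auto
      then show "free_hom R n V v (a \<oplus>\<^bsub>free_module R n\<^esub> b) = free_hom R n V v a \<oplus>\<^bsub>V\<^esub> free_hom R n V v b"
        unfolding free_hom_def using F.M.a_closed[OF a b] a b V.lincomb_add[of n a b v] am bm assms(2)
        by (simp del: power_module_simps) }
    { fix r assume r: "r \<in> carrier R"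
      have "lincomb V (r \<odot>\<^bsub>free_module R n\<^esub> a) v n = lincomb V (\<lambda>i. r \<otimes>\<^bsub>R\<^esub> a i) v n"
        by (rule lincomb_cong) auto
      then show "free_hom R n V v (r \<odot>\<^bsub>free_module R n\<^esub> a) = r \<odot>\<^bsub>V\<^esub> free_hom R n V v a"
        unfolding free_hom_def using F.smult_closed[OF r a] a r V.lincomb_smult[of r n a v] am assms(2)
        by (simp del: power_module_simps) }
  qed
qed

lemma free_hom_unit_vec:
  assumes "module R V" "\<And>i. i < n \<Longrightarrow> v i \<in> carrier V" "i < n"
  shows "free_hom R n V v (unit_vec R n i) = v i"
proof -
  interpret V: module R V by fact
  have "lincomb V (unit_vec R n i) v n = lincomb V (\<lambda>j. if j = i then \<one> else \<zero>) v n"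
    by (rule lincomb_cong) (auto simp: unit_vec_def)
  then show ?thesis unfolding free_hom_def
    using unit_vec_closed[of n i] V.lincomb_unit[of n v i] assms(2,3) by (simp del: power_module_simps)
qed

lemma mod_hom_free:
  assumes "module R V" and f: "f \<in> mod_hom R (free_module R n) V" and a: "a \<in> carrier (free_module R n)"
  shows "f a = lincomb V a (\<lambda>i. f (unit_vec R n i)) n"
proof -
  interpret V: module R V by fact
  let ?F = "free_module R n"
  interpret F: module R ?F by (rule free_module_module)
  note am = V.free_mem[OF a]
  \<comment> \<open>The truncations of \<open>a\<close> to its first \<open>k\<close> coordinates,
    each obtained from the previous one by adding a multiple of a unit vector.\<close>
  have *: "f (\<lambda>i\<in>{..<n}. if i < k then a i else \<zero>) = lincomb V a (\<lambda>i. f (unit_vec R n i)) k" if "k \<le> n" for k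
    using that
  proof (induction k)
    case 0
    have "(\<lambda>i\<in>{..<n}. if i < 0 then a i else \<zero>) = \<zero>\<^bsub>?F\<^esub>" by (simp cong: restrict_cong)
    then show ?case by (simp only: mod_hom_zero[OF F.module_axioms assms(1) f] lincomb.simps)
  next
    case (Suc k)
    let ?t = "\<lambda>k. \<lambda>i\<in>{..<n}. if i < k then a i else \<zero>"
    have "?t (Suc k) = ?t k \<oplus>\<^bsub>?F\<^esub> a k \<odot>\<^bsub>?F\<^esub> unit_vec R n k"
      using Suc.prems am by (auto simp: unit_vec_def less_Suc_eq intro!: restrict_ext)
    moreover have "?t k \<in> carrier ?F" using am by auto
    moreover have "a k \<in> carrier R" using am Suc.prems by simp
    ultimately have "f (?t (Suc k)) = f (?t k) \<oplus>\<^bsub>V\<^esub> a k \<odot>\<^bsub>V\<^esub> f (unit_vec R n k)"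
      using mod_hom_add[OF f] mod_hom_smult[OF f] unit_vec_closed[of n k] F.smult_closed
      by (simp del: power_module_simps)
    then show ?case by (simp only: lincomb.simps Suc.IH[OF Suc_leD[OF Suc.prems]])
  qed
  have "(\<lambda>i\<in>{..<n}. if i < n then a i else \<zero>) = a"
    using a by (intro extensionalityI[of _ "{..<n}"]) (auto simp: PiE_def)
  then show ?thesis using *[OF order_refl] by (simp only:)
qed

text \<open>Evaluation at the unit vectors; the inverse sends \<open>v\<close> to
  \<open>free_hom R n V v\<close>.\<close>

lemma Hom_free_iso:
  assumes V: "module R V"
  shows "(\<lambda>f\<in>mod_hom R (free_module R n) V. \<lambda>i\<in>{..<n}. f (unit_vec R n i))
      \<in> mod_hom R (Hom_module R (free_module R n) V) (power_module V n)" (is "?ev \<in> _")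
    and "bij_betw (\<lambda>f\<in>mod_hom R (free_module R n) V. \<lambda>i\<in>{..<n}. f (unit_vec R n i))
      (carrier (Hom_module R (free_module R n) V)) (carrier (power_module V n))"
proof -
  let ?F = "free_module R n"
  let ?H = "Hom_module R ?F V"
  interpret V: module R V by fact
  interpret F: module R ?F by (rule free_module_module)
  interpret H: module R ?H by (rule Hom_module_module[OF F.module_axioms V])
  show ev: "?ev \<in> mod_hom R ?H (power_module V n)"
  proof (rule mod_homI)
    fix f assume f: "f \<in> carrier ?H"
    show "?ev f \<in> carrier (power_module V n)"
      using f mod_hom_closed[OF _ unit_vec_closed] by auto
    show "?ev (f \<oplus>\<^bsub>?H\<^esub> g) = ?ev f \<oplus>\<^bsub>power_module V n\<^esub> ?ev g" if g: "g \<in> carrier ?H" for g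
      using f g H.M.a_closed[OF f g] unit_vec_closed[of n] by (auto intro!: restrict_ext)
    show "?ev (r \<odot>\<^bsub>?H\<^esub> f) = r \<odot>\<^bsub>power_module V n\<^esub> ?ev f" if r: "r \<in> carrier R" for r
      using f r H.smult_closed[OF r f] unit_vec_closed[of n] by (auto intro!: restrict_ext)
  qed simp
  show "bij_betw ?ev (carrier ?H) (carrier (power_module V n))"
    unfolding bij_betw_def
  proof
    show "inj_on ?ev (carrier ?H)"
    proof (rule inj_onI)
      fix f g assume f: "f \<in> carrier ?H" and g: "g \<in> carrier ?H" and eq: "?ev f = ?ev g"
      have "f (unit_vec R n i) = g (unit_vec R n i)" if "i < n" for i
        using fun_cong[OF eq, of i] f g that by simp
      then have "f a = g a" if "a \<in> carrier ?F" for a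
        using mod_hom_free[OF V _ that, of f] mod_hom_free[OF V _ that, of g] f g
          lincomb_cong[of n a a "\<lambda>i. f (unit_vec R n i)" "\<lambda>i. g (unit_vec R n i)" V] by simp
      then show "f = g" using f g by (intro mod_hom_eqI[of f R ?F V]) auto
    qed
    show "?ev ` carrier ?H = carrier (power_module V n)"
    proof (intro equalityI subsetI)
      fix v assume v: "v \<in> carrier (power_module V n)"
      then have vm: "v i \<in> carrier V" if "i < n" for i using that by (auto dest: PiE_mem)
      have "v = ?ev (free_hom R n V v)"
        using v free_hom_unit_vec[OF V vm] free_hom_hom[OF V vm]
        by (intro extensionalityI[of v "{..<n}"]) (auto simp: PiE_def)
      then show "v \<in> ?ev ` carrier ?H" using free_hom_hom[OF V vm] by (intro image_eqI) auto
    next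
      fix v assume "v \<in> ?ev ` carrier ?H"
      then obtain f where f: "f \<in> carrier ?H" "v = ?ev f" by blast
      show "v \<in> carrier (power_module V n)" unfolding f(2)
        using f(1) mod_hom_closed[OF ev] by blast
    qed
  qed
qed

lemma Hom_free_weakly_regular:
  assumes "module R V" "set xs \<subseteq> carrier R" "weakly_regular V xs"
  shows "weakly_regular (Hom_module R (free_module R n) V) xs"
  using weakly_regular_iso[OF Hom_module_module[OF free_module_module assms(1)] power_module_module[OF assms(1)]
      Hom_free_iso[OF assms(1)] assms(2) power_module_weakly_regular[OF assms]] .

text \<open>For a free source, \<open>Hom\<close> commutes with reduction modulo the sequence: under
  evaluation at the unit vectors the claim becomes the coordinatewise description of multiples in a
  power of \<open>V\<close>. This is the starting point for a general source, which is reached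
  through a resolution.\<close>

lemma Hom_free_seq_mult:
  assumes V: "module R V" and xs: "set xs \<subseteq> carrier R" and f: "f \<in> mod_hom R (free_module R n) V"
    and vals: "\<And>a. a \<in> carrier (free_module R n) \<Longrightarrow> f a \<in> seq_mult V (carrier V) xs"
  shows "f \<in> seq_mult (Hom_module R (free_module R n) V) (mod_hom R (free_module R n) V) xs"
proof -
  let ?H = "Hom_module R (free_module R n) V"
  let ?ev = "\<lambda>f\<in>mod_hom R (free_module R n) V. \<lambda>i\<in>{..<n}. f (unit_vec R n i)"
  have H: "module R ?H" by (rule Hom_module_module[OF free_module_module V])
  interpret H: module R ?H by (rule H)
  note iso = Hom_free_iso[OF V, of n]
  have ev: "?ev f \<in> {..<n} \<rightarrow>\<^sub>E carrier V" using mod_hom_closed[OF iso(1), of f] f by simp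
  have "?ev f \<in> seq_mult (power_module V n) ({..<n} \<rightarrow>\<^sub>E carrier V) xs"
    using power_module_seq_mult_iff[OF V xs ev] vals[OF unit_vec_closed] f by simp
  then have "?ev f \<in> ?ev ` seq_mult ?H (carrier ?H) xs"
    using mod_hom_seq_mult[OF H power_module_module[OF V] iso(1) H.carrier_is_submodule xs]
      bij_betw_imp_surj_on[OF iso(2)] by simp
  then have "f \<in> seq_mult ?H (carrier ?H) xs"
    using inj_on_image_mem_iff[OF bij_betw_imp_inj_on[OF iso(2)], of f "seq_mult ?H (carrier ?H) xs"]
      H.submoduleE(1)[OF H.seq_mult_submodule[OF H.carrier_is_submodule xs]] f by simp
  then show ?thesis by simp
qed

section \<open>Free covers and free resolutions of finite rank\<close>

lemma free_module_noetherian: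
  assumes "noetherian_ring R" shows "noetherian_module R (free_module R n)"
proof -
  let ?F = "free_module R n"
  interpret F: module R ?F by (rule free_module_module)
  let ?S = "unit_vec R n ` {..<n}"
  have S: "?S \<subseteq> carrier ?F" using unit_vec_closed by blast
  have "carrier ?F \<subseteq> submodule_gen R ?F ?S"
  proof
    fix a assume a: "a \<in> carrier ?F"
    let ?id = "\<lambda>a\<in>carrier ?F. a"
    have id: "?id \<in> mod_hom R ?F ?F"
      using F.M.a_closed F.smult_closed by (intro mod_homI) (auto simp del: power_module_simps)
    have "a = lincomb ?F a (\<lambda>i. ?id (unit_vec R n i)) n"
      using mod_hom_free[OF F.module_axioms id a] a by simp
    moreover have "\<dots> \<in> submodule_gen R ?F ?S"
    proof (rule F.lincomb_submodule[OF F.submodule_gen_submodule[OF S]])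
      show "a i \<in> carrier R" if "i < n" for i using F.free_mem[OF a that] .
      show "?id (unit_vec R n i) \<in> submodule_gen R ?F ?S" if "i < n" for i
        using F.submodule_gen_subset[of ?S] unit_vec_closed[of n i] that by auto
    qed
    ultimately show "a \<in> submodule_gen R ?F ?S" by simp
  qed
  then show ?thesis using F.noetherian_moduleI[OF assms _ S] by blast
qed

text \<open>The unit vectors are sent to a finite generating set of \<open>K\<close>. Covering
  submodules, and not only whole modules, is what continues a resolution past a kernel.\<close>

lemma free_cover:
  assumes V: "module R V" "noetherian_module R V" and K: "submodule K R V"
  shows "\<exists>m f. f \<in> mod_hom R (free_module R m) V \<and> f ` carrier (free_module R m) = K"
proof -
  interpret V: module R V by fact
  obtain S where S: "finite S" "S \<subseteq> K" "K \<subseteq> submodule_gen R V S"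
    using V(2) K unfolding noetherian_module_def by blast
  obtain v and m :: nat where v: "S = v ` {i. i < m}" using finite_imp_nat_seg_image_inj_on[OF S(1)] by metis
  have vK: "v i \<in> K" if "i < m" for i using v S(2) that by auto
  then have vV: "v i \<in> carrier V" if "i < m" for i using V.submoduleE(1)[OF K] that by blast
  have f: "free_hom R m V v \<in> mod_hom R (free_module R m) V" by (rule free_hom_hom[OF V(1) vV])
  have "free_hom R m V v ` carrier (free_module R m) \<subseteq> K"
  proof
    fix x assume "x \<in> free_hom R m V v ` carrier (free_module R m)"
    then obtain a where a: "a \<in> carrier (free_module R m)" "x = lincomb V a v m"
      unfolding free_hom_def by (auto simp del: power_module_simps)
    show "x \<in> K" unfolding a(2) using V.free_mem[OF a(1)] vK by (intro V.lincomb_submodule[OF K]) auto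
  qed
  moreover have "S \<subseteq> free_hom R m V v ` carrier (free_module R m)"
  proof
    fix x assume "x \<in> S"
    then obtain i where i: "i < m" "x = v i" using v by blast
    have "x = free_hom R m V v (unit_vec R m i)" using free_hom_unit_vec[OF V(1) vV i(1)] i(2) by simp
    then show "x \<in> free_hom R m V v ` carrier (free_module R m)"
      using unit_vec_closed[of m i] by (rule image_eqI)
  qed
  then have "submodule_gen R V S \<subseteq> free_hom R m V v ` carrier (free_module R m)"
    using V.submodule_gen_minimal mod_hom_image_submodule[OF free_module_module V(1) f
      module.carrier_is_submodule[OF free_module_module]] by blast
  ultimately show ?thesis using f S(3) by blast
qed

text \<open>\<open>Ext\<close> takes its resolution by \<open>SOME\<close>; existence is what
  guarantees that the chosen triple is a resolution.\<close>

lemma free_resolution_exists: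
  assumes noeth: "noetherian_ring R" and M: "fg_module R M"
  shows "\<exists>b d e. free_resolution R M b d e"
proof -
  have mM: "module R M" "noetherian_module R M"
    using M fg_module_noetherian[OF noeth M] by (auto simp: fg_module_def)
  obtain b0 e where e: "e \<in> mod_hom R (free_module R b0) M" "e ` carrier (free_module R b0) = carrier M"
    using free_cover[OF mM module.carrier_is_submodule[OF mM(1)]] by blast
  \<comment> \<open>The choice runs over triples of target rank, source rank and differential. At
    index 0, \<open>P\<close> ties the first differential to the augmentation; \<open>Q\<close> is
    exactness between consecutive differentials.\<close>
  define P where "P = (\<lambda>i::nat. \<lambda>(k, m, d). d \<in> mod_hom R (free_module R m) (free_module R k) \<and>
     (i = 0 \<longrightarrow> k = b0 \<and> d ` carrier (free_module R m) = mod_ker (free_module R b0) M e))"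
  define Q where "Q = (\<lambda>i::nat. \<lambda>(k::nat, m, d) (k', m', d'). k' = m \<and>
     d' ` carrier (free_module R m') = mod_ker (free_module R m) (free_module R k) d)"
  note cover = free_cover[OF free_module_module free_module_noetherian[OF noeth]]
  have "\<exists>f. \<forall>i. P i (f i) \<and> Q i (f i) (f (Suc i))"
  proof (rule dependent_nat_choice)
    show "\<exists>x. P 0 x"
      using cover[OF mod_ker_submodule[OF free_module_module mM(1) e(1)]] unfolding P_def by auto
    show "\<exists>y. P (Suc i) y \<and> Q i x y" if "P i x" for x i
    proof -
      obtain k m d where x: "x = (k, m, d)" by (cases x) auto
      then have d: "d \<in> mod_hom R (free_module R m) (free_module R k)" using that unfolding P_def by simp
      obtain m' d' where "d' \<in> mod_hom R (free_module R m') (free_module R m)"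
        "d' ` carrier (free_module R m') = mod_ker (free_module R m) (free_module R k) d"
        using cover[OF mod_ker_submodule[OF free_module_module free_module_module d]] by blast
      then show ?thesis unfolding P_def Q_def x by (intro exI[of _ "(m, m', d')"]) simp
    qed
  qed
  then obtain f where f: "\<And>i. P i (f i)" "\<And>i. Q i (f i) (f (Suc i))" by blast
  define b where "b i = fst (f i)" for i
  define d where "d i = snd (snd (f i))" for i
  have fi: "f i = (b i, b (Suc i), d i)" for i
    using f(2)[of i] unfolding b_def d_def Q_def by (auto simp: split_beta prod_eq_iff)
  have b0: "b 0 = b0" "d 0 ` carrier (free_module R (b 1)) = mod_ker (free_module R b0) M e"
    using f(1)[of 0] unfolding P_def fi by auto
  have "free_resolution R M b d e"
    unfolding free_resolution_def
  proof (intro conjI allI)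
    show "d i \<in> mod_hom R (free_module R (b (Suc i))) (free_module R (b i))" for i
      using f(1)[of i] unfolding P_def fi by simp
    show "d (Suc i) ` carrier (free_module R (b (Suc (Suc i)))) =
        mod_ker (free_module R (b (Suc i))) (free_module R (b i)) (d i)" for i
      using f(2)[of i] unfolding Q_def fi by simp
  qed (use e b0 in auto)
  then show ?thesis by blast
qed

end

subsection \<open>The functor \<open>Hom\<close> and vanishing of \<open>Ext\<close>\<close>

text \<open>The contravariant functor \<open>Hom(-, V)\<close> on maps. The outer restriction makes
  the result extensional, as \<open>mod_hom\<close> demands; on cochains it agrees with
  \<open>Hom_coboundary\<close>.\<close>

definition Hom_map ::
    "('r, 'x) ring_scheme \<Rightarrow> ('r, 'a) module \<Rightarrow> ('r, 'b) module \<Rightarrow> ('r, 'v) module \<Rightarrow>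
     ('a \<Rightarrow> 'b) \<Rightarrow> ('b \<Rightarrow> 'v) \<Rightarrow> ('a \<Rightarrow> 'v)" where
  "Hom_map R A B V f = (\<lambda>g\<in>mod_hom R B V. compose (carrier A) g f)"

lemma Hom_map_apply: "g \<in> mod_hom R B V \<Longrightarrow> a \<in> carrier A \<Longrightarrow> Hom_map R A B V f g a = g (f a)"
  unfolding Hom_map_def compose_def by simp

lemma Hom_map_closed:
  assumes A: "module R A" and f: "f \<in> mod_hom R A B" and g: "g \<in> mod_hom R B V"
  shows "Hom_map R A B V f g \<in> mod_hom R A V"
proof (rule mod_homI)
  interpret A: module R A by (rule A)
  show "Hom_map R A B V f g \<in> extensional (carrier A)"
    unfolding Hom_map_def using g by (simp add: compose_extensional)
  fix a assume a: "a \<in> carrier A"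
  show "Hom_map R A B V f g a \<in> carrier V"
    using mod_hom_closed[OF g mod_hom_closed[OF f a]] by (simp add: Hom_map_apply[OF g a])
  show "Hom_map R A B V f g (a \<oplus>\<^bsub>A\<^esub> a') = Hom_map R A B V f g a \<oplus>\<^bsub>V\<^esub> Hom_map R A B V f g a'"
    if a': "a' \<in> carrier A" for a'
    using mod_hom_add[OF g mod_hom_closed[OF f a] mod_hom_closed[OF f a']] a a'
    by (simp add: Hom_map_apply[OF g] mod_hom_add[OF f])
  show "Hom_map R A B V f g (r \<odot>\<^bsub>A\<^esub> a) = r \<odot>\<^bsub>V\<^esub> Hom_map R A B V f g a" if r: "r \<in> carrier R" for r
    using mod_hom_smult[OF g r mod_hom_closed[OF f a]] a r
    by (simp add: Hom_map_apply[OF g] mod_hom_smult[OF f])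
qed

lemma Hom_map_hom:
  assumes A: "module R A" and B: "module R B" and V: "module R V" and f: "f \<in> mod_hom R A B"
  shows "Hom_map R A B V f \<in> mod_hom R (Hom_module R B V) (Hom_module R A V)"
proof (rule mod_homI)
  let ?HA = "Hom_module R A V" and ?HB = "Hom_module R B V"
  interpret HA: module R ?HA by (rule Hom_module_module[OF A V])
  interpret HB: module R ?HB by (rule Hom_module_module[OF B V])
  show "Hom_map R A B V f \<in> extensional (carrier ?HB)" unfolding Hom_map_def by simp
  fix g assume g: "g \<in> carrier ?HB"
  then have g': "g \<in> mod_hom R B V" by simp
  have gc: "Hom_map R A B V f g \<in> mod_hom R A V" by (rule Hom_map_closed[OF A f g'])
  then show "Hom_map R A B V f g \<in> carrier ?HA" by simp
  show "Hom_map R A B V f (g \<oplus>\<^bsub>?HB\<^esub> h) = Hom_map R A B V f g \<oplus>\<^bsub>?HA\<^esub> Hom_map R A B V f h"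
    if h: "h \<in> carrier ?HB" for h
  proof (rule mod_hom_eqI)
    have h': "h \<in> mod_hom R B V" using h by simp
    have s: "g \<oplus>\<^bsub>?HB\<^esub> h \<in> mod_hom R B V" using HB.M.a_closed[OF g h] by simp
    show "Hom_map R A B V f (g \<oplus>\<^bsub>?HB\<^esub> h) \<in> mod_hom R A V" by (rule Hom_map_closed[OF A f s])
    show "Hom_map R A B V f g \<oplus>\<^bsub>?HA\<^esub> Hom_map R A B V f h \<in> mod_hom R A V"
      using HA.M.a_closed[of "Hom_map R A B V f g" "Hom_map R A B V f h"] gc Hom_map_closed[OF A f h'] by simp
    fix a assume a: "a \<in> carrier A"
    show "Hom_map R A B V f (g \<oplus>\<^bsub>?HB\<^esub> h) a = (Hom_map R A B V f g \<oplus>\<^bsub>?HA\<^esub> Hom_map R A B V f h) a"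
      unfolding Hom_map_apply[OF s a]
      using a mod_hom_closed[OF f a] Hom_map_apply[OF g' a] Hom_map_apply[OF h' a] by simp
  qed
  show "Hom_map R A B V f (r \<odot>\<^bsub>?HB\<^esub> g) = r \<odot>\<^bsub>?HA\<^esub> Hom_map R A B V f g" if r: "r \<in> carrier R" for r
  proof (rule mod_hom_eqI)
    have s: "r \<odot>\<^bsub>?HB\<^esub> g \<in> mod_hom R B V" using HB.smult_closed[OF r g] by simp
    show "Hom_map R A B V f (r \<odot>\<^bsub>?HB\<^esub> g) \<in> mod_hom R A V" by (rule Hom_map_closed[OF A f s])
    show "r \<odot>\<^bsub>?HA\<^esub> Hom_map R A B V f g \<in> mod_hom R A V"
      using HA.smult_closed[OF r, of "Hom_map R A B V f g"] gc by simp
    fix a assume a: "a \<in> carrier A"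
    show "Hom_map R A B V f (r \<odot>\<^bsub>?HB\<^esub> g) a = (r \<odot>\<^bsub>?HA\<^esub> Hom_map R A B V f g) a"
      unfolding Hom_map_apply[OF s a] using a mod_hom_closed[OF f a] Hom_map_apply[OF g' a] by simp
  qed
qed

lemma Hom_map_inj:
  assumes f: "f ` carrier A = carrier B" shows "inj_on (Hom_map R A B V f) (mod_hom R B V)"
proof (rule inj_onI)
  fix g h assume g: "g \<in> mod_hom R B V" and h: "h \<in> mod_hom R B V"
    and eq: "Hom_map R A B V f g = Hom_map R A B V f h"
  show "g = h"
  proof (rule mod_hom_eqI[OF g h])
    fix x assume "x \<in> carrier B"
    then obtain a where a: "a \<in> carrier A" "x = f a" using f by blast
    then show "g x = h x" using Hom_map_apply[OF g a(1)] Hom_map_apply[OF h a(1)] eq by metis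
  qed
qed

lemma Hom_map_complex:
  assumes A: "module R A" and B: "module R B" and C: "module R C" and V: "module R V"
    and f: "f \<in> mod_hom R A B" and h: "h \<in> mod_hom R B C"
    and zero: "\<And>a. a \<in> carrier A \<Longrightarrow> h (f a) = \<zero>\<^bsub>C\<^esub>"
  shows "Hom_map R B C V h ` mod_hom R C V \<subseteq>
    mod_ker (Hom_module R B V) (Hom_module R A V) (Hom_map R A B V f)"
proof
  fix z assume "z \<in> Hom_map R B C V h ` mod_hom R C V"
  then obtain g where g: "g \<in> mod_hom R C V" "z = Hom_map R B C V h g" by blast
  have z: "z \<in> mod_hom R B V" using Hom_map_closed[OF B h g(1)] g(2) by simp
  have "Hom_map R A B V f z = \<zero>\<^bsub>Hom_module R A V\<^esub>"
  proof (rule mod_hom_eqI)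
    show "Hom_map R A B V f z \<in> mod_hom R A V" by (rule Hom_map_closed[OF A f z])
    show "\<zero>\<^bsub>Hom_module R A V\<^esub> \<in> mod_hom R A V"
      using abelian_groupE(2)[OF module.axioms(2)[OF Hom_module_module[OF A V]]] by simp
    fix a assume a: "a \<in> carrier A"
    have "Hom_map R A B V f z a = z (f a)" by (rule Hom_map_apply[OF z a])
    also have "\<dots> = g (h (f a))" unfolding g(2) by (rule Hom_map_apply[OF g(1) mod_hom_closed[OF f a]])
    finally have "Hom_map R A B V f z a = g (h (f a))" .
    then show "Hom_map R A B V f z a = \<zero>\<^bsub>Hom_module R A V\<^esub> a"
      using zero[OF a] mod_hom_zero[OF C V g(1)] a by simp
  qed
  then show "z \<in> mod_ker (Hom_module R B V) (Hom_module R A V) (Hom_map R A B V f)"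
    unfolding mod_ker_def using z by simp
qed

text \<open>Left exactness: a map \<open>z\<close> that kills the image of \<open>f\<close> kills
  the kernel of \<open>h\<close> and so factors through \<open>h\<close>. The factor
  \<open>g\<close> is defined by an arbitrary choice \<open>s\<close> of preimages, and
  \<open>well_def\<close> shows that the choice does not matter.\<close>

lemma Hom_map_exact:
  assumes A: "module R A" and B: "module R B" and C: "module R C" and V: "module R V"
    and f: "f \<in> mod_hom R A B" and h: "h \<in> mod_hom R B C"
    and exact: "f ` carrier A = mod_ker B C h" and surj: "h ` carrier B = carrier C"
  shows "mod_ker (Hom_module R B V) (Hom_module R A V) (Hom_map R A B V f) =
    Hom_map R B C V h ` mod_hom R C V"
proof
  show "Hom_map R B C V h ` mod_hom R C V \<subseteq>
      mod_ker (Hom_module R B V) (Hom_module R A V) (Hom_map R A B V f)"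
    by (rule Hom_map_complex[OF A B C V f h]) (use exact in \<open>auto simp: mod_ker_def\<close>)
  interpret B: module R B by (rule B)
  interpret C: module R C by (rule C)
  interpret V: module R V by (rule V)
  show "mod_ker (Hom_module R B V) (Hom_module R A V) (Hom_map R A B V f) \<subseteq>
      Hom_map R B C V h ` mod_hom R C V"
  proof
    fix z assume "z \<in> mod_ker (Hom_module R B V) (Hom_module R A V) (Hom_map R A B V f)"
    then have z: "z \<in> mod_hom R B V" and z0: "Hom_map R A B V f z = \<zero>\<^bsub>Hom_module R A V\<^esub>"
      unfolding mod_ker_def by auto
    have ker: "z a = \<zero>\<^bsub>V\<^esub>" if a: "a \<in> carrier B" "h a = \<zero>\<^bsub>C\<^esub>" for a
    proof -
      have "a \<in> mod_ker B C h" unfolding mod_ker_def using a by blast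
      then obtain a' where a': "a' \<in> carrier A" "a = f a'" using exact by blast
      have "z a = Hom_map R A B V f z a'" unfolding a'(2) by (rule Hom_map_apply[OF z a'(1), symmetric])
      then show ?thesis unfolding z0 using a'(1) by simp
    qed
    have well_def: "z a = z a'" if a: "a \<in> carrier B" "a' \<in> carrier B" "h a = h a'" for a a'
    proof -
      have "h (a \<ominus>\<^bsub>B\<^esub> a') = \<zero>\<^bsub>C\<^esub>"
        using mod_hom_minus[OF B C h a(1,2)] a(3) mod_hom_closed[OF h a(2)]
        by (simp add: C.M.minus_eq C.M.r_neg)
      then have "z a \<ominus>\<^bsub>V\<^esub> z a' = \<zero>\<^bsub>V\<^esub>"
        using ker[OF B.M.minus_closed[OF a(1,2)]] mod_hom_minus[OF B V z a(1,2)] by simp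
      then show ?thesis
        using V.minus_add_cancel[of "z a'" "z a"] mod_hom_closed[OF z a(1)] mod_hom_closed[OF z a(2)] by simp
    qed
    define s where "s x = (SOME a. a \<in> carrier B \<and> h a = x)" for x
    have s: "s x \<in> carrier B \<and> h (s x) = x" if "x \<in> carrier C" for x
    proof -
      have "x \<in> h ` carrier B" using that surj by simp
      then have "\<exists>a. a \<in> carrier B \<and> h a = x" by auto
      then show ?thesis unfolding s_def by (rule someI_ex)
    qed
    define g where "g = (\<lambda>x\<in>carrier C. z (s x))"
    have gh: "g (h a) = z a" if "a \<in> carrier B" for a
      using well_def[of "s (h a)" a] s[OF mod_hom_closed[OF h that]] that mod_hom_closed[OF h that]
      unfolding g_def by simp
    have g: "g \<in> mod_hom R C V"
    proof (rule mod_homI)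
      show "g \<in> extensional (carrier C)" unfolding g_def by simp
      fix x assume x: "x \<in> carrier C"
      then have "x \<in> h ` carrier B" using surj by simp
      then obtain a where a: "a \<in> carrier B" "x = h a" by blast
      show "g x \<in> carrier V" using gh a mod_hom_closed[OF z] by simp
      show "g (x \<oplus>\<^bsub>C\<^esub> y) = g x \<oplus>\<^bsub>V\<^esub> g y" if "y \<in> carrier C" for y
      proof -
        have "y \<in> h ` carrier B" using that surj by simp
        then obtain a' where a': "a' \<in> carrier B" "y = h a'" by blast
        have "x \<oplus>\<^bsub>C\<^esub> y = h (a \<oplus>\<^bsub>B\<^esub> a')" using mod_hom_add[OF h a(1) a'(1)] a a' by simp
        then show ?thesis
          using gh[OF B.M.a_closed[OF a(1) a'(1)]] gh[OF a(1)] gh[OF a'(1)]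
            mod_hom_add[OF z a(1) a'(1)] a(2) a'(2) by simp
      qed
      show "g (r \<odot>\<^bsub>C\<^esub> x) = r \<odot>\<^bsub>V\<^esub> g x" if r: "r \<in> carrier R" for r
      proof -
        have "r \<odot>\<^bsub>C\<^esub> x = h (r \<odot>\<^bsub>B\<^esub> a)" using mod_hom_smult[OF h r a(1)] a by simp
        then show ?thesis
          using gh[OF B.smult_closed[OF r a(1)]] gh[OF a(1)] mod_hom_smult[OF z r a(1)] a(2) by simp
      qed
    qed
    have "z = Hom_map R B C V h g"
      by (rule mod_hom_eqI[OF z Hom_map_closed[OF B h g]]) (simp add: Hom_map_apply[OF g] gh)
    then show "z \<in> Hom_map R B C V h ` mod_hom R C V" using g by blast
  qed
qed

text \<open>This is injectivity of \<open>Hom(M, N) / I Hom(M, N) -> Hom(M, N / I N)\<close>.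
  Composed with the augmentation, \<open>f\<close> becomes a 0-cocycle on a free module with values
  in \<open>I N\<close>, hence a multiple of the sequence with cochain coefficients.
  \<open>complex_cocycle_seq_mult\<close> replaces these by 0-cocycles, and the 0-cocycles are
  \<open>Hom(M, N)\<close>.\<close>

lemma (in noetherian_local_ring) Hom_seq_mult_if_Ext_vanishes:
  fixes M :: "('a, 'm) module" and N :: "('a, 'n) module"
  assumes M: "fg_module R M" and N: "module R N"
    and Ext: "\<forall>i. 1 \<le> i \<and> i \<le> t - 1 \<longrightarrow> zero_module (Ext R i M N)"
    and xs: "set xs \<subseteq> carrier R" "weakly_regular N xs" "length xs = t"
    and f: "f \<in> mod_hom R M N" and vals: "\<And>x. x \<in> carrier M \<Longrightarrow> f x \<in> seq_mult N (carrier N) xs"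
  shows "f \<in> seq_mult (Hom_module R M N) (mod_hom R M N) xs"
proof -
  have mM: "module R M" using M by (simp add: fg_module_def)
  obtain b d e where bde: "(SOME (b, d, e). free_resolution R M b d e) = (b, d, e)"
    by (cases "SOME (b, d, e). free_resolution R M b d e") auto
  have "free_resolution R M b d e"
  proof -
    have "\<exists>p. case p of (b, d, e) \<Rightarrow> free_resolution R M b d e"
      using free_resolution_exists[OF noetherian_ring_axioms M] by auto
    from someI_ex[OF this] show ?thesis using bde by simp
  qed
  then have e: "e \<in> mod_hom R (free_module R (b 0)) M" "e ` carrier (free_module R (b 0)) = carrier M"
    and d: "\<And>i. d i \<in> mod_hom R (free_module R (b (Suc i))) (free_module R (b i))"
    and d0: "d 0 ` carrier (free_module R (b (Suc 0))) = mod_ker (free_module R (b 0)) M e"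
    and dd: "\<And>i. d (Suc i) ` carrier (free_module R (b (Suc (Suc i)))) =
          mod_ker (free_module R (b (Suc i))) (free_module R (b i)) (d i)"
    unfolding free_resolution_def by (simp_all del: power_module_simps)
  let ?F = "\<lambda>i. free_module R (b i)"
  let ?C = "\<lambda>i. Hom_module R (?F i) N"
  let ?\<delta> = "\<lambda>i. Hom_map R (?F (Suc i)) (?F i) N (d i)"
  let ?H = "Hom_module R M N" and ?\<epsilon> = "Hom_map R (?F 0) M N e"
  have F: "module R (?F i)" for i by (rule free_module_module)
  have C: "module R (?C i)" for i by (rule Hom_module_module[OF F N])
  have \<delta>: "?\<delta> i \<in> mod_hom R (?C i) (?C (Suc i))" for i by (rule Hom_map_hom[OF F F N d])
  have \<delta>_eq: "?\<delta> i g = Hom_coboundary R b d i g" if "g \<in> carrier (?C i)" for i g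
    using that unfolding Hom_map_def Hom_coboundary_def by simp
  \<comment> \<open>The degree \<open>Suc i\<close> lies between 1 and \<open>t - 1\<close>, where
    \<open>Ext\<close> vanishes. Degree 0 is not among these and is described by left exactness in
    \<open>ker\<close> below.\<close>
  have exact: "mod_ker (?C (Suc i)) (?C (Suc (Suc i))) (?\<delta> (Suc i)) = ?\<delta> i ` carrier (?C i)" if i: "Suc i < t" for i
  proof
    have "d i (d (Suc i) a) = \<zero>\<^bsub>?F i\<^esub>" if "a \<in> carrier (?F (Suc (Suc i)))" for a
      using dd[of i] that unfolding mod_ker_def by blast
    then show "?\<delta> i ` carrier (?C i) \<subseteq> mod_ker (?C (Suc i)) (?C (Suc (Suc i))) (?\<delta> (Suc i))"
      using Hom_map_complex[OF F F F N d d] by simp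
    show "mod_ker (?C (Suc i)) (?C (Suc (Suc i))) (?\<delta> (Suc i)) \<subseteq> ?\<delta> i ` carrier (?C i)"
    proof
      fix z assume z: "z \<in> mod_ker (?C (Suc i)) (?C (Suc (Suc i))) (?\<delta> (Suc i))"
      let ?Z = "Hom_cocycles R b d N (Suc i)" and ?B = "Hom_coboundaries R b d N (Suc i)"
      have zZ: "z \<in> ?Z"
        using z \<delta>_eq[of z "Suc i"] unfolding Hom_cocycles_def mod_ker_def Hom_cochains_def by auto
      have B: "?B = ?\<delta> i ` carrier (?C i)"
        unfolding Hom_coboundaries_def Hom_cochains_def using \<delta>_eq[of _ i] by (auto simp: image_iff)
      have "zero_module (Ext R (Suc i) M N)" using Ext i by auto
      then have zero: "zero_module (Hom_cohomology R b d N (Suc i))" unfolding Ext_def bde by simp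
      \<comment> \<open>Vanishing cohomology makes the coset of every cocycle equal to
        \<open>?B\<close>. As zero is a coboundary, the coset of \<open>z\<close> contains
        \<open>z\<close>, which is therefore a coboundary.\<close>
      have "?B +>\<^bsub>?C (Suc i)\<lparr>carrier := ?Z\<rparr>\<^esub> z = ?B"
        using zero zZ unfolding zero_module_def Hom_cohomology_def quot_module_def A_RCOSETS_def' Hom_cochains_def
        by (simp add: set_eq_iff) blast
      moreover have "\<zero>\<^bsub>?C (Suc i)\<^esub> \<in> ?B"
        unfolding B using mod_hom_zero[OF C C \<delta>] abelian_groupE(2)[OF module.axioms(2)[OF C]] by (metis imageI)
      then have "\<zero>\<^bsub>?C (Suc i)\<^esub> \<oplus>\<^bsub>?C (Suc i)\<^esub> z \<in> ?B +>\<^bsub>?C (Suc i)\<lparr>carrier := ?Z\<rparr>\<^esub> z"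
        unfolding a_r_coset_def' by (auto simp del: Hom_module_simps power_module_simps)
      moreover have "\<zero>\<^bsub>?C (Suc i)\<^esub> \<oplus>\<^bsub>?C (Suc i)\<^esub> z = z"
        using abelian_groupE(5)[OF module.axioms(2)[OF C]] z unfolding mod_ker_def by blast
      ultimately show "z \<in> ?\<delta> i ` carrier (?C i)" unfolding B by simp
    qed
  qed
  have H: "module R ?H" by (rule Hom_module_module[OF mM N])
  interpret H: module R ?H by (rule H)
  have \<epsilon>: "?\<epsilon> \<in> mod_hom R ?H (?C 0)" by (rule Hom_map_hom[OF F mM N e(1)])
  have ker: "mod_ker (?C 0) (?C (Suc 0)) (?\<delta> 0) = ?\<epsilon> ` carrier ?H"
    using Hom_map_exact[OF F F mM N d e(1) d0 e(2)] by simp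
  have \<epsilon>f: "?\<epsilon> f \<in> mod_hom R (?F 0) N" by (rule Hom_map_closed[OF F e(1) f])
  have "?\<epsilon> f a \<in> seq_mult N (carrier N) xs" if "a \<in> carrier (?F 0)" for a
    using Hom_map_apply[OF f that] vals[OF mod_hom_closed[OF e(1) that]] by simp
  then have "?\<epsilon> f \<in> seq_mult (?C 0) (carrier (?C 0)) xs"
    using Hom_free_seq_mult[OF N xs(1) \<epsilon>f] by simp
  then have "?\<epsilon> f \<in> seq_mult (?C 0) (mod_ker (?C 0) (?C (Suc 0)) (?\<delta> 0)) xs"
    using complex_cocycle_seq_mult[of R ?C ?\<delta> t xs 0 "?\<epsilon> f"] C \<delta> exact xs
      Hom_free_weakly_regular[OF N xs(1,2)] ker f by simp
  then have "?\<epsilon> f \<in> ?\<epsilon> ` seq_mult ?H (carrier ?H) xs"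
    unfolding ker mod_hom_seq_mult[OF H C \<epsilon> H.carrier_is_submodule xs(1)] .
  then have "f \<in> seq_mult ?H (carrier ?H) xs"
    using inj_on_image_mem_iff[OF Hom_map_inj[OF e(2)], of f R N "seq_mult ?H (carrier ?H) xs"]
      H.submoduleE(1)[OF H.seq_mult_submodule[OF H.carrier_is_submodule xs(1)]] f by simp
  then show ?thesis by simp
qed

text \<open>Multiplication of \<open>u\<close> by scalars is a section of \<open>p\<close>, so
  \<open>N\<close> is the direct sum of the cyclic submodule of \<open>u\<close>, free of rank one,
  and the kernel of \<open>p\<close>.\<close>

lemma direct_summand_if_retraction:
  fixes R :: "('r, 'x) ring_scheme" and N :: "('r, 'n) module"
  assumes N: "module R N" and p: "p \<in> mod_hom R N (self_module R)"
    and u: "u \<in> carrier N" "p u = \<one>\<^bsub>R\<^esub>"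
  shows "direct_summand R (self_module R) N"
proof -
  interpret N: module R N by fact
  have S: "module R (self_module R)" by (rule self_module_module) (rule N.R.is_cring)
  let ?P = "{a \<odot>\<^bsub>N\<^esub> u | a. a \<in> carrier R}" and ?Q = "mod_ker N (self_module R) p"
  have P: "submodule ?P R N" by (rule N.cyclic_submodule[OF u(1)])
  have Q: "submodule ?Q R N" by (rule mod_ker_submodule[OF N S p])
  have pc: "p x \<in> carrier R" if "x \<in> carrier N" for x using mod_hom_closed[OF p that] by simp
  have pau: "p (a \<odot>\<^bsub>N\<^esub> u) = a" if "a \<in> carrier R" for a
    using mod_hom_smult[OF p that u(1)] u(2) that by simp
  have "?P <+>\<^bsub>N\<^esub> ?Q = carrier N"
  proof (intro equalityI subsetI)
    fix x assume "x \<in> ?P <+>\<^bsub>N\<^esub> ?Q"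
    then show "x \<in> carrier N" unfolding set_add_def' using N.submoduleE(1)[OF P] N.submoduleE(1)[OF Q] by auto
  next
    fix x assume x: "x \<in> carrier N"
    let ?y = "p x \<odot>\<^bsub>N\<^esub> u"
    have y: "?y \<in> carrier N" "?y \<in> ?P" using pc[OF x] u by auto
    have "p (x \<ominus>\<^bsub>N\<^esub> ?y) = \<zero>\<^bsub>R\<^esub>"
    proof -
      interpret S: module R "self_module R" by (rule S)
      have "p (x \<ominus>\<^bsub>N\<^esub> ?y) = p x \<ominus>\<^bsub>self_module R\<^esub> p x"
        using mod_hom_minus[OF N S p x y(1)] pau[OF pc[OF x]] by simp
      then show ?thesis using S.M.r_neg[of "p x"] pc[OF x] by (simp add: S.M.minus_eq)
    qed
    then have "x \<ominus>\<^bsub>N\<^esub> ?y \<in> ?Q" unfolding mod_ker_def using x y by simp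
    moreover have "x = ?y \<oplus>\<^bsub>N\<^esub> (x \<ominus>\<^bsub>N\<^esub> ?y)" using N.minus_add_cancel[OF y(1) x] by simp
    ultimately show "x \<in> ?P <+>\<^bsub>N\<^esub> ?Q" unfolding set_add_def' using y(2) by blast
  qed
  moreover have "?P \<inter> ?Q = {\<zero>\<^bsub>N\<^esub>}"
  proof
    show "?P \<inter> ?Q \<subseteq> {\<zero>\<^bsub>N\<^esub>}" using pau u(1) unfolding mod_ker_def by auto
    show "{\<zero>\<^bsub>N\<^esub>} \<subseteq> ?P \<inter> ?Q" using N.submodule_zero[OF P] N.submodule_zero[OF Q] by blast
  qed
  moreover have "mod_iso R (self_module R) (N\<lparr>carrier := ?P\<rparr>)"
    unfolding mod_iso_def
  proof (rule bexI)
    let ?h = "\<lambda>a\<in>carrier R. a \<odot>\<^bsub>N\<^esub> u"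
    show "?h \<in> mod_hom R (self_module R) (N\<lparr>carrier := ?P\<rparr>)"
      using u by (intro mod_homI) (auto simp: N.smult_l_distr N.smult_assoc1)
    have "inj_on ?h (carrier R)" using pau by (intro inj_onI) (metis restrict_apply')
    then show "bij_betw ?h (carrier (self_module R)) (carrier (N\<lparr>carrier := ?P\<rparr>))"
      unfolding bij_betw_def by (auto simp: image_iff)
  qed
  ultimately show ?thesis unfolding direct_summand_def using P Q by blast
qed

theorem theorem3p6:
  fixes R :: "('r, 'x) ring_scheme"
    and M :: "('r, 'm) module"
    and N :: "('r, 'n) module"
    and t :: nat
  assumes "noetherian_local_ring R"
    and "depth R (self_module R) = enat t"
    and "fg_module R M" and "fg_module R N"
    and "M \<in> Deep R"
    and "N \<in> Omega_Deep R"
    and "Hom_module R M N \<in> DF R"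
    and "\<forall>i. 1 \<le> i \<and> i \<le> t - 1 \<longrightarrow> zero_module (Ext R i M N)"
  shows "direct_summand R (self_module R) N"
proof -
  interpret noetherian_local_ring R by fact
  let ?S = "self_module R" and ?H = "Hom_module R M N"
  have S: "module R ?S" by (rule self_module_module) (rule is_cring)
  have mM: "module R M" and mN: "module R N" using assms(3,4) by (auto simp: fg_module_def)
  have H: "module R ?H" by (rule Hom_module_module[OF mM mN])
  interpret N: module R N by (rule mN)
  obtain n \<iota> \<pi> and X :: "('r, (nat \<Rightarrow> 'r) set) module"
    where X: "X \<in> Deep R" and ses: "short_exact R N \<iota> (free_module R n) \<pi> X"
    using assms(6) unfolding Omega_Deep_def by blast
  obtain k \<theta> \<rho> and Y :: "('r, (nat \<Rightarrow> 'm \<Rightarrow> 'n) set) module"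
    where Y: "Y \<in> Deep R" and ses': "short_exact R ?S \<theta> (power_module ?H k) \<rho> Y"
    using assms(7) unfolding DF_def by blast
  have mX: "module R X" and mY: "module R Y" using X Y by (auto simp: Deep_def fg_module_def)
  obtain xs s where len: "length xs = t" and xs: "set xs \<subseteq> max_ideal R"
    and reg: "weakly_regular ?S xs" "weakly_regular X xs" "weakly_regular Y xs"
    and s: "s \<in> carrier R" "s \<notin> seq_mult ?S (carrier R) xs"
    and soc: "\<And>a. a \<in> max_ideal R \<Longrightarrow> a \<otimes>\<^bsub>R\<^esub> s \<in> seq_mult ?S (carrier R) xs"
    using common_maximal_regular_sequence[OF assms(2) X Y] by blast
  have xc: "set xs \<subseteq> carrier R" using xs max_ideal_closed by blast
  have \<iota>: "\<iota> \<in> mod_hom R N (free_module R n)" and \<pi>: "\<pi> \<in> mod_hom R (free_module R n) X"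
    and \<iota>inj: "inj_on \<iota> (carrier N)" and \<iota>im: "\<iota> ` carrier N = mod_ker (free_module R n) X \<pi>"
    and \<pi>im: "\<pi> ` carrier (free_module R n) = carrier X"
    using ses unfolding short_exact_def by blast+
  have \<theta>: "\<theta> \<in> mod_hom R ?S (power_module ?H k)" and \<rho>: "\<rho> \<in> mod_hom R (power_module ?H k) Y"
    and \<theta>inj: "inj_on \<theta> (carrier ?S)" and \<theta>im: "\<theta> ` carrier ?S = mod_ker (power_module ?H k) Y \<rho>"
    and \<rho>im: "\<rho> ` carrier (power_module ?H k) = carrier Y"
    using ses' unfolding short_exact_def by blast+
  \<comment> \<open>The common leading premises of \<open>exact_weakly_regular\<close> and
    \<open>exact_seq_mult\<close> for the sequence \<open>0 -> N -> R^n -> X -> 0\<close>.\<close>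
  note exN = mN free_module_module mX \<iota> \<pi> \<iota>inj \<iota>im \<pi>im xc reg(2)
  have regN: "weakly_regular N xs"
    by (rule exact_weakly_regular[OF exN power_module_weakly_regular[OF S xc reg(1)]])
  have "\<theta> s \<notin> seq_mult (power_module ?H k) (carrier (power_module ?H k)) xs"
    using exact_seq_mult[OF S power_module_module[OF H] mY \<theta> \<rho> \<theta>inj \<theta>im \<rho>im xc reg(3), of s] s by auto
  moreover have \<theta>s: "\<theta> s \<in> {..<k} \<rightarrow>\<^sub>E carrier ?H" using mod_hom_closed[OF \<theta>, of s] s by simp
  ultimately obtain i where i: "i < k" "\<theta> s i \<notin> seq_mult ?H (carrier ?H) xs"
    using power_module_seq_mult_iff[OF H xc \<theta>s] by auto
  \<comment> \<open>By linearity \<open>\<theta> s\<close> is \<open>s\<close> times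
    \<open>\<theta> \<one>\<close>, so its \<open>i\<close>-th coordinate is \<open>s\<close> times
    the homomorphism \<open>\<phi>\<close>.\<close>
  define \<phi> where "\<phi> = \<theta> \<one>\<^bsub>R\<^esub> i"
  have "\<theta> \<one>\<^bsub>R\<^esub> \<in> {..<k} \<rightarrow>\<^sub>E carrier ?H" using mod_hom_closed[OF \<theta>, of "\<one>\<^bsub>R\<^esub>"] by simp
  then have \<phi>: "\<phi> \<in> mod_hom R M N" unfolding \<phi>_def using i(1) by (auto dest: PiE_mem)
  have "\<theta> s = s \<odot>\<^bsub>power_module ?H k\<^esub> \<theta> \<one>\<^bsub>R\<^esub>"
    using mod_hom_smult[OF \<theta> s(1), of "\<one>\<^bsub>R\<^esub>"] s(1) by simp
  then have \<theta>si: "\<theta> s i = s \<odot>\<^bsub>?H\<^esub> \<phi>" unfolding \<phi>_def using i(1) by simp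
  have s\<phi>: "s \<odot>\<^bsub>?H\<^esub> \<phi> \<in> mod_hom R M N" using module.smult_closed[OF H s(1), of \<phi>] \<phi> by simp
  have "\<exists>m\<in>carrier M. s \<odot>\<^bsub>N\<^esub> \<phi> m \<notin> seq_mult N (carrier N) xs"
  proof (rule ccontr)
    assume "\<not> ?thesis"
    then have "s \<odot>\<^bsub>?H\<^esub> \<phi> \<in> seq_mult ?H (mod_hom R M N) xs"
      using Hom_seq_mult_if_Ext_vanishes[OF assms(3) mN assms(8) xc regN len s\<phi>] by simp
    then show False using i(2) \<theta>si by simp
  qed
  then obtain m where m: "m \<in> carrier M" "s \<odot>\<^bsub>N\<^esub> \<phi> m \<notin> seq_mult N (carrier N) xs" by blast
  have \<phi>m: "\<phi> m \<in> carrier N" by (rule mod_hom_closed[OF \<phi> m(1)])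
  have s\<phi>m: "s \<odot>\<^bsub>N\<^esub> \<phi> m \<in> carrier N" using \<phi>m s by simp
  have "\<iota> (s \<odot>\<^bsub>N\<^esub> \<phi> m) \<notin> seq_mult (free_module R n) (carrier (free_module R n)) xs"
    using exact_seq_mult[OF exN s\<phi>m] m(2) by blast
  moreover have "\<iota> (s \<odot>\<^bsub>N\<^esub> \<phi> m) \<in> {..<n} \<rightarrow>\<^sub>E carrier ?S" using mod_hom_closed[OF \<iota> s\<phi>m] by simp
  ultimately obtain j where j: "j < n" "\<iota> (s \<odot>\<^bsub>N\<^esub> \<phi> m) j \<notin> seq_mult ?S (carrier ?S) xs"
    using power_module_seq_mult_iff[OF S xc, of "\<iota> (s \<odot>\<^bsub>N\<^esub> \<phi> m)" n] by auto
  \<comment> \<open>\<open>\<iota>\<close> followed by the coordinate in which the image of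
    \<open>s \<phi>(m)\<close> escapes the ideal of the sequence.\<close>
  define p where "p = (\<lambda>u\<in>carrier N. \<iota> u j)"
  have p: "p \<in> mod_hom R N ?S"
    unfolding p_def using j(1) mod_hom_closed[OF \<iota>] mod_hom_add[OF \<iota>] mod_hom_smult[OF \<iota>]
    by (intro mod_homI) (auto dest: PiE_mem)
  define c where "c = p (\<phi> m)"
  have c: "c \<in> carrier R" unfolding c_def using mod_hom_closed[OF p \<phi>m] by simp
  have "\<iota> (s \<odot>\<^bsub>N\<^esub> \<phi> m) j = c \<otimes>\<^bsub>R\<^esub> s"
    using mod_hom_smult[OF p s(1) \<phi>m] s\<phi>m c s(1) m_comm unfolding c_def p_def by simp
  then have "c \<notin> max_ideal R" using soc j(2) by auto
  then obtain b where b: "b \<in> carrier R" "b \<otimes>\<^bsub>R\<^esub> c = \<one>\<^bsub>R\<^esub>" using unit_if_notin_max_ideal[OF c] by blast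
  have "p (b \<odot>\<^bsub>N\<^esub> \<phi> m) = \<one>\<^bsub>R\<^esub>" using mod_hom_smult[OF p b(1) \<phi>m] b(2) unfolding c_def by simp
  then show ?thesis using direct_summand_if_retraction[OF mN p] b(1) \<phi>m by blast
qed

end
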